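(* Let $N\ge1$, let $Q\in\mathcal B^{N\times N}$ with $\mathrm{trace}\,Q=0$ (pointwise on the unit circle), and let $a\in\mathcal B$. Then $$E(e^{aI_N+Q})=\exp\Big(N\cdot\mathrm{trace}\,H(a)H(\tilde a)\Big)\cdot E(e^Q).$$
   Context: $\mathcal B$ is the Banach algebra of all functions $\phi\in L^1(\mathbb T)$ on the unit circle $\mathbb T$ whose Fourier coefficients $\phi_k=\frac1{2\pi}\int_0^{2\pi}\phi(e^{ix})e^{-ikx}dx$ satisfy $$\|\phi\|_{\mathcal B}:=\sum_{k\in\mathbb Z}|\phi_k|+\Big(\sum_{k\in\mathbb Z}|k|\,|\phi_k|^2\Big)^{1/2}<\infty,$$ with pointwise operations; its elements are continuous functions. $\mathcal B^{N\times N}$ is the algebra of $N\times N$ matrix functions with entries in $\mathcal B$, and $I_N$ is the $N\times N$ identity matrix. For $\phi\in L^\infty(\mathbb T)^{N\times N}$ the Toeplitz and Hankel operators on $(\ell^2(\mathbb Z_+))^N$, $\mathbb Z_+=\{0,1,2,\dots\}$, are $T(\phi)=(\phi_{j-k})_{j,k\ge0}$ and $H(\phi)=(\phi_{j+k+1})_{j,k\ge0}$. Also $\tilde a(e^{ix})=a(e^{-ix})$. Hankel operators with symbols in $\mathcal B$ are Hilbert–Schmidt. For invertible $\phi\in\mathcal B^{N\times N}$, $E(\phi)$ is the operator determinant $E(\phi)=\det\big(T(\phi)T(\phi^{-1})\big)$, where $T(\phi)T(\phi^{-1})=I-H(\phi)H(\tilde\phi^{-1})$ is the identity plus a trace class operator.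 *)

theory Defs
  imports "HOL-Analysis.Analysis"
begin

text \<open>Functions on the unit circle are functions on \<^typ>\<open>complex\<close> of which only the values on
  \<^term>\<open>sphere 0 1 :: complex set\<close> matter.\<close>

definition fourier :: "(complex \<Rightarrow> complex) \<Rightarrow> int \<Rightarrow> complex" where
  "fourier \<phi> k =
     integral {0..2 * pi} (\<lambda>x. \<phi> (cis x) * cis (- (of_int k * x))) / of_real (2 * pi)"

text \<open>The algebra \<open>\<B>\<close>. An integrable function with absolutely summable Fourier coefficients
  agrees almost everywhere with exactly one continuous function; elements of \<open>\<B>\<close> are taken to be
  these continuous representatives. The two summability conditions express that the
  two series in the norm of \<open>\<B>\<close> are finite.\<close>

definition krein_algebra :: "(complex \<Rightarrow> complex) set" where
  "krein_algebra = {\<phi>. continuous_on (sphere 0 1) \<phi>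
     \<and> (\<lambda>k. norm (fourier \<phi> k)) summable_on UNIV
     \<and> (\<lambda>k. of_int \<bar>k\<bar> * (norm (fourier \<phi> k))\<^sup>2) summable_on UNIV}"

definition krein_matrix_algebra :: "(complex \<Rightarrow> complex^'n^'n) set" where
  "krein_matrix_algebra = {\<phi>. \<forall>i j. (\<lambda>z. \<phi> z $ i $ j) \<in> krein_algebra}"

definition matrix_fourier :: "(complex \<Rightarrow> complex^'n^'n) \<Rightarrow> int \<Rightarrow> complex^'n^'n" where
  "matrix_fourier \<phi> k = (\<chi> i j. fourier (\<lambda>z. \<phi> z $ i $ j) k)"

text \<open>On the circle, \<^term>\<open>cnj (cis x) = cis (- x)\<close>.\<close>

definition reflect :: "(complex \<Rightarrow> 'a) \<Rightarrow> complex \<Rightarrow> 'a" where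
  "reflect \<phi> z = \<phi> (cnj z)"

text \<open>The powers are formed with the matrix product \<open>**\<close>, since \<open>*\<close> is componentwise on
  the type of matrices. In \<open>\<B>\<close>, where the
  operations are pointwise, the exponential of a matrix function is the pointwise one.\<close>

definition matrix_exp :: "complex^'n^'n \<Rightarrow> complex^'n^'n" where
  "matrix_exp A = (\<Sum>k. (1 / fact k) *\<^sub>R (((**) A) ^^ k) (mat 1))"

text \<open>Operators on the Hilbert space of square-summable sequences \<^typ>\<open>nat \<Rightarrow> complex^'n\<close> are
  represented by functions on all sequences; their values outside that space are
  irrelevant. On that space, the series defining Toeplitz and Hankel operators with bounded
  symbols converge, and the product of operators is composition.\<close>

type_synonym 'n seq_operator = "(nat \<Rightarrow> complex^'n) \<Rightarrow> (nat \<Rightarrow> complex^'n)"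

definition toeplitz :: "(complex \<Rightarrow> complex^'n^'n) \<Rightarrow> 'n seq_operator" where
  "toeplitz \<phi> f = (\<lambda>j. \<Sum>\<^sub>\<infinity>k. matrix_fourier \<phi> (int j - int k) *v f k)"

definition hankel :: "(complex \<Rightarrow> complex^'n^'n) \<Rightarrow> 'n seq_operator" where
  "hankel \<phi> f = (\<lambda>j. \<Sum>\<^sub>\<infinity>k. matrix_fourier \<phi> (int j + int k + 1) *v f k)"

text \<open>Scalar Hankel operators are the case of \<open>1 \<times> 1\<close> matrix symbols.\<close>

abbreviation scalar_hankel :: "(complex \<Rightarrow> complex) \<Rightarrow> 1 seq_operator" where
  "scalar_hankel \<phi> \<equiv> hankel (\<lambda>z. mat (\<phi> z))"

definition std_basis :: "nat \<times> 'n \<Rightarrow> nat \<Rightarrow> complex^'n" where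
  "std_basis q = (\<lambda>j. if j = fst q then axis (snd q) 1 else 0)"

definition op_entry :: "'n::finite seq_operator \<Rightarrow> nat \<times> 'n \<Rightarrow> nat \<times> 'n \<Rightarrow> complex" where
  "op_entry A p q = A (std_basis q) (fst p) $ snd p"

definition op_trace :: "'n::finite seq_operator \<Rightarrow> complex" where
  "op_trace A = (\<Sum>\<^sub>\<infinity>p. op_entry A p p)"

text \<open>The principal minor of the matrix of \<open>K\<close> belonging to a finite set \<open>S\<close> of basis vectors: the
  diagonal entry of the exterior power of \<open>K\<close> of order \<^term>\<open>card S\<close> at their wedge product.\<close>

definition principal_minor :: "'n::finite seq_operator \<Rightarrow> (nat \<times> 'n) set \<Rightarrow> complex" where
  "principal_minor K S =
     (\<Sum>p | p permutes S. of_int (sign p) * (\<Prod>q\<in>S. op_entry K q (p q)))"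

text \<open>The operator (Fredholm) determinant of \<open>A = I + K\<close> with \<open>K\<close> trace class,
  \<open>det (I + K) = \<Sum>\<^sub>m trace (\<Lambda>\<^sup>m K)\<close>, where the traces of the exterior powers are
  written out in the orthonormal basis of wedge products of standard basis vectors.
  The resulting series converges absolutely for trace class \<open>K\<close>.\<close>

definition op_det :: "'n::finite seq_operator \<Rightarrow> complex" where
  "op_det A = (\<Sum>\<^sub>\<infinity>S\<in>{S. finite S}. principal_minor (\<lambda>f j. A f j - f j) S)"

definition E_det :: "(complex \<Rightarrow> complex^'n^'n) \<Rightarrow> complex" where
  "E_det \<phi> = op_det (toeplitz \<phi> \<circ> toeplitz (\<lambda>z. matrix_inv (\<phi> z)))"

end

theory Submission
  imports Defs
begin

text \<open>Write \<open>a = a_- + a_+\<close> with negative and nonnegative frequencies. Then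
  \<open>T(e^(a I + Q)) = e^(T(a_-)) T(e^Q) e^(T(a_+))\<close>, and likewise for the inverse symbol. If the symbols are
  trigonometric polynomials, \<open>T(e^Q) = e^(T(Q)) (I + K)\<close> and \<open>T(e^(-Q)) = (I + K') e^(-T(Q))\<close>
  with trace class \<open>K\<close> and \<open>K'\<close>. So both determinants contain the factors
  \<open>det (I + K) det (I + K')\<close>, and their quotient is a determinant of a product of multiplicative commutators of
  \<open>e^(T(a_-))\<close>, \<open>e^(T(a_+))\<close> and \<open>e^(T(Q))\<close>. By the Helton-Howe-Pincus formula
  \<open>det (e^A e^B e^(-A) e^(-B)) = exp (trace [A, B])\<close> it is the exponential of a sum of traces of additive
  commutators. Those with \<open>T(Q)\<close> vanish as \<open>trace Q = 0\<close>, and the remaining one is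
  \<open>[T(a_-), T(a_+)] = H(a_+) H(reflect a_-)\<close>.

  For trigonometric polynomials all the trace class operators involved have absolutely summable matrix
  entries, for which the Fredholm determinant is elementary. In the general case the symbols are truncated. The
  matrices of the truncated exponentials are dominated entrywise by one exponential with
  Hilbert-Schmidt off-diagonal blocks, and Hadamard's inequality turns this into a summable bound for the
  principal minors, so that the determinants converge.\<close>

section \<open>Determinants over finite index sets\<close>

text \<open>The determinant is a series of principal minors in one fixed basis, so its algebra is
  proved for finite matrices and transported along finite index sets. Trace norms are replaced by
  absolute sums of matrix entries. Matrices with such sums form an ideal in the algebra of matrices
  with bounded absolute row and column sums; that algebra is complete, so the exponential exists in
  it, and it contains the Laurent matrices of absolutely convergent Fourier series. Toeplitz
  matrices are corners of bi-infinite matrices, completed by the identity, so that they lie in the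
  same algebra. The obstacle is that this ideal is smaller than the trace class: a product of two
  Hilbert-Schmidt Hankel blocks need not have absolutely summable entries. The commutator calculus
  is therefore confined to trigonometric polynomials, and only the finished identity is passed to
  the limit. The bound on minors used there needs no more than square summable blocks. The factor
  \<open>N\<close> arises because the commutator of the scalar parts has the same diagonal entry in
  each of the \<open>N\<close> components.\<close>

definition det_on :: "('a \<Rightarrow> 'a \<Rightarrow> complex) \<Rightarrow> 'a set \<Rightarrow> complex" where
  "det_on M S = (\<Sum>p | p permutes S. of_int (sign p) * (\<Prod>i\<in>S. M i (p i)))"

lemma det_on_cong:
  assumes "S = S'" "\<And>i j. i \<in> S' \<Longrightarrow> j \<in> S' \<Longrightarrow> M i j = M' i j"
  shows "det_on M S = det_on M' S'"
  unfolding det_on_def assms(1)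
  by (intro sum.cong prod.cong refl arg_cong2[where f = "(*)"] assms(2))
    (auto simp: permutes_in_image)

lemma det_on_empty [simp]: "det_on M {} = 1"
  by (simp add: det_on_def)

lemma det_on_singleton [simp]: "det_on M {i} = M i i"
  by (simp add: det_on_def)

text \<open>Conjugating a permutation by an injection keeps its sign. This serves to split a sum
  type into its two summands and to move minors from natural to integer indices.\<close>

lemma det_on_reindex:
  assumes "inj_on f S" "finite S"
  shows "det_on (\<lambda>i j. M (f i) (f j)) S = det_on M (f ` S)"
proof -
  have b: "bij_betw f S (f ` S)" using assms by (simp add: inj_on_imp_bij_betw)
  have bij: "bij_betw (map_permutation S f) {p. p permutes S} {p. p permutes f ` S}"
  proof -
    have "bij_betw (\<lambda>\<pi> x. if x \<in> f ` S then f (\<pi> (inv_into S f x)) else x)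
        {p. p permutes S} {p. p permutes f ` S}"
      by (rule bij_betw_permutations[OF b])
    also have "(\<lambda>\<pi> x. if x \<in> f ` S then f (\<pi> (inv_into S f x)) else x) = map_permutation S f"
      by (auto simp: map_permutation_def restrict_id_def fun_eq_iff)
    finally show ?thesis .
  qed
  have "det_on M (f ` S) = (\<Sum>p | p permutes S. of_int (sign (map_permutation S f p)) *
      (\<Prod>i\<in>f ` S. M i (map_permutation S f p i)))"
    unfolding det_on_def by (rule sum.reindex_bij_betw[OF bij, symmetric])
  also have "\<dots> = det_on (\<lambda>i j. M (f i) (f j)) S"
    unfolding det_on_def
  proof (intro sum.cong refl, clarify)
    fix p assume p: "p permutes S"
    show "of_int (sign (map_permutation S f p)) * (\<Prod>i\<in>f ` S. M i (map_permutation S f p i)) =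
         of_int (sign p) * (\<Prod>i\<in>S. M (f i) (f (p i)))"
      using assms p
      by (simp add: sign_map_permutation prod.reindex map_permutation_apply)
  qed
  finally show ?thesis ..
qed

lemma det_on_transpose:
  assumes "finite S"
  shows "det_on (\<lambda>i j. M j i) S = det_on M S"
proof -
  have "det_on (\<lambda>i j. M j i) S =
      (\<Sum>p | p permutes S. of_int (sign (inv p)) * (\<Prod>i\<in>S. M (inv p i) i))"
    unfolding det_on_def by (rule sum_permutations_inverse)
  also have "\<dots> = det_on M S"
    unfolding det_on_def
  proof (intro sum.cong refl, clarify)
    fix p assume p: "p permutes S"
    have "(\<Prod>i\<in>S. M (inv p i) i) = (\<Prod>i\<in>S. M (inv p (p i)) (p i))"
      using prod.permute[OF p, of "\<lambda>i. M (inv p i) i"] by (simp add: o_def)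
    also have "\<dots> = (\<Prod>i\<in>S. M i (p i))" using p by (simp add: permutes_inverses)
    finally show "of_int (sign (inv p)) * (\<Prod>i\<in>S. M (inv p i) i) = of_int (sign p) * (\<Prod>i\<in>S.
        M i (p i))"
      using assms p by (simp add: sign_inverse permutes_imp_permutation)
  qed
  finally show ?thesis .
qed

lemma det_on_permute_rows:
  assumes q: "q permutes S" and "finite S"
  shows "det_on (\<lambda>i j. M (q i) j) S = of_int (sign q) * det_on M S"
proof -
  have "det_on (\<lambda>i j. M (q i) j) S =
      (\<Sum>p | p permutes S. of_int (sign (p \<circ> q)) * (\<Prod>i\<in>S. M (q i) ((p \<circ> q) i)))"
    unfolding det_on_def by (rule sum_permutations_compose_right[OF q])
  also have "\<dots> = of_int (sign q) * det_on M S"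
    unfolding det_on_def sum_distrib_left
  proof (intro sum.cong refl, clarify)
    fix p assume p: "p permutes S"
    have "(\<Prod>i\<in>S. M (q i) ((p \<circ> q) i)) = (\<Prod>i\<in>S. M i (p i))"
      using prod.permute[OF q, of "\<lambda>i. M i (p i)"] by (simp add: o_def)
    moreover have "sign (p \<circ> q) = sign p * sign q"
      using p q assms(2) by (auto intro!: sign_compose intro: permutes_imp_permutation)
    ultimately show "of_int (sign (p \<circ> q)) * (\<Prod>i\<in>S. M (q i) ((p \<circ> q) i)) =
        of_int (sign q) * (of_int (sign p) * (\<Prod>i\<in>S. M i (p i)))"
      by (simp add: mult_ac)
  qed
  finally show ?thesis .
qed

lemma det_on_equal_rows:
  assumes "finite S" "i \<in> S" "j \<in> S" "i \<noteq> j" "\<And>k. k \<in> S \<Longrightarrow> M i k = M j k"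
  shows "det_on M S = 0"
proof -
  let ?q = "Transposition.transpose i j"
  have q: "?q permutes S" using assms by (simp add: permutes_swap_id)
  have "det_on (\<lambda>a b. M (?q a) b) S = det_on M S"
    using assms by (intro det_on_cong) (auto simp: Transposition.transpose_def)
  then have "det_on M S = - det_on M S"
    using det_on_permute_rows[OF q assms(1), of M] assms(4) by (simp add: sign_swap_id)
  then show ?thesis by simp
qed

text \<open>Multilinearity in the rows: \<open>\<tau>\<close> chooses the inner index of each row.
  With \<open>J = S\<close> it leads to multiplicativity, for general \<open>J\<close> to the
  Cauchy-Binet formula.\<close>

lemma det_on_sum_product:
  assumes "finite S" "finite J"
  shows "det_on (\<lambda>i j. \<Sum>k\<in>J. A i k * B k j) S =
    (\<Sum>\<tau>\<in>S \<rightarrow>\<^sub>E J. (\<Prod>i\<in>S. A i (\<tau> i)) * det_on (\<lambda>i j. B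
        (\<tau> i) j) S)"
proof -
  have "det_on (\<lambda>i j. \<Sum>k\<in>J. A i k * B k j) S =
      (\<Sum>p | p permutes S. \<Sum>\<tau>\<in>S \<rightarrow>\<^sub>E J. of_int (sign p) * (\<Prod>i\<in>S. A
          i (\<tau> i) * B (\<tau> i) (p i)))"
    unfolding det_on_def using assms by (simp add: prod_sum_PiE sum_distrib_left)
  also have "\<dots> = (\<Sum>\<tau>\<in>S \<rightarrow>\<^sub>E J. \<Sum>p | p permutes S. of_int (sign p) *
      (\<Prod>i\<in>S. A i (\<tau> i) * B (\<tau> i) (p i)))"
    by (rule sum.swap)
  finally show ?thesis
    by (simp add: det_on_def sum_distrib_left prod.distrib mult_ac)
qed

text \<open>Permutations are the identity outside \<open>S\<close>, whereas members of
  \<open>PiE\<close> are undefined there; restriction is the passage between the two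
  encodings.\<close>

lemma inj_on_restrict_permutes: "inj_on (\<lambda>p. restrict p S) {p. p permutes S}"
proof (rule inj_onI)
  fix p q assume pq: "p \<in> {p. p permutes S}" "q \<in> {p. p permutes S}" "restrict p S = restrict q S"
  show "p = q"
  proof
    fix x show "p x = q x"
      using pq by (cases "x \<in> S") (auto simp: permutes_not_in dest: fun_cong[where x = x])
  qed
qed

text \<open>A choice of inner indices that is not injective repeats a row of \<open>B\<close> and
  contributes nothing; on a finite set the remaining ones are permutations.\<close>

lemma det_on_mult:
  assumes "finite S"
  shows "det_on (\<lambda>i j. \<Sum>k\<in>S. A i k * B k j) S = det_on A S * det_on B S"
proof -
  let ?P = "{p. p permutes S}"
  let ?f = "\<lambda>\<tau>. (\<Prod>i\<in>S. A i (\<tau> i)) * det_on (\<lambda>i j. B (\<tau> i) j) S"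
  have "(\<Sum>\<tau>\<in>S \<rightarrow>\<^sub>E S. ?f \<tau>) = (\<Sum>\<tau>\<in>(\<lambda>p. restrict p S)
      ` ?P. ?f \<tau>)"
  proof (rule sum.mono_neutral_right)
    show "finite (S \<rightarrow>\<^sub>E S)" using assms by (simp add: finite_PiE)
    show "(\<lambda>p. restrict p S) ` ?P \<subseteq> S \<rightarrow>\<^sub>E S" by (auto simp: permutes_in_image)
    show "\<forall>\<tau>\<in>(S \<rightarrow>\<^sub>E S) - (\<lambda>p. restrict p S) ` ?P. ?f \<tau> = 0"
    proof
      fix \<tau> assume t: "\<tau> \<in> (S \<rightarrow>\<^sub>E S) - (\<lambda>p. restrict p S) ` ?P"
      have "\<not> inj_on \<tau> S"
      proof
        assume inj: "inj_on \<tau> S"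
        then have "bij_betw \<tau> S S"
          using t assms endo_inj_surj[OF assms _ inj] by (auto simp: bij_betw_def)
        then have "bij_betw (restrict_id \<tau> S) S S"
          by (simp add: bij_betw_restrict_id)
        then have "restrict_id \<tau> S permutes S"
          by (rule bij_imp_permutes) (simp add: restrict_id_def)
        moreover have "\<tau> = restrict (restrict_id \<tau> S) S"
          using t by (auto simp: restrict_id_def fun_eq_iff PiE_def extensional_def)
        ultimately show False using t by blast
      qed
      then obtain i j where "i \<in> S" "j \<in> S" "i \<noteq> j" "\<tau> i = \<tau> j"
        by (auto simp: inj_on_def)
      then show "?f \<tau> = 0" using det_on_equal_rows[OF assms, of i j] by simp
    qed
  qed
  also have "\<dots> = (\<Sum>p\<in>?P. ?f (restrict p S))"
    by (rule sum.reindex[OF inj_on_restrict_permutes, unfolded o_def])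
  also have "\<dots> = (\<Sum>p\<in>?P. of_int (sign p) * (\<Prod>i\<in>S. A i (p i)) * det_on B S)"
  proof (rule sum.cong[OF refl])
    fix p assume p: "p \<in> ?P"
    have "det_on (\<lambda>i j. B (restrict p S i) j) S = det_on (\<lambda>i j. B (p i) j) S"
      by (rule det_on_cong) auto
    then show "?f (restrict p S) = of_int (sign p) * (\<Prod>i\<in>S. A i (p i)) * det_on B S"
      using p assms by (simp add: det_on_permute_rows)
  qed
  finally show ?thesis
    using assms by (simp add: det_on_sum_product det_on_def[of A] sum_distrib_right)
qed

text \<open>A permutation that moves a point of \<open>S\<close> meets a zero entry in that row, so
  only the permutations of \<open>T\<close> survive.\<close>

lemma det_on_diag_rows:
  assumes "finite S" "finite T" "S \<inter> T = {}"
    and "\<And>i j. i \<in> S \<Longrightarrow> j \<in> S \<union> T \<Longrightarrow> M i j = (if i = j then d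
        i else 0)"
  shows "det_on M (S \<union> T) = (\<Prod>i\<in>S. d i) * det_on M T"
proof -
  have "det_on M (S \<union> T) =
     (\<Sum>p | p permutes T. of_int (sign p) * (\<Prod>i\<in>S \<union> T. M i (p i)))"
    unfolding det_on_def
  proof (rule sum.mono_neutral_right)
    show "finite {p. p permutes S \<union> T}" using assms by (simp add: finite_permutations)
    show "{p. p permutes T} \<subseteq> {p. p permutes S \<union> T}" by (auto intro: permutes_subset)
    show "\<forall>p\<in>{p. p permutes S \<union> T} - {p. p permutes T}. of_int (sign p) * (\<Prod>i\<in>S
        \<union> T. M i (p i)) = 0"
    proof
      fix p assume "p \<in> {p. p permutes S \<union> T} - {p. p permutes T}"
      then have p: "p permutes S \<union> T" "\<not> p permutes T" by auto
      have "\<exists>i\<in>S. p i \<noteq> i"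
      proof (rule ccontr)
        assume "\<not> ?thesis"
        then have "p permutes T"
          by (intro permutes_superset[OF p(1)]) auto
        then show False using p by simp
      qed
      then obtain i where i: "i \<in> S" "p i \<noteq> i" by blast
      then have "M i (p i) = 0"
        using assms(4)[of i "p i"] p(1) permutes_in_image[OF p(1), of i] by auto
      then have "(\<Prod>i\<in>S \<union> T. M i (p i)) = 0"
        using i assms by (intro prod_zero) auto
      then show "of_int (sign p) * (\<Prod>i\<in>S \<union> T. M i (p i)) = 0" by simp
    qed
  qed
  also have "\<dots> = (\<Prod>i\<in>S. d i) * det_on M T"
    unfolding det_on_def sum_distrib_left
  proof (intro sum.cong refl, clarify)
    fix p assume p: "p permutes T"
    have "(\<Prod>i\<in>S. M i (p i)) = (\<Prod>i\<in>S. d i)"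
      using assms p by (intro prod.cong refl) (auto simp: permutes_not_in disjoint_iff)
    then show "of_int (sign p) * (\<Prod>i\<in>S \<union> T. M i (p i)) =
        (\<Prod>i\<in>S. d i) * (of_int (sign p) * (\<Prod>i\<in>T. M i (p i)))"
      using assms by (simp add: prod.union_disjoint mult_ac)
  qed
  finally show ?thesis .
qed

lemma det_on_identity_rows:
  assumes "finite S" "finite T" "S \<inter> T = {}"
    and "\<And>i j. i \<in> S \<Longrightarrow> j \<in> S \<union> T \<Longrightarrow> M i j = of_bool (i = j)"
  shows "det_on M (S \<union> T) = det_on M T"
  using det_on_diag_rows[OF assms(1-3), of M "\<lambda>_. 1"] assms(4) by simp

lemma det_on_identity: "finite S \<Longrightarrow> det_on (\<lambda>i j. of_bool (i = j)) S = 1"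
  using det_on_identity_rows[of S "{}" "\<lambda>i j. of_bool (i = j)"] by simp

text \<open>In every row either \<open>K\<close> or the identity is chosen, and \<open>S\<close>
  collects the rows with \<open>K\<close>. This makes finite determinants partial sums of the
  Fredholm series.\<close>

lemma det_on_identity_plus:
  assumes "finite F"
  shows "det_on (\<lambda>i j. of_bool (i = j) + K i j) F = (\<Sum>S\<in>Pow F. det_on K S)"
proof -
  have "det_on (\<lambda>i j. of_bool (i = j) + K i j) F = (\<Sum>p | p permutes F.
      \<Sum>S\<in>Pow F. of_int (sign p) * ((\<Prod>i\<in>S. K i (p i)) * (\<Prod>i\<in>F - S. of_bool (i = p i))))"
    unfolding det_on_def using assms
    by (simp add: add.commute[of "of_bool _"] prod_add sum_distrib_left)
  also have "\<dots> = (\<Sum>S\<in>Pow F. \<Sum>p | p permutes F.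
      of_int (sign p) * ((\<Prod>i\<in>S. K i (p i)) * (\<Prod>i\<in>F - S. of_bool (i = p i))))"
    by (rule sum.swap)
  also have "\<dots> = (\<Sum>S\<in>Pow F. det_on (\<lambda>i j. if i \<in> S then K i j else of_bool (i = j))
      ((F - S) \<union> S))"
    unfolding det_on_def
  proof (intro sum.cong refl)
    fix S p assume S: "S \<in> Pow F"
    then show "{p. p permutes F} = {p. p permutes F - S \<union> S}" by (simp add: Un_absorb2)
    have "(\<Prod>i\<in>F. if i \<in> S then K i (p i) else of_bool (i = p i)) =
        (\<Prod>i\<in>S. K i (p i)) * (\<Prod>i\<in>F - S. of_bool (i = p i))"
      using S assms by (subst prod.subset_diff[of S F]) (auto intro!: arg_cong2[where f = "(*)"])
    then show "of_int (sign p) * ((\<Prod>i\<in>S. K i (p i)) * (\<Prod>i\<in>F - S. of_bool (i = p i))) =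
       of_int (sign p) * (\<Prod>i\<in>F - S \<union> S. if i \<in> S then K i (p i) else of_bool (i = p i))"
      using S by (simp add: Un_absorb2)
  qed
  also have "\<dots> = (\<Sum>S\<in>Pow F. det_on K S)"
  proof (rule sum.cong[OF refl])
    fix S assume S: "S \<in> Pow F"
    then have fin: "finite S" "finite (F - S)" using assms finite_subset by auto
    have "det_on (\<lambda>i j. if i \<in> S then K i j else of_bool (i = j)) ((F - S) \<union> S) =
        det_on (\<lambda>i j. if i \<in> S then K i j else of_bool (i = j)) S"
      by (rule det_on_identity_rows) (use fin in auto)
    also have "\<dots> = det_on K S" by (rule det_on_cong) auto
    finally show "det_on (\<lambda>i j. if i \<in> S then K i j else of_bool (i = j)) ((F - S) \<union> S) =
        det_on K S" .
  qed
  finally show ?thesis .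
qed

text \<open>The block matrix with rows \<open>(1, -A)\<close> and \<open>(B, 1)\<close> is multiplied
  from the right by the unipotent block matrices which clear one of its rows.\<close>

lemma det_on_Sylvester:
  assumes "finite F"
  shows "det_on (\<lambda>i j. of_bool (i = j) + (\<Sum>k\<in>F. A i k * B k j)) F =
    det_on (\<lambda>i j. of_bool (i = j) + (\<Sum>k\<in>F. B i k * A k j)) F"
proof -
  define L R :: "('a + 'a) set" where "L = Inl ` F" and "R = Inr ` F"
  have fin: "finite L" "finite R" "L \<inter> R = {}" "R \<inter> L = {}" using assms by (auto simp: L_def R_def)
  define X :: "'a + 'a \<Rightarrow> 'a + 'a \<Rightarrow> complex" where "X = (\<lambda>i j. case i of
      Inl a \<Rightarrow> (case j of Inl b \<Rightarrow> of_bool (a = b) | Inr b \<Rightarrow> - A a b)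
    | Inr a \<Rightarrow> (case j of Inl b \<Rightarrow> B a b | Inr b \<Rightarrow> of_bool (a = b)))"
  define Y :: "'a + 'a \<Rightarrow> 'a + 'a \<Rightarrow> complex" where "Y = (\<lambda>i j. case i of
      Inl a \<Rightarrow> (case j of Inl b \<Rightarrow> of_bool (a = b) | Inr b \<Rightarrow> A a b)
    | Inr a \<Rightarrow> (case j of Inl b \<Rightarrow> 0 | Inr b \<Rightarrow> of_bool (a = b)))"
  define Y' :: "'a + 'a \<Rightarrow> 'a + 'a \<Rightarrow> complex" where "Y' = (\<lambda>i j. case i of
      Inl a \<Rightarrow> (case j of Inl b \<Rightarrow> of_bool (a = b) | Inr b \<Rightarrow> 0)
    | Inr a \<Rightarrow> (case j of Inl b \<Rightarrow> - B a b | Inr b \<Rightarrow> of_bool (a = b)))"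
  have sumU: "(\<Sum>k\<in>L \<union> R. f k) = (\<Sum>k\<in>F. f (Inl k)) + (\<Sum>k\<in>F. f (Inr k))" for f
      :: "'a + 'a \<Rightarrow> complex"
    using fin by (simp add: sum.union_disjoint L_def R_def sum.reindex)
  have prodl: "(\<Sum>k\<in>F. of_bool (a = k) * f k) = f a" "(\<Sum>k\<in>F. f k * of_bool (k = a)) = f a" if
      "a \<in> F"
    for a and f :: "'a \<Rightarrow> complex"
    using assms that by (simp_all add: of_bool_def if_distrib if_distribR cong: if_cong)
  have detL: "det_on M L = det_on (\<lambda>i j. M (Inl i) (Inl j)) F" for M
    using assms unfolding L_def by (intro det_on_reindex[symmetric]) auto
  have detR: "det_on M R = det_on (\<lambda>i j. M (Inr i) (Inr j)) F" for M
    using assms unfolding R_def by (intro det_on_reindex[symmetric]) auto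
  have "det_on Y (R \<union> L) = det_on Y L"
    by (rule det_on_identity_rows) (use fin in \<open>auto simp: L_def R_def Y_def\<close>)
  also have "\<dots> = 1" using assms by (simp add: detL Y_def det_on_identity)
  finally have Y1: "det_on Y (L \<union> R) = 1" by (simp add: Un_commute)
  have "det_on Y' (L \<union> R) = det_on Y' R"
    by (rule det_on_identity_rows) (use fin in \<open>auto simp: L_def R_def Y'_def\<close>)
  also have "\<dots> = 1" using assms by (simp add: detR Y'_def det_on_identity)
  finally have Y'1: "det_on Y' (L \<union> R) = 1" .
  \<comment> \<open>\<open>X\<close> times \<open>Y\<close> has the block rows \<open>(1, 0)\<close>
    and \<open>(B, 1 + B A)\<close>. Further below, \<open>X\<close> times \<open>Y'\<close> has the
    block rows \<open>(1 + A B, -A)\<close> and \<open>(0, 1)\<close>.\<close>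
  have "det_on X (L \<union> R) = det_on (\<lambda>i j. \<Sum>k\<in>L \<union> R. X i k * Y k j) (L \<union> R)"
    using fin by (simp add: det_on_mult Y1)
  also have "\<dots> = det_on (\<lambda>i j. \<Sum>k\<in>L \<union> R. X i k * Y k j) R"
    by (rule det_on_identity_rows)
      (use fin in \<open>auto simp: L_def R_def X_def Y_def sumU[unfolded L_def R_def] prodl sum_negf\<close>)
  also have "\<dots> = det_on (\<lambda>i j. of_bool (i = j) + (\<Sum>k\<in>F. B i k * A k j)) F"
    unfolding detR by (rule det_on_cong) (auto simp: sumU X_def Y_def prodl)
  finally have 1: "det_on X (L \<union> R) = \<dots>" .
  have "det_on X (L \<union> R) = det_on (\<lambda>i j. \<Sum>k\<in>L \<union> R. X i k * Y' k j) (R \<union> L)"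
    using fin by (simp add: det_on_mult Y'1 Un_commute)
  also have "\<dots> = det_on (\<lambda>i j. \<Sum>k\<in>L \<union> R. X i k * Y' k j) L"
    by (rule det_on_identity_rows)
      (use fin in \<open>auto simp: L_def R_def X_def Y'_def sumU[unfolded L_def R_def] prodl sum_negf\<close>)
  also have "\<dots> = det_on (\<lambda>i j. of_bool (i = j) + (\<Sum>k\<in>F. A i k * B k j)) F"
    unfolding detL by (rule det_on_cong) (auto simp: sumU X_def Y'_def prodl)
  finally show ?thesis using 1 by simp
qed

section \<open>Schur complements, Gram determinants and a Hadamard bound for products\<close>

lemma det_on_pivot:
  assumes "finite S" "r \<notin> S" "M r r \<noteq> 0"
  shows "det_on M (insert r S) = M r r * det_on (\<lambda>i j. M i j - M i r * M r j / M r r) S"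
proof -
  let ?U = "insert r S"
  \<comment> \<open>Right multiplication by \<open>C\<close> subtracts multiples of the pivot column
    from the others. Row \<open>r\<close> then has only its pivot entry left, and the remaining rows
    carry the Schur complement.\<close>
  define C where "C = (\<lambda>k j. of_bool (k = j) - (if k = r \<and> j \<noteq> r then M r j / M r r else 0))"
  have "det_on C (S \<union> {r}) = det_on C {r}"
    by (rule det_on_identity_rows) (use assms in \<open>auto simp: C_def\<close>)
  then have C1: "det_on C ?U = 1" by (simp add: C_def)
  have entry: "(\<Sum>k\<in>?U. M i k * C k j) = M i j - (if j \<noteq> r then M i r * M r j / M r r else 0)"
    if "j \<in> ?U" for i j
  proof -
    have "(\<Sum>k\<in>S. M i k * C k j) = (\<Sum>k\<in>S. if k = j then M i j else 0)"
      using assms(2) by (intro sum.cong) (auto simp: C_def)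
    then show ?thesis using that assms by (auto simp: C_def field_simps)
  qed
  have "det_on M ?U = det_on (\<lambda>i j. \<Sum>k\<in>?U. M i k * C k j) ({r} \<union> S)"
    using assms by (simp add: det_on_mult C1 del: sum.insert)
  also have "\<dots> = (\<Prod>i\<in>{r}. M r r) * det_on (\<lambda>i j. \<Sum>k\<in>?U. M i k * C k j) S"
    by (rule det_on_diag_rows) (use assms in \<open>auto simp: entry simp del: sum.insert\<close>)
  also have "det_on (\<lambda>i j. \<Sum>k\<in>?U. M i k * C k j) S = det_on (\<lambda>i j. M i j - M i r * M r
      j / M r r) S"
    by (rule det_on_cong) (use assms in \<open>auto simp: entry simp del: sum.insert\<close>)
  finally show ?thesis by simp
qed

text \<open>A pivot step replaces the remaining vectors by their components orthogonal to the pivot vector,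
  which are shorter.\<close>

lemma det_on_Gram_bound:
  fixes u :: "'a \<Rightarrow> 'b \<Rightarrow> complex"
  assumes "finite S" "finite J"
  shows "\<exists>d\<ge>0. det_on (\<lambda>i j. \<Sum>k\<in>J. u i k * cnj (u j k)) S = complex_of_real d \<and>
    d \<le> (\<Prod>i\<in>S. \<Sum>k\<in>J. (cmod (u i k))\<^sup>2)"
  using assms(1)
proof (induction S arbitrary: u rule: finite_induct)
  case empty
  show ?case by (intro exI[of _ 1]) simp
next
  case (insert r S)
  define G where "G = (\<lambda>(u :: 'a \<Rightarrow> 'b \<Rightarrow> complex) i j. \<Sum>k\<in>J. u i k *
      cnj (u j k) :: complex)"
  define q where "q = (\<lambda>(u :: 'a \<Rightarrow> 'b \<Rightarrow> complex) i. \<Sum>k\<in>J. (cmod (u i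
      k))\<^sup>2)"
  have Gd: "G u i j = (\<Sum>k\<in>J. u i k * cnj (u j k))" for u i j by (simp add: G_def)
  have Gq: "G u i i = of_real (q u i)" for u i
    by (simp add: G_def q_def complex_norm_square del: of_real_power)
  have q0: "q u i \<ge> 0" for u i by (simp add: q_def sum_nonneg)
  show ?case
  proof (cases "q u r = 0")
    case True
    then have ur: "u r k = 0" if "k \<in> J" for k
      using that assms(2) by (simp add: q_def sum_nonneg_eq_0_iff)
    have "det_on (G u) ({r} \<union> S) = (\<Prod>i\<in>{r}. 0) * det_on (G u) S"
      by (rule det_on_diag_rows) (use insert ur in \<open>auto simp: G_def\<close>)
    then show ?thesis
      using insert q0[of u] unfolding G_def
      by (intro exI[of _ 0]) (auto intro!: prod_nonneg sum_nonneg mult_nonneg_nonneg)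
  next
    case False
    \<comment> \<open>The component of \<open>u i\<close> orthogonal to \<open>u r\<close>.\<close>
    define w where "w = (\<lambda>i k. u i k - G u i r / G u r r * u r k)"
    have nz: "G u r r \<noteq> 0" using False by (simp add: Gq)
    have cG: "cnj (G u i j) = G u j i" for i j by (simp add: G_def mult.commute)
    have expand: "G (\<lambda>i k. u i k - c i * u r k) i j =
        G u i j - cnj (c j) * G u i r - c i * G u r j + c i * cnj (c j) * G u r r" for c i j
      by (simp add: Gd algebra_simps sum.distrib sum_subtractf sum_distrib_left)
    \<comment> \<open>The Gram matrix of the projected vectors is the Schur complement left by the
      pivot step, so the induction hypothesis applies to \<open>w\<close>.\<close>
    have Gw: "G w i j = G u i j - G u i r * G u r j / G u r r" for i j
    proof -
      have "G w i j = G u i j - cnj (G u j r / G u r r) * G u i r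
         - (G u i r / G u r r) * G u r j + (G u i r / G u r r) * cnj (G u j r / G u r r) * G u r r"
        unfolding w_def by (rule expand)
      also have "cnj (G u j r / G u r r) = G u r j / G u r r" by (simp add: cG)
      finally show ?thesis using nz by simp
    qed
    obtain d where d: "d \<ge> 0" "det_on (G w) S = of_real d" "d \<le> (\<Prod>i\<in>S. q w i)"
      using insert.IH[of w] unfolding G_def q_def by blast
    have "det_on (G u) (insert r S) = of_real (q u r * d)"
      using insert nz d(2) unfolding det_on_pivot[where M = "G u", OF insert.hyps(1,2) nz] Gw[symmetric] by
          (simp add: Gq)
    moreover have "(\<Prod>i\<in>S. q w i) \<le> (\<Prod>i\<in>S. q u i)"
    proof (rule prod_mono)
      fix i
      have "complex_of_real (q w i) = of_real (q u i - (cmod (G u i r))\<^sup>2 / q u r)"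
        using Gw[of i i] cG[of i r] by (simp add: Gq complex_norm_square del: of_real_power)
      then have "q w i = q u i - (cmod (G u i r))\<^sup>2 / q u r" using of_real_eq_iff by blast
      then show "0 \<le> q w i \<and> q w i \<le> q u i" using q0[of w i] q0[of u r] by simp
    qed
    ultimately have "\<exists>d\<ge>0. det_on (G u) (insert r S) = of_real d \<and> d \<le>
        (\<Prod>i\<in>insert r S. q u i)"
      using insert.hyps d(1,3) q0
      by (intro exI[of _ "q u r * d"]) (auto intro!: mult_left_mono intro: order_trans)
    then show ?thesis unfolding G_def q_def .
  qed
qed

text \<open>The Cauchy-Binet formula with maps in place of subsets: averaging the row expansion over
  all permutations of \<open>S\<close> turns the product over \<open>A\<close> into a minor. A
  subset of \<open>J\<close> of size \<open>card S\<close> is the image of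
  \<open>fact (card S)\<close> injective maps, which explains the factorial.\<close>

lemma det_on_sum_product_symmetric:
  assumes "finite S" "finite J"
  shows "fact (card S) * det_on (\<lambda>i j. \<Sum>k\<in>J. A i k * B k j) S =
    (\<Sum>\<tau>\<in>S \<rightarrow>\<^sub>E J. det_on (\<lambda>i j. A i (\<tau> j)) S * det_on (\<lambda>i
        j. B (\<tau> i) j) S)"
proof -
  let ?P = "{p. p permutes S}" and ?T = "S \<rightarrow>\<^sub>E J"
  let ?D = "det_on (\<lambda>i j. \<Sum>k\<in>J. A i k * B k j) S"
  have D: "?D = (\<Sum>\<tau>\<in>?T. of_int (sign q) * (\<Prod>i\<in>S. A i (\<tau> (q i))) * det_on
      (\<lambda>i j. B (\<tau> i) j) S)"
    if q: "q permutes S" for q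
  proof -
    let ?r = "\<lambda>q \<tau>. restrict (\<tau> \<circ> q) S"
    have bij: "bij_betw (?r q) ?T ?T"
    proof (rule bij_betw_byWitness[where f' = "?r (inv q)"])
      show "\<forall>\<tau>\<in>?T. ?r (inv q) (?r q \<tau>) = \<tau>" "\<forall>\<tau>\<in>?T. ?r q (?r (inv
          q) \<tau>) = \<tau>"
        using q permutes_inv[OF q]
        by (auto simp: fun_eq_iff restrict_def permutes_in_image permutes_inverses PiE_def extensional_def)
      show "?r q ` ?T \<subseteq> ?T" "?r (inv q) ` ?T \<subseteq> ?T"
        using q permutes_inv[OF q] by (auto simp: permutes_in_image PiE_def Pi_def)
    qed
    have "?D = (\<Sum>\<tau>\<in>?T. (\<Prod>i\<in>S. A i (?r q \<tau> i)) * det_on (\<lambda>i j. B (?r q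
        \<tau> i) j) S)"
      unfolding det_on_sum_product[OF assms]
      by (rule sum.reindex_bij_betw[OF bij, symmetric])
    also have "\<dots> = (\<Sum>\<tau>\<in>?T. of_int (sign q) * (\<Prod>i\<in>S. A i (\<tau> (q i))) * det_on
        (\<lambda>i j. B (\<tau> i) j) S)"
    proof (rule sum.cong[OF refl])
      fix \<tau> assume "\<tau> \<in> ?T"
      have "det_on (\<lambda>i j. B (?r q \<tau> i) j) S = det_on (\<lambda>i j. B (\<tau> (q i)) j) S"
        by (rule det_on_cong) auto
      also have "\<dots> = of_int (sign q) * det_on (\<lambda>i j. B (\<tau> i) j) S"
        by (rule det_on_permute_rows[OF q assms(1)])
      finally show "(\<Prod>i\<in>S. A i (?r q \<tau> i)) * det_on (\<lambda>i j. B (?r q \<tau> i) j) S =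
          of_int (sign q) * (\<Prod>i\<in>S. A i (\<tau> (q i))) * det_on (\<lambda>i j. B (\<tau> i) j) S"
        by simp
    qed
    finally show ?thesis .
  qed
  have "fact (card S) * ?D = (\<Sum>q\<in>?P. ?D)"
    using assms by (simp add: card_permutations)
  also have "\<dots> = (\<Sum>q\<in>?P. \<Sum>\<tau>\<in>?T.
      of_int (sign q) * (\<Prod>i\<in>S. A i (\<tau> (q i))) * det_on (\<lambda>i j. B (\<tau> i) j) S)"
    using D by (intro sum.cong) auto
  also have "\<dots> = (\<Sum>\<tau>\<in>?T. \<Sum>q\<in>?P.
      of_int (sign q) * (\<Prod>i\<in>S. A i (\<tau> (q i))) * det_on (\<lambda>i j. B (\<tau> i) j) S)"
    by (rule sum.swap)
  also have "\<dots> = (\<Sum>\<tau>\<in>?T. det_on (\<lambda>i j. A i (\<tau> j)) S * det_on (\<lambda>i j. B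
      (\<tau> i) j) S)"
    by (intro sum.cong refl) (simp only: det_on_def[of "\<lambda>i j. A i (_ j)"] sum_distrib_right)
  finally show ?thesis .
qed

text \<open>Cauchy-Schwarz in the symmetrised Cauchy-Binet formula separates \<open>A\<close> from
  \<open>B\<close>, and each of the two factors is a Gram determinant. The bound is a product over
  \<open>S\<close>, as summation over all finite \<open>S\<close> requires.\<close>

lemma cmod_det_on_sum_product_le:
  assumes "finite S" "finite J"
  shows "(cmod (det_on (\<lambda>i j. \<Sum>k\<in>J. A i k * B k j) S))\<^sup>2 \<le>
    (\<Prod>i\<in>S. (\<Sum>k\<in>J. (cmod (A i k))\<^sup>2) * (\<Sum>k\<in>J. (cmod (B k i))\<^sup>2))"
proof -
  let ?T = "S \<rightarrow>\<^sub>E J" and ?n = "fact (card S) :: real"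
  \<comment> \<open>The sum of the squared minors equals the factorial times a Gram determinant,
    again by the symmetrised formula; the two factorials cancel at the end.\<close>
  have Gram: "(\<Sum>\<tau>\<in>?T. (cmod (det_on (\<lambda>i j. u i (\<tau> j)) S))\<^sup>2) \<le>
      ?n * (\<Prod>i\<in>S. \<Sum>k\<in>J. (cmod (u i k))\<^sup>2)" for u
  proof -
    obtain d where d: "det_on (\<lambda>i j. \<Sum>k\<in>J. u i k * cnj (u j k)) S = complex_of_real d"
      "d \<le> (\<Prod>i\<in>S. \<Sum>k\<in>J. (cmod (u i k))\<^sup>2)"
      using det_on_Gram_bound[OF assms] by blast
    have c: "det_on (\<lambda>i j. cnj (u j (\<tau> i))) S = cnj (det_on (\<lambda>i j. u i (\<tau> j)) S)" for \<tau>
    proof -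
      have "det_on (\<lambda>i j. cnj (u j (\<tau> i))) S = det_on (\<lambda>i j. cnj (u i (\<tau> j))) S"
        using det_on_transpose[OF assms(1), of "\<lambda>i j. cnj (u i (\<tau> j))"] by simp
      also have "\<dots> = cnj (det_on (\<lambda>i j. u i (\<tau> j)) S)" by (simp add: det_on_def)
      finally show ?thesis .
    qed
    have "complex_of_real (?n * d) = (\<Sum>\<tau>\<in>?T. of_real ((cmod (det_on (\<lambda>i j. u i (\<tau>
        j)) S))\<^sup>2))"
      using det_on_sum_product_symmetric[OF assms, of u "\<lambda>k j. cnj (u j k)"]
      by (simp add: d c complex_norm_square del: of_real_power)
    then have "?n * d = (\<Sum>\<tau>\<in>?T. (cmod (det_on (\<lambda>i j. u i (\<tau> j)) S))\<^sup>2)"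
      unfolding of_real_sum[symmetric] of_real_eq_iff .
    then show ?thesis using d(2) by (metis fact_ge_zero mult_left_mono)
  qed
  let ?a = "\<lambda>\<tau>. cmod (det_on (\<lambda>i j. A i (\<tau> j)) S)" and ?b = "\<lambda>\<tau>. cmod
      (det_on (\<lambda>i j. B (\<tau> i) j) S)"
  let ?D = "cmod (det_on (\<lambda>i j. \<Sum>k\<in>J. A i k * B k j) S)"
  have b: "?b \<tau> = cmod (det_on (\<lambda>i j. B (\<tau> j) i) S)" for \<tau>
    using det_on_transpose[OF assms(1), of "\<lambda>i j. B (\<tau> i) j"] by simp
  have "?n * ?D \<le> (\<Sum>\<tau>\<in>?T. ?a \<tau> * ?b \<tau>)"
  proof -
    have "?n * ?D = cmod (fact (card S) * det_on (\<lambda>i j. \<Sum>k\<in>J. A i k * B k j) S)"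
      by (simp add: norm_mult)
    also have "\<dots> \<le> (\<Sum>\<tau>\<in>?T. ?a \<tau> * ?b \<tau>)"
      unfolding det_on_sum_product_symmetric[OF assms] by (rule sum_norm_le) (simp add: norm_mult)
    finally show ?thesis .
  qed
  then have "(?n * ?D)\<^sup>2 \<le> (\<Sum>\<tau>\<in>?T. ?a \<tau> * ?b \<tau>)\<^sup>2" by (intro power_mono) auto
  also have "\<dots> \<le> (\<Sum>\<tau>\<in>?T. (?a \<tau>)\<^sup>2) * (\<Sum>\<tau>\<in>?T. (?b
      \<tau>)\<^sup>2)" by (rule Cauchy_Schwarz_ineq_sum)
  also have "\<dots> \<le> (?n * (\<Prod>i\<in>S. \<Sum>k\<in>J. (cmod (A i k))\<^sup>2)) * (?n *
      (\<Prod>i\<in>S. \<Sum>k\<in>J. (cmod (B k i))\<^sup>2))"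
    using Gram[of A] Gram[of "\<lambda>i k. B k i"] by (intro mult_mono) (auto simp: b sum_nonneg prod_nonneg)
  finally have "?n\<^sup>2 * ?D\<^sup>2 \<le> ?n\<^sup>2 *
      (\<Prod>i\<in>S. (\<Sum>k\<in>J. (cmod (A i k))\<^sup>2) * (\<Sum>k\<in>J. (cmod (B k i))\<^sup>2))"
    by (simp add: power_mult_distrib prod.distrib power2_eq_square mult_ac)
  then show ?thesis by (simp add: mult_le_cancel_left)
qed

section \<open>Fredholm determinants of absolutely summable kernels\<close>

text \<open>Dominated convergence along an arbitrary filter. The Weierstrass test makes the finite
  partial sums converge uniformly in \<open>n\<close>, so the two limits may be exchanged.\<close>

lemma tendsto_infsum_dominated:
  fixes f :: "'b \<Rightarrow> 'a \<Rightarrow> 'c::banach"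
  assumes le: "\<And>n x. x \<in> A \<Longrightarrow> norm (f n x) \<le> g x" and g: "g summable_on A"
    and lim: "\<And>x. x \<in> A \<Longrightarrow> ((\<lambda>n. f n x) \<longlongrightarrow> h x) G"
  shows "((\<lambda>n. infsum (f n) A) \<longlongrightarrow> infsum h A) G"
proof (cases "G = bot")
  case False
  have hle: "norm (h x) \<le> g x" if "x \<in> A" for x
    by (rule tendsto_upperbound[OF tendsto_norm[OF lim[OF that]] _ False]) (use le that in auto)
  have "h summable_on A"
    by (rule abs_summable_summable, rule Infinite_Sum.abs_summable_on_comparison_test'[OF g]) (use hle in auto)
  then have h: "((\<lambda>X. \<Sum>x\<in>X. h x) \<longlongrightarrow> infsum h A) (finite_subsets_at_top A)"
    by (simp add: infsum_tendsto)
  show ?thesis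
  proof (rule swap_uniform_limit')
    show "uniform_limit UNIV (\<lambda>X n. \<Sum>x\<in>X. f n x) (\<lambda>n. infsum (f n) A)
        (finite_subsets_at_top A)"
      by (rule Weierstrass_m_test_general[OF _ g]) (rule le)
    show "\<forall>\<^sub>F X in finite_subsets_at_top A. ((\<lambda>n. \<Sum>x\<in>X. f n x)
        \<longlongrightarrow> (\<Sum>x\<in>X. h x)) G"
      by (rule eventually_finite_subsets_at_top_weakI) (auto intro!: tendsto_sum lim)
  qed (use h in auto)
qed simp

text \<open>The sum over all subsets of a finite set factorises into the product of
  \<open>1 + x i\<close>, which is at most the exponential of the sum of the
  \<open>x i\<close>.\<close>

lemma summable_on_prod_finite_subsets:
  fixes x :: "'a \<Rightarrow> real"
  assumes x0: "\<And>i. x i \<ge> 0" and x: "x summable_on UNIV"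
  shows "(\<lambda>S. \<Prod>i\<in>S. x i) summable_on {S. finite S}"
proof (rule nonneg_bdd_above_summable_on)
  show "(\<Prod>i\<in>S. x i) \<ge> 0" for S using x0 by (simp add: prod_nonneg)
  show "bdd_above (sum (\<lambda>S. \<Prod>i\<in>S. x i) ` {F. F \<subseteq> {S. finite S} \<and> finite F})"
  proof (rule bdd_aboveI2)
    fix \<F> :: "'a set set" assume F: "\<F> \<in> {F. F \<subseteq> {S. finite S} \<and> finite F}"
    then have fin: "finite (\<Union>\<F>)" by auto
    have "(\<Sum>S\<in>\<F>. \<Prod>i\<in>S. x i) \<le> (\<Sum>S\<in>Pow (\<Union>\<F>). \<Prod>i\<in>S. x i)"
      using fin x0 by (intro sum_mono2) (auto simp: prod_nonneg)
    also have "\<dots> = (\<Prod>i\<in>\<Union>\<F>. x i + 1)" using fin by (simp add: prod_add)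
    also have "\<dots> \<le> (\<Prod>i\<in>\<Union>\<F>. exp (x i))"
      using x0 by (intro prod_mono conjI add_nonneg_nonneg) (simp_all add: exp_ge_add_one_self add.commute[of _ 1])
    also have "\<dots> = exp (\<Sum>i\<in>\<Union>\<F>. x i)" using fin by (simp add: exp_sum)
    also have "\<dots> \<le> exp (infsum x UNIV)"
      using fin x x0 by (simp add: finite_sum_le_infsum)
    finally show "(\<Sum>S\<in>\<F>. \<Prod>i\<in>S. x i) \<le> exp (infsum x UNIV)" .
  qed
qed

text \<open>The argument is the deviation from the identity: the value is the determinant of
  \<open>1 + K\<close>, as in \<open>op_det\<close>.\<close>

definition fredholm_det :: "('a \<Rightarrow> 'a \<Rightarrow> complex) \<Rightarrow> complex" where
  "fredholm_det K = infsum (det_on K) {S. finite S}"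

definition fredholm_trace :: "('a \<Rightarrow> 'a \<Rightarrow> complex) \<Rightarrow> complex" where
  "fredholm_trace K = (\<Sum>\<^sub>\<infinity>i. K i i)"

lemma tendsto_det_on:
  assumes "\<And>i j. ((\<lambda>n. K n i j) \<longlongrightarrow> K' i j) G"
  shows "((\<lambda>n. det_on (K n) S) \<longlongrightarrow> det_on K' S) G"
  unfolding det_on_def by (intro tendsto_intros assms)

lemma tendsto_fredholm_det:
  fixes x :: "'a \<Rightarrow> real"
  assumes "\<And>i. x i \<ge> 0" "x summable_on UNIV"
    and "\<And>n S. finite S \<Longrightarrow> cmod (det_on (K n) S) \<le> (\<Prod>i\<in>S. x i)"
    and "\<And>i j. ((\<lambda>n. K n i j) \<longlongrightarrow> K' i j) G"
  shows "((\<lambda>n. fredholm_det (K n)) \<longlongrightarrow> fredholm_det K') G"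
  unfolding fredholm_det_def
  by (rule tendsto_infsum_dominated[OF _ summable_on_prod_finite_subsets[OF assms(1,2)]])
    (use assms(3,4) in \<open>auto intro: tendsto_det_on\<close>)

text \<open>The determinant over \<open>F\<close> is the Fredholm series of \<open>K F\<close> cut
  down to subsets of \<open>F\<close>, and every fixed \<open>S\<close> is eventually retained. The
  kernel may vary with \<open>F\<close> because in products the inner summation is truncated to
  \<open>F\<close> as well.\<close>

lemma tendsto_det_on_identity_plus:
  fixes x :: "'a \<Rightarrow> real"
  assumes "\<And>i. x i \<ge> 0" "x summable_on UNIV"
    and "\<And>F S. finite S \<Longrightarrow> cmod (det_on (K F) S) \<le> (\<Prod>i\<in>S. x i)"
    and "\<And>i j. ((\<lambda>F. K F i j) \<longlongrightarrow> K' i j) (finite_subsets_at_top UNIV)"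
  shows "((\<lambda>F. det_on (\<lambda>i j. of_bool (i = j) + K F i j) F) \<longlongrightarrow> fredholm_det K')
    (finite_subsets_at_top UNIV)"
proof -
  let ?f = "\<lambda>F S. of_bool (S \<subseteq> F) * det_on (K F) S"
  have "((\<lambda>F. infsum (?f F) {S. finite S}) \<longlongrightarrow> fredholm_det K')
      (finite_subsets_at_top UNIV)"
    unfolding fredholm_det_def
  proof (rule tendsto_infsum_dominated[OF _ summable_on_prod_finite_subsets[OF assms(1,2)]])
    fix F and S :: "'a set" assume "S \<in> {S. finite S}"
    then show "cmod (?f F S) \<le> (\<Prod>i\<in>S. x i)"
      using assms(1) assms(3)[of S F] by (auto simp: of_bool_def prod_nonneg)
  next
    fix S :: "'a set" assume S: "S \<in> {S. finite S}"
    have "\<forall>\<^sub>F F in finite_subsets_at_top UNIV. det_on (K F) S = ?f F S"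
      unfolding eventually_finite_subsets_at_top using S by (intro exI[of _ S]) auto
    then show "((\<lambda>F. ?f F S) \<longlongrightarrow> det_on K' S) (finite_subsets_at_top UNIV)"
      by (rule Lim_transform_eventually[OF tendsto_det_on[OF assms(4)]])
  qed
  moreover have "\<forall>\<^sub>F F in finite_subsets_at_top UNIV.
      infsum (?f F) {S. finite S} = det_on (\<lambda>i j. of_bool (i = j) + K F i j) F"
  proof (rule eventually_finite_subsets_at_top_weakI)
    fix F :: "'a set" assume F: "finite F" "F \<subseteq> UNIV"
    have "infsum (?f F) {S. finite S} = infsum (det_on (K F)) (Pow F)"
      using F by (intro infsum_cong_neutral) (auto intro: finite_subset)
    also have "\<dots> = det_on (\<lambda>i j. of_bool (i = j) + K F i j) F"
      using F by (simp add: det_on_identity_plus)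
    finally show "infsum (?f F) {S. finite S} = det_on (\<lambda>i j. of_bool (i = j) + K F i j) F" .
  qed
  ultimately show ?thesis by (rule Lim_transform_eventually)
qed

text \<open>The substitute for a trace norm bound. Quantifying over finite sets makes it stable
  under entrywise limits without any separate summability argument.\<close>

definition abs_sum_le :: "('a \<Rightarrow> 'b \<Rightarrow> complex) \<Rightarrow> real \<Rightarrow> bool" where
  "abs_sum_le K c \<longleftrightarrow> (\<forall>F. finite F \<longrightarrow> (\<Sum>(i,j)\<in>F. cmod (K i
      j)) \<le> c)"

lemma abs_sum_leD: "abs_sum_le K c \<Longrightarrow> finite F \<Longrightarrow> (\<Sum>(i,j)\<in>F. cmod (K i
    j)) \<le> c"
  by (simp add: abs_sum_le_def)

lemma abs_sum_le_nonneg: "abs_sum_le K c \<Longrightarrow> 0 \<le> c"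
  using abs_sum_leD[of K c "{}"] by simp

lemma abs_sum_le_mono: "abs_sum_le K c \<Longrightarrow> c \<le> d \<Longrightarrow> abs_sum_le K d"
  unfolding abs_sum_le_def by (meson order_trans)

lemma abs_sum_le_dominated:
  assumes "abs_sum_le D c" "\<And>i j. cmod (K i j) \<le> cmod (D i j)"
  shows "abs_sum_le K c"
  unfolding abs_sum_le_def
proof (intro allI impI)
  fix F :: "('a \<times> 'b) set" assume "finite F"
  have "(\<Sum>(i,j)\<in>F. cmod (K i j)) \<le> (\<Sum>(i,j)\<in>F. cmod (D i j))"
    by (rule sum_mono) (use assms(2) in auto)
  also have "\<dots> \<le> c" using assms(1) \<open>finite F\<close> by (rule abs_sum_leD)
  finally show "(\<Sum>(i,j)\<in>F. cmod (K i j)) \<le> c" .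
qed

lemma abs_sum_le_summable:
  assumes "abs_sum_le K c"
  shows "(\<lambda>(i,j). cmod (K i j)) summable_on UNIV"
  by (rule nonneg_bdd_above_summable_on) (use assms in \<open>auto simp: abs_sum_le_def intro!:
      bdd_aboveI2[where M = c]\<close>)

lemma abs_sum_le_iff_infsum:
  "abs_sum_le K c \<longleftrightarrow>
    (\<lambda>(i,j). cmod (K i j)) summable_on UNIV \<and> (\<Sum>\<^sub>\<infinity>(i,j). cmod (K i j)) \<le> c"
proof
  assume *: "abs_sum_le K c"
  then show "(\<lambda>(i,j). cmod (K i j)) summable_on UNIV \<and> (\<Sum>\<^sub>\<infinity>(i,j). cmod (K i
      j)) \<le> c"
    using abs_sum_le_summable[OF *] by (auto intro!: infsum_le_finite_sums abs_sum_leD)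
next
  assume *: "(\<lambda>(i,j). cmod (K i j)) summable_on UNIV \<and> (\<Sum>\<^sub>\<infinity>(i,j). cmod (K i
      j)) \<le> c"
  show "abs_sum_le K c" unfolding abs_sum_le_def
  proof (intro allI impI)
    fix F :: "('a \<times> 'b) set" assume "finite F"
    then have "(\<Sum>(i,j)\<in>F. cmod (K i j)) \<le> (\<Sum>\<^sub>\<infinity>(i,j). cmod (K i j))"
      using * by (intro finite_sum_le_infsum) auto
    then show "(\<Sum>(i,j)\<in>F. cmod (K i j)) \<le> c" using * by simp
  qed
qed

lemma abs_sum_le_add:
  assumes "abs_sum_le K c" "abs_sum_le L d"
  shows "abs_sum_le (\<lambda>i j. K i j + L i j) (c + d)"
  unfolding abs_sum_le_def
proof (intro allI impI)
  fix F :: "('a \<times> 'b) set" assume F: "finite F"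
  have "(\<Sum>(i,j)\<in>F. cmod (K i j + L i j)) \<le> (\<Sum>(i,j)\<in>F. cmod (K i j)) + (\<Sum>(i,j)\<in>F.
      cmod (L i j))"
    unfolding sum.distrib[symmetric] by (rule sum_mono) (auto intro: norm_triangle_ineq)
  also have "\<dots> \<le> c + d" using assms F by (intro add_mono abs_sum_leD)
  finally show "(\<Sum>(i,j)\<in>F. cmod (K i j + L i j)) \<le> c + d" .
qed

lemma abs_sum_le_mult_left:
  assumes "abs_sum_le K c" shows "abs_sum_le (\<lambda>i j. a * K i j) (cmod a * c)"
  using assms unfolding abs_sum_le_def
  by (auto simp: norm_mult sum_distrib_left[symmetric] case_prod_unfold intro!: mult_left_mono)

lemma abs_sum_le_tendsto:
  assumes "\<And>i j. ((\<lambda>n. K n i j) \<longlongrightarrow> K' i j) G" "\<forall>\<^sub>F n in G.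
      abs_sum_le (K n) c" "G \<noteq> bot"
  shows "abs_sum_le K' c"
  unfolding abs_sum_le_def
proof (intro allI impI)
  fix F :: "('a \<times> 'b) set" assume F: "finite F"
  have "((\<lambda>n. \<Sum>(i,j)\<in>F. cmod (K n i j)) \<longlongrightarrow> (\<Sum>(i,j)\<in>F. cmod (K' i j))) G"
    unfolding case_prod_unfold by (intro tendsto_intros assms)
  then show "(\<Sum>(i,j)\<in>F. cmod (K' i j)) \<le> c"
    by (rule tendsto_upperbound[OF _ _ assms(3)])
      (use assms(2) F in \<open>auto elim!: eventually_mono intro: abs_sum_leD\<close>)
qed

lemma abs_sum_le_row_summable:
  fixes K :: "'a \<Rightarrow> 'b \<Rightarrow> complex"
  assumes "abs_sum_le K c"
  shows "(\<lambda>j. cmod (K i j)) summable_on UNIV"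
    and "(\<lambda>i. \<Sum>\<^sub>\<infinity>j. cmod (K i j)) summable_on UNIV"
    and "(\<Sum>\<^sub>\<infinity>i. \<Sum>\<^sub>\<infinity>j. cmod (K i j)) \<le> c"
proof -
  have s: "(\<lambda>(i,j). cmod (K i j)) summable_on UNIV \<times> UNIV" using abs_sum_le_summable[OF assms] by simp
  show "(\<lambda>j. cmod (K i j)) summable_on UNIV"
    using summable_on_SigmaD1[OF s, of i] by simp
  show "(\<lambda>i. \<Sum>\<^sub>\<infinity>j. cmod (K i j)) summable_on UNIV"
    using summable_on_Sigma_banach[OF s] by simp
  show "(\<Sum>\<^sub>\<infinity>i. \<Sum>\<^sub>\<infinity>j. cmod (K i j)) \<le> c"
    using infsum_Sigma'_banach[OF s] assms unfolding abs_sum_le_iff_infsum by simp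
qed

text \<open>Permutations are among the maps from \<open>S\<close> to \<open>S\<close>, and the sum
  over all such maps factorises by rows.\<close>

lemma cmod_det_on_le:
  assumes "finite S"
  shows "cmod (det_on K S) \<le> (\<Prod>i\<in>S. \<Sum>j\<in>S. cmod (K i j))"
proof -
  let ?f = "\<lambda>\<tau>. \<Prod>i\<in>S. cmod (K i (\<tau> i))"
  have "cmod (det_on K S) \<le> (\<Sum>p | p permutes S. ?f p)"
    unfolding det_on_def by (rule sum_norm_le) (simp add: norm_mult prod_norm sign_def)
  also have "\<dots> = (\<Sum>p | p permutes S. ?f (restrict p S))"
    by (intro sum.cong prod.cong) auto
  also have "\<dots> = (\<Sum>\<tau>\<in>(\<lambda>p. restrict p S) ` {p. p permutes S}. ?f \<tau>)"
    by (rule sum.reindex[OF inj_on_restrict_permutes, unfolded o_def, symmetric])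
  also have "\<dots> \<le> (\<Sum>\<tau>\<in>S \<rightarrow>\<^sub>E S. ?f \<tau>)"
    using assms by (intro sum_mono2) (auto simp: finite_PiE permutes_in_image prod_nonneg)
  also have "\<dots> = (\<Prod>i\<in>S. \<Sum>j\<in>S. cmod (K i j))"
    using assms by (simp add: prod_sum_PiE)
  finally show ?thesis .
qed

lemma cmod_det_on_le_row_sums:
  assumes "abs_sum_le D c" "\<And>i j. cmod (K i j) \<le> cmod (D i j)" "finite S"
  shows "cmod (det_on K S) \<le> (\<Prod>i\<in>S. \<Sum>\<^sub>\<infinity>j. cmod (D i j))"
proof -
  have "cmod (det_on K S) \<le> (\<Prod>i\<in>S. \<Sum>j\<in>S. cmod (K i j))" by (rule cmod_det_on_le[OF assms(3)])
  also have "\<dots> \<le> (\<Prod>i\<in>S. \<Sum>\<^sub>\<infinity>j. cmod (D i j))"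
  proof (rule prod_mono, rule conjI)
    fix i
    show "0 \<le> (\<Sum>j\<in>S. cmod (K i j))" by (simp add: sum_nonneg)
    have "(\<Sum>j\<in>S. cmod (K i j)) \<le> (\<Sum>j\<in>S. cmod (D i j))" by (rule sum_mono) (rule assms)
    also have "\<dots> \<le> (\<Sum>\<^sub>\<infinity>j. cmod (D i j))"
      by (rule finite_sum_le_infsum) (use assms abs_sum_le_row_summable(1) in auto)
    finally show "(\<Sum>j\<in>S. cmod (K i j)) \<le> (\<Sum>\<^sub>\<infinity>j. cmod (D i j))" .
  qed
  finally show ?thesis .
qed

lemma tendsto_det_on_identity_plus_abs_sum:
  assumes "abs_sum_le D c" "\<And>F i j. cmod (K F i j) \<le> cmod (D i j)"
    and "\<And>i j. ((\<lambda>F. K F i j) \<longlongrightarrow> K' i j) (finite_subsets_at_top UNIV)"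
  shows "((\<lambda>F. det_on (\<lambda>i j. of_bool (i = j) + K F i j) F) \<longlongrightarrow> fredholm_det K')
    (finite_subsets_at_top UNIV)"
  by (rule tendsto_det_on_identity_plus[OF _ abs_sum_le_row_summable(2)[OF assms(1)]])
    (use assms in \<open>auto intro: infsum_nonneg cmod_det_on_le_row_sums\<close>)

lemma abs_sum_le_diagonal_summable:
  assumes "abs_sum_le K c"
  shows "(\<lambda>i. cmod (K i i)) summable_on UNIV" "cmod (fredholm_trace K) \<le> c"
proof -
  have le: "(\<Sum>i\<in>F. cmod (K i i)) \<le> c" if "finite F" for F
  proof -
    have "(\<Sum>i\<in>F. cmod (K i i)) = (\<Sum>(i,j)\<in>(\<lambda>i. (i,i)) ` F. cmod (K i j))"
      by (subst sum.reindex) (auto simp: inj_on_def)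
    also have "\<dots> \<le> c" using assms that by (intro abs_sum_leD) auto
    finally show ?thesis .
  qed
  show s: "(\<lambda>i. cmod (K i i)) summable_on UNIV"
    by (rule nonneg_bdd_above_summable_on) (use le in \<open>auto intro!: bdd_aboveI2[where M = c]\<close>)
  have "cmod (fredholm_trace K) \<le> (\<Sum>\<^sub>\<infinity>i. cmod (K i i))"
    unfolding fredholm_trace_def by (rule norm_infsum_bound) (rule s)
  also have "\<dots> \<le> c" by (rule infsum_le_finite_sums[OF s]) (rule le)
  finally show "cmod (fredholm_trace K) \<le> c" .
qed

lemma fredholm_trace_add:
  assumes "abs_sum_le K c" "abs_sum_le L d"
  shows "fredholm_trace (\<lambda>i j. K i j + L i j) = fredholm_trace K + fredholm_trace L"
  unfolding fredholm_trace_def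
  by (rule infsum_add)
    (rule abs_summable_summable[OF abs_sum_le_diagonal_summable(1)[OF assms(1)]],
     rule abs_summable_summable[OF abs_sum_le_diagonal_summable(1)[OF assms(2)]])

lemma fredholm_trace_mult_left: "fredholm_trace (\<lambda>i j. a * K i j) = a * fredholm_trace K"
  unfolding fredholm_trace_def by (rule infsum_cmult_right')

lemma exp_remainder_mono:
  fixes x y :: real
  assumes "0 \<le> x" "x \<le> y"
  shows "exp x - 1 - x \<le> exp y - 1 - y"
proof -
  have "exp x * (1 + (y - x)) \<le> exp x * exp (y - x)" by (intro mult_left_mono exp_ge_add_one_self) auto
  also have "\<dots> = exp y" by (simp flip: exp_add)
  finally have "exp y \<ge> exp x + exp x * (y - x)" by (simp add: algebra_simps)
  moreover have "exp x * (y - x) \<ge> 1 * (y - x)" using assms by (intro mult_right_mono) auto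
  ultimately show ?thesis by simp
qed

text \<open>Minors of order at least two are majorised by the terms of the same order in the product
  of \<open>1 + x i\<close>, and that product is at most an exponential. For small \<open>c\<close>
  the error is quadratic, which the comparison with \<open>exp\<close> of a trace relies on.\<close>

lemma fredholm_det_first_order:
  assumes K: "abs_sum_le K c"
  shows "cmod (fredholm_det K - 1 - fredholm_trace K) \<le> exp c - 1 - c"
proof -
  let ?x = "\<lambda>i. \<Sum>\<^sub>\<infinity>j. cmod (K i j)"
  have x0: "?x i \<ge> 0" for i by (rule infsum_nonneg) simp
  have bound: "cmod (det_on (\<lambda>i j. of_bool (i = j) + K i j) F - 1 - (\<Sum>i\<in>F. K i i)) \<le> exp c
      - 1 - c"
    if F: "finite F" for F
  proof -
    \<comment> \<open>The empty set and the singletons account for the summand 1 and for the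
      trace.\<close>
    let ?E = "insert {} ((\<lambda>i. {i}) ` F)"
    have E: "finite ?E" "?E \<subseteq> Pow F" using F by auto
    have sumE: "(\<Sum>S\<in>?E. f S) = f {} + (\<Sum>i\<in>F. f {i})" for f :: "'a set \<Rightarrow>
        'b::comm_monoid_add"
      using F by (subst sum.insert) (auto simp: sum.reindex)
    have "det_on (\<lambda>i j. of_bool (i = j) + K i j) F - 1 - (\<Sum>i\<in>F. K i i) = (\<Sum>S\<in>Pow F -
        ?E. det_on K S)"
      using F E by (simp add: det_on_identity_plus sum_diff sumE del: sum.insert)
    also have "cmod \<dots> \<le> (\<Sum>S\<in>Pow F - ?E. \<Prod>i\<in>S. ?x i)"
      using F by (intro sum_norm_le cmod_det_on_le_row_sums[OF K]) (auto intro: finite_subset)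
    also have "\<dots> = (\<Prod>i\<in>F. ?x i + 1) - 1 - (\<Sum>i\<in>F. ?x i)"
      using F E by (simp add: prod_add sum_diff sumE del: sum.insert)
    also have "(\<Prod>i\<in>F. ?x i + 1) \<le> (\<Prod>i\<in>F. exp (?x i))"
      using x0 by (intro prod_mono conjI add_nonneg_nonneg) (simp_all add: exp_ge_add_one_self add.commute[of _ 1])
    also have "(\<Prod>i\<in>F. exp (?x i)) = exp (\<Sum>i\<in>F. ?x i)" using F by (simp add: exp_sum)
    also have "exp (\<Sum>i\<in>F. ?x i) - 1 - (\<Sum>i\<in>F. ?x i) \<le> exp c - 1 - c"
    proof (rule exp_remainder_mono)
      show "0 \<le> (\<Sum>i\<in>F. ?x i)" using x0 by (simp add: sum_nonneg)
      have "(\<Sum>i\<in>F. ?x i) \<le> (\<Sum>\<^sub>\<infinity>i. ?x i)"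
        by (rule finite_sum_le_infsum) (use F x0 abs_sum_le_row_summable(2)[OF K] in auto)
      also have "\<dots> \<le> c" by (rule abs_sum_le_row_summable(3)[OF K])
      finally show "(\<Sum>i\<in>F. ?x i) \<le> c" .
    qed
    finally show ?thesis by simp
  qed
  have 1: "((\<lambda>F. det_on (\<lambda>i j. of_bool (i = j) + K i j) F) \<longlongrightarrow> fredholm_det
      K) (finite_subsets_at_top UNIV)"
    by (rule tendsto_det_on_identity_plus_abs_sum[OF K]) auto
  have 2: "((\<lambda>F. \<Sum>i\<in>F. K i i) \<longlongrightarrow> fredholm_trace K) (finite_subsets_at_top UNIV)"
    unfolding fredholm_trace_def
    by (rule infsum_tendsto, rule abs_summable_summable, rule abs_sum_le_diagonal_summable(1)[OF K])
  have "((\<lambda>F. cmod (det_on (\<lambda>i j. of_bool (i = j) + K i j) F - 1 - (\<Sum>i\<in>F. K i i)))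
      \<longlongrightarrow>
      cmod (fredholm_det K - 1 - fredholm_trace K)) (finite_subsets_at_top UNIV)"
    by (intro tendsto_intros 1 2)
  then show ?thesis
    by (rule tendsto_upperbound) (auto intro!: eventually_finite_subsets_at_top_weakI bound)
qed

section \<open>The Banach algebra of matrices with bounded row and column sums\<close>

text \<open>The hypothesis of the Schur test. Column sums control left multiplication of absolutely
  summable kernels, and row and column sums together control products with Hilbert-Schmidt
  kernels.\<close>

definition schur_le :: "('a \<Rightarrow> 'a \<Rightarrow> complex) \<Rightarrow> real \<Rightarrow> bool" where
  "schur_le X c \<longleftrightarrow> (\<forall>i F. finite F \<longrightarrow>
    (\<Sum>j\<in>F. cmod (X i j)) \<le> c \<and> (\<Sum>j\<in>F. cmod (X j i)) \<le> c)"

lemma schur_leD: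
  assumes "schur_le X c" "finite F"
  shows "(\<Sum>j\<in>F. cmod (X i j)) \<le> c" "(\<Sum>j\<in>F. cmod (X j i)) \<le> c"
  using assms by (auto simp: schur_le_def)

lemma schur_leI:
  assumes "\<And>i F. finite F \<Longrightarrow> (\<Sum>j\<in>F. cmod (X i j)) \<le> c"
    "\<And>i F. finite F \<Longrightarrow> (\<Sum>j\<in>F. cmod (X j i)) \<le> c"
  shows "schur_le X c"
  using assms by (auto simp: schur_le_def)

lemma schur_le_nonneg: "schur_le X c \<Longrightarrow> 0 \<le> c"
  using schur_leD(1)[of X c "{}"] by simp

lemma schur_le_entry: "schur_le X c \<Longrightarrow> cmod (X i j) \<le> c"
  using schur_leD(1)[of X c "{j}" i] by simp

lemma schur_le_transpose: "schur_le (\<lambda>i j. X j i) c \<longleftrightarrow> schur_le X c"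
  by (auto simp: schur_le_def)

lemma schur_le_summable:
  assumes "schur_le X c"
  shows "(\<lambda>j. cmod (X i j)) summable_on UNIV" "(\<lambda>j. cmod (X j i)) summable_on UNIV"
proof -
  have *: "(\<lambda>j. cmod (Y i j)) summable_on UNIV" if "schur_le Y c" for Y
    by (rule nonneg_bdd_above_summable_on)
      (use schur_leD(1)[OF that] in \<open>auto intro!: bdd_aboveI2[where M = c]\<close>)
  show "(\<lambda>j. cmod (X i j)) summable_on UNIV" by (rule *[OF assms])
  show "(\<lambda>j. cmod (X j i)) summable_on UNIV"
    by (rule *[of "\<lambda>i j. X j i"]) (rule iffD2[OF schur_le_transpose assms])
qed

lemma schur_le_infsum:
  assumes "schur_le X c"
  shows "(\<Sum>\<^sub>\<infinity>j. cmod (X i j)) \<le> c" "(\<Sum>\<^sub>\<infinity>j. cmod (X j i)) \<le> c"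
  by (rule infsum_le_finite_sums[OF schur_le_summable(1)[OF assms]], rule schur_leD(1)[OF assms], assumption)
    (rule infsum_le_finite_sums[OF schur_le_summable(2)[OF assms]], rule schur_leD(2)[OF assms], assumption)

lemma schur_le_zero: "schur_le (\<lambda>i j. 0) 0"
  by (simp add: schur_le_def)

lemma schur_le_add:
  assumes "schur_le X c" "schur_le Y d"
  shows "schur_le (\<lambda>i j. X i j + Y i j) (c + d)"
proof (rule schur_leI)
  fix i and F :: "'a set" assume F: "finite F"
  have "(\<Sum>j\<in>F. cmod (X i j + Y i j)) \<le> (\<Sum>j\<in>F. cmod (X i j) + cmod (Y i j))"
    by (intro sum_mono norm_triangle_ineq)
  then show "(\<Sum>j\<in>F. cmod (X i j + Y i j)) \<le> c + d"
    using schur_leD(1)[OF assms(1) F, of i] schur_leD(1)[OF assms(2) F, of i] by (simp add: sum.distrib)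
  have "(\<Sum>j\<in>F. cmod (X j i + Y j i)) \<le> (\<Sum>j\<in>F. cmod (X j i) + cmod (Y j i))"
    by (intro sum_mono norm_triangle_ineq)
  then show "(\<Sum>j\<in>F. cmod (X j i + Y j i)) \<le> c + d"
    using schur_leD(2)[OF assms(1) F, of i] schur_leD(2)[OF assms(2) F, of i] by (simp add: sum.distrib)
qed

lemma schur_le_uminus: "schur_le (\<lambda>i j. - X i j) c \<longleftrightarrow> schur_le X c"
  by (simp add: schur_le_def)

lemma schur_le_scaleR: "schur_le X c \<Longrightarrow> schur_le (\<lambda>i j. r *\<^sub>R X i j) (\<bar>r\<bar> * c)"
  by (auto simp: schur_le_def sum_distrib_left[symmetric] intro!: mult_left_mono)

lemma schur_le_one: "schur_le (\<lambda>i j. of_bool (i = j)) 1"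
  by (rule schur_leI; simp add: of_bool_def if_distrib cong: if_cong)

lemma summable_mult_bounded:
  assumes "(\<lambda>k. cmod (f k)) summable_on A" "\<And>k. cmod (g k) \<le> d"
  shows "(\<lambda>k. cmod (f k * g k)) summable_on A" "(\<lambda>k. cmod (g k * f k)) summable_on A"
    "(\<lambda>k. f k * g k) summable_on A" "(\<lambda>k. g k * f k) summable_on A"
proof -
  show *: "(\<lambda>k. cmod (f k * g k)) summable_on A"
    by (rule Infinite_Sum.abs_summable_on_comparison_test'[OF summable_on_cmult_left[OF assms(1), of d]])
      (auto simp: norm_mult intro!: mult_left_mono assms(2))
  show "(\<lambda>k. f k * g k) summable_on A" by (rule abs_summable_summable[OF *])
  show **: "(\<lambda>k. cmod (g k * f k)) summable_on A" using * by (simp add: mult.commute)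
  show "(\<lambda>k. g k * f k) summable_on A" by (rule abs_summable_summable[OF **])
qed

lemma summable_on_finite_sum:
  fixes f :: "'a \<Rightarrow> 'b \<Rightarrow> 'c::banach"
  assumes "finite F" "\<And>j. j \<in> F \<Longrightarrow> f j summable_on A"
  shows "(\<lambda>k. \<Sum>j\<in>F. f j k) summable_on A"
  using assms by (induction F rule: finite_induct) (auto intro: summable_on_add)

lemma infsum_finite_sum:
  fixes f :: "'a \<Rightarrow> 'b \<Rightarrow> 'c::banach"
  assumes "finite F" "\<And>j. j \<in> F \<Longrightarrow> f j summable_on A"
  shows "(\<Sum>\<^sub>\<infinity>k\<in>A. \<Sum>j\<in>F. f j k) = (\<Sum>j\<in>F. infsum (f j) A)"
  using assms by (induction F rule: finite_induct) (auto simp: infsum_add summable_on_finite_sum)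

lemma sum_cmod_product_le:
  fixes X :: "'a \<Rightarrow> complex" and Y :: "'a \<Rightarrow> 'b \<Rightarrow> complex"
  assumes "(\<lambda>k. cmod (X k)) summable_on UNIV" "(\<Sum>\<^sub>\<infinity>k. cmod (X k)) \<le> c"
    and "\<And>k. (\<Sum>j\<in>F. cmod (Y k j)) \<le> d" "finite F" "0 \<le> d"
  shows "(\<Sum>j\<in>F. cmod (\<Sum>\<^sub>\<infinity>k. X k * Y k j)) \<le> c * d"
proof -
  have Yd: "cmod (Y k j) \<le> d" if "j \<in> F" for k j
    using member_le_sum[of j F "\<lambda>j. cmod (Y k j)"] assms(3)[of k] assms(4) that by simp
  have s: "(\<lambda>k. cmod (X k * Y k j)) summable_on UNIV" if "j \<in> F" for j
    by (rule summable_mult_bounded(1)[OF assms(1)]) (rule Yd[OF that])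
  have "(\<Sum>j\<in>F. cmod (\<Sum>\<^sub>\<infinity>k. X k * Y k j)) \<le> (\<Sum>j\<in>F.
      \<Sum>\<^sub>\<infinity>k. cmod (X k * Y k j))"
    using s by (intro sum_mono norm_infsum_bound) auto
  also have "\<dots> = (\<Sum>\<^sub>\<infinity>k. \<Sum>j\<in>F. cmod (X k * Y k j))"
    using s by (intro infsum_finite_sum[symmetric] assms(4)) auto
  also have "\<dots> \<le> (\<Sum>\<^sub>\<infinity>k. cmod (X k) * d)"
  proof (rule infsum_mono)
    show "(\<lambda>k. \<Sum>j\<in>F. cmod (X k * Y k j)) summable_on UNIV"
      using s by (intro summable_on_finite_sum assms(4)) auto
    show "(\<lambda>k. cmod (X k) * d) summable_on UNIV" by (rule summable_on_cmult_left[OF assms(1)])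
    show "(\<Sum>j\<in>F. cmod (X k * Y k j)) \<le> cmod (X k) * d" for k
      using assms(3)[of k] by (simp add: norm_mult sum_distrib_left[symmetric] mult_left_mono)
  qed
  also have "\<dots> = (\<Sum>\<^sub>\<infinity>k. cmod (X k)) * d" using assms(1) by (simp add: infsum_cmult_left)
  also have "\<dots> \<le> c * d" using assms by (intro mult_right_mono) auto
  finally show ?thesis .
qed

lemma schur_le_mult:
  assumes "schur_le X c" "schur_le Y d"
  shows "schur_le (\<lambda>i j. \<Sum>\<^sub>\<infinity>k. X i k * Y k j) (c * d)"
proof (rule schur_leI)
  fix i and F :: "'a set" assume F: "finite F"
  show "(\<Sum>j\<in>F. cmod (\<Sum>\<^sub>\<infinity>k. X i k * Y k j)) \<le> c * d"
    by (rule sum_cmod_product_le)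
      (use assms F schur_le_nonneg in \<open>auto intro: schur_le_summable schur_le_infsum schur_leD\<close>)
  \<comment> \<open>Column sums of the product are row sums of the product of the transposed
    matrices in reverse order.\<close>
  have "(\<Sum>j\<in>F. cmod (\<Sum>\<^sub>\<infinity>k. Y k i * X j k)) \<le> d * c"
    by (rule sum_cmod_product_le[where Y = "\<lambda>k j. X j k"])
      (use assms F schur_le_nonneg in \<open>auto intro: schur_le_summable schur_le_infsum schur_leD\<close>)
  then show "(\<Sum>j\<in>F. cmod (\<Sum>\<^sub>\<infinity>k. X j k * Y k i)) \<le> c * d" by (simp add: mult.commute)
qed

text \<open>A type of its own, so that the library exponential and its laws for Banach algebras
  apply with \<open>*\<close> as the matrix product.\<close>

typedef 'a bmat = "{X :: 'a \<Rightarrow> 'a \<Rightarrow> complex. \<exists>c. schur_le X c}" morphisms entry Bmat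
  using schur_le_zero by blast

setup_lifting type_definition_bmat

lemma bmat_eqI: "(\<And>i j. entry X i j = entry Y i j) \<Longrightarrow> X = Y"
  by (simp add: entry_inject[symmetric] fun_eq_iff)

lemma entry_Bmat: "schur_le X c \<Longrightarrow> entry (Bmat X) = X"
  by (rule Bmat_inverse) auto

lemma summable_schur_triple:
  assumes X: "(\<lambda>k. cmod (X k)) summable_on UNIV" and Y: "schur_le Y c" and Z: "\<And>l. cmod (Z l) \<le> d"
  shows "(\<lambda>(k,l). X k * Y k l * Z l) summable_on UNIV"
proof -
  have d: "d \<ge> 0" using Z norm_ge_zero order_trans by blast
  have "(\<lambda>(k,l). norm (X k * Y k l * Z l)) summable_on Sigma UNIV (\<lambda>_. UNIV)"
  proof (rule summable_on_SigmaI)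
    fix k
    have "(\<lambda>l. cmod (X k * Y k l * Z l)) summable_on UNIV"
      by (rule summable_mult_bounded(1)[OF _ Z]) 
        (simp add: norm_mult summable_on_cmult_right schur_le_summable[OF Y])
    then show "((\<lambda>l. case (k,l) of (k,l) \<Rightarrow> norm (X k * Y k l * Z l)) has_sum
        (\<Sum>\<^sub>\<infinity>l. cmod (X k * Y k l * Z l))) UNIV"
      by simp
  next
    show "(\<lambda>k. \<Sum>\<^sub>\<infinity>l. cmod (X k * Y k l * Z l)) summable_on UNIV"
    proof (rule summable_on_comparison_test[OF summable_on_cmult_left[OF X, of "c * d"]])
      fix k
      have "(\<Sum>\<^sub>\<infinity>l. cmod (X k * Y k l * Z l)) \<le> (\<Sum>\<^sub>\<infinity>l. cmod (X k)
          * d * cmod (Y k l))"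
      proof (rule infsum_mono)
        show "(\<lambda>l. cmod (X k * Y k l * Z l)) summable_on UNIV"
          by (rule summable_mult_bounded(1)[OF _ Z]) 
            (simp add: norm_mult summable_on_cmult_right schur_le_summable[OF Y])
        show "(\<lambda>l. cmod (X k) * d * cmod (Y k l)) summable_on UNIV"
          by (intro summable_on_cmult_right schur_le_summable[OF Y])
        show "cmod (X k * Y k l * Z l) \<le> cmod (X k) * d * cmod (Y k l)" for l
          using mult_left_mono[OF Z[of l], of "cmod (X k) * cmod (Y k l)"] by (simp add: norm_mult mult_ac)
      qed
      also have "\<dots> = cmod (X k) * d * (\<Sum>\<^sub>\<infinity>l. cmod (Y k l))"
        by (rule infsum_cmult_right) (rule schur_le_summable[OF Y])
      also have "\<dots> \<le> cmod (X k) * (c * d)"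
        using mult_left_mono[OF schur_le_infsum(1)[OF Y, of k], of "cmod (X k) * d"] d by (simp add: mult_ac)
      finally show "(\<Sum>\<^sub>\<infinity>l. cmod (X k * Y k l * Z l)) \<le> cmod (X k) * (c * d)" .
    qed (auto intro: infsum_nonneg)
  qed auto
  then have "(\<lambda>p. norm (case p of (k,l) \<Rightarrow> X k * Y k l * Z l)) summable_on UNIV"
    by (simp add: case_prod_unfold)
  then show ?thesis by (rule abs_summable_summable)
qed

text \<open>The outer factors are one summable row and one bounded column rather than matrices.
  Hence the lemma also covers the action on bounded sequences, where it is used in
  \<open>symbol_mult\<close>.\<close>

lemma schur_mult_assoc:
  assumes X: "(\<lambda>k. cmod (X k)) summable_on UNIV" and Y: "schur_le Y c" and Z: "\<And>l. cmod (Z l) \<le> d"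
  shows "(\<Sum>\<^sub>\<infinity>l. (\<Sum>\<^sub>\<infinity>k. X k * Y k l) * Z l) =
      (\<Sum>\<^sub>\<infinity>k. X k * (\<Sum>\<^sub>\<infinity>l. Y k l * Z l))"
proof -
  have XY: "(\<lambda>k. X k * Y k l) summable_on UNIV" for l
    by (rule summable_mult_bounded(3)[OF X]) (rule schur_le_entry[OF Y])
  have YZ: "(\<lambda>l. Y k l * Z l) summable_on UNIV" for k
    by (rule summable_mult_bounded(3)[OF schur_le_summable(1)[OF Y] Z])
  have "(\<Sum>\<^sub>\<infinity>l. (\<Sum>\<^sub>\<infinity>k. X k * Y k l) * Z l) =
      (\<Sum>\<^sub>\<infinity>l. \<Sum>\<^sub>\<infinity>k. X k * Y k l * Z l)"
    using XY by (simp add: infsum_cmult_left)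
  also have "\<dots> = (\<Sum>\<^sub>\<infinity>k. \<Sum>\<^sub>\<infinity>l. X k * Y k l * Z l)"
    by (rule infsum_swap_banach[symmetric]) (use summable_schur_triple[OF assms] in simp)
  also have "\<dots> = (\<Sum>\<^sub>\<infinity>k. X k * (\<Sum>\<^sub>\<infinity>l. Y k l * Z l))"
    using YZ by (simp add: infsum_cmult_right mult.assoc)
  finally show ?thesis .
qed

instantiation bmat :: (type) real_normed_algebra_1
begin

lift_definition zero_bmat :: "'a bmat" is "\<lambda>i j. 0" using schur_le_zero by blast
lift_definition one_bmat :: "'a bmat" is "\<lambda>i j. of_bool (i = j)" using schur_le_one by blast
lift_definition plus_bmat :: "'a bmat \<Rightarrow> 'a bmat \<Rightarrow> 'a bmat" is "\<lambda>X Y i j. X i j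
    + Y i j"
  using schur_le_add by blast
lift_definition uminus_bmat :: "'a bmat \<Rightarrow> 'a bmat" is "\<lambda>X i j. - X i j"
  using schur_le_uminus by blast
lift_definition minus_bmat :: "'a bmat \<Rightarrow> 'a bmat \<Rightarrow> 'a bmat" is "\<lambda>X Y i j. X i j
    - Y i j"
proof -
  fix X Y :: "'a \<Rightarrow> 'a \<Rightarrow> complex"
  assume "\<exists>c. schur_le X c" "\<exists>c. schur_le Y c"
  then obtain c d where "schur_le X c" "schur_le (\<lambda>i j. - Y i j) d"
    by (auto simp: schur_le_uminus)
  from schur_le_add[OF this] show "\<exists>c. schur_le (\<lambda>i j. X i j - Y i j) c" by auto
qed
lift_definition scaleR_bmat :: "real \<Rightarrow> 'a bmat \<Rightarrow> 'a bmat" is "\<lambda>r X i j. r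
    *\<^sub>R X i j"
  using schur_le_scaleR by blast
lift_definition times_bmat :: "'a bmat \<Rightarrow> 'a bmat \<Rightarrow> 'a bmat" is "\<lambda>X Y i j.
    \<Sum>\<^sub>\<infinity>k. X i k * Y k j"
  using schur_le_mult by blast

definition norm_bmat :: "'a bmat \<Rightarrow> real" where
  "norm_bmat X = Inf {c. schur_le (entry X) c}"

definition "dist_bmat (X :: 'a bmat) Y = norm (X - Y)"
definition "sgn_bmat (X :: 'a bmat) = scaleR (inverse (norm X)) X"
definition "uniformity_bmat = (INF e\<in>{0 <..}. principal {(X :: 'a bmat, Y). dist X Y < e})"
definition "open_bmat (U :: 'a bmat set) = (\<forall>X\<in>U. \<forall>\<^sub>F (X', Y) in uniformity. X' = X
    \<longrightarrow> Y \<in> U)"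

lemma norm_bmat_le: "schur_le (entry X) c \<Longrightarrow> norm X \<le> c"
  unfolding norm_bmat_def using schur_le_nonneg
  by (intro cInf_lower bdd_belowI[of _ 0]) auto

lemma schur_le_norm_bmat: "schur_le (entry X) (norm X)"
proof (rule schur_leI)
  have ne: "{c. schur_le (entry X) c} \<noteq> {}" using entry[of X] by auto
  fix i and F :: "'a set" assume F: "finite F"
  show "(\<Sum>j\<in>F. cmod (entry X i j)) \<le> norm X" "(\<Sum>j\<in>F. cmod (entry X j i)) \<le> norm X"
    unfolding norm_bmat_def
    by (rule cInf_greatest[OF ne], use schur_leD(1)[OF _ F] in blast)
      (rule cInf_greatest[OF ne], use schur_leD(2)[OF _ F] in blast)
qed

instance
proof
  fix X Y Z :: "'a bmat" and a b :: real
  show "X + Y + Z = X + (Y + Z)" "X + Y = Y + X" "0 + X = X" "- X + X = 0" "X - Y = X + - Y"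
    "a *\<^sub>R (X + Y) = a *\<^sub>R X + a *\<^sub>R Y" "(a + b) *\<^sub>R X = a *\<^sub>R X + b *\<^sub>R X"
    "a *\<^sub>R b *\<^sub>R X = (a * b) *\<^sub>R X" "1 *\<^sub>R X = X"
    by (transfer, simp add: algebra_simps)+
  have SX: "(\<lambda>k. cmod (entry X i k)) summable_on UNIV" "(\<lambda>k. cmod (entry X k i)) summable_on UNIV"
    for X :: "'a bmat" and i using schur_le_summable[OF schur_le_norm_bmat] by auto
  have EX: "cmod (entry X i k) \<le> norm X" for X :: "'a bmat" and i k
    by (rule schur_le_entry[OF schur_le_norm_bmat])
  have SXY: "(\<lambda>k. entry X i k * entry Y k j) summable_on UNIV" for X Y :: "'a bmat" and i j
    by (rule summable_mult_bounded(3)[OF SX(1) EX])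
  show "X * Y * Z = X * (Y * Z)"
    by (rule bmat_eqI) (simp add: times_bmat.rep_eq schur_mult_assoc[OF SX(1) schur_le_norm_bmat EX])
  show "(X + Y) * Z = X * Z + Y * Z" "X * (Y + Z) = X * Y + X * Z"
    by (rule bmat_eqI, simp add: times_bmat.rep_eq plus_bmat.rep_eq algebra_simps infsum_add SXY)+
  show "a *\<^sub>R X * Y = a *\<^sub>R (X * Y)" "X * a *\<^sub>R Y = a *\<^sub>R (X * Y)"
    by (rule bmat_eqI, simp add: times_bmat.rep_eq scaleR_bmat.rep_eq infsum_scaleR_right)+
  have sel: "(\<Sum>\<^sub>\<infinity>k. of_bool (i = k) * f k) = f i" "(\<Sum>\<^sub>\<infinity>k. f k *
      of_bool (k = i)) = f i"
    for i and f :: "'a \<Rightarrow> complex"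
    by (subst infsum_cong_neutral[where T = "{i}" and g = f]; auto)+
  show "1 * X = X" "X * 1 = X"
    by (rule bmat_eqI, simp add: times_bmat.rep_eq one_bmat.rep_eq sel)+
  show "(0 :: 'a bmat) \<noteq> 1"
  proof
    assume "(0 :: 'a bmat) = 1"
    then have "entry (0 :: 'a bmat) undefined undefined = entry 1 undefined undefined" by simp
    then show False by (simp add: zero_bmat.rep_eq one_bmat.rep_eq)
  qed
  show "dist X Y = norm (X - Y)" by (rule dist_bmat_def)
  show "sgn X = inverse (norm X) *\<^sub>R X" by (rule sgn_bmat_def)
  show "uniformity = (INF e\<in>{0 <..}. principal {(X :: 'a bmat, Y). dist X Y < e})"
    by (rule uniformity_bmat_def)
  show "open U = (\<forall>X\<in>U. \<forall>\<^sub>F (X', Y) in uniformity. X' = X \<longrightarrow> Y \<in>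
      U)" for U :: "'a bmat set"
    by (rule open_bmat_def)
  have n0: "norm X \<ge> 0" for X :: "'a bmat" using schur_le_nonneg[OF schur_le_norm_bmat] .
  show "(norm X = 0) = (X = 0)"
  proof
    assume "norm X = 0"
    then have "entry X i j = 0" for i j using EX[of X i j] by simp
    then show "X = 0" by (intro bmat_eqI) (simp add: zero_bmat.rep_eq)
  next
    assume "X = 0"
    then have "schur_le (entry X) 0" by (simp add: zero_bmat.rep_eq schur_le_zero)
    then show "norm X = 0" using norm_bmat_le[of X 0] n0[of X] by simp
  qed
  show "norm (X + Y) \<le> norm X + norm Y"
    by (rule norm_bmat_le) (simp add: plus_bmat.rep_eq schur_le_add schur_le_norm_bmat)
  have sc: "norm (a *\<^sub>R X) \<le> \<bar>a\<bar> * norm X" for a and X :: "'a bmat"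
    by (rule norm_bmat_le) (simp add: scaleR_bmat.rep_eq schur_le_scaleR[unfolded scaleR_conv_of_real]
        scaleR_conv_of_real schur_le_norm_bmat)
  show "norm (a *\<^sub>R X) = \<bar>a\<bar> * norm X"
  proof (cases "a = 0")
    case True
    then show ?thesis using sc[of a X] n0[of "a *\<^sub>R X"] by simp
  next
    case False
    have "inverse a *\<^sub>R a *\<^sub>R X = X"
      by (rule bmat_eqI) (simp add: scaleR_bmat.rep_eq False)
    then have "norm X \<le> \<bar>inverse a\<bar> * norm (a *\<^sub>R X)" using sc[of "inverse a" "a *\<^sub>R
        X"] by simp
    then have "\<bar>a\<bar> * norm X \<le> norm (a *\<^sub>R X)"
      using False by (simp add: field_simps abs_inverse)
    then show ?thesis using sc[of a X] by simp
  qed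
  show "norm (X * Y) \<le> norm X * norm Y"
    by (rule norm_bmat_le) (simp add: times_bmat.rep_eq schur_le_mult schur_le_norm_bmat)
  show "norm (1 :: 'a bmat) = 1"
  proof (rule antisym)
    show "norm (1 :: 'a bmat) \<le> 1" by (rule norm_bmat_le) (simp add: one_bmat.rep_eq schur_le_one)
    show "1 \<le> norm (1 :: 'a bmat)" using EX[of 1 undefined undefined] by (simp add: one_bmat.rep_eq)
  qed
qed

end

lemma entry_simps [simp]:
  "entry 0 i j = 0" "entry 1 i j = of_bool (i = j)"
  "entry (X + Y) i j = entry X i j + entry Y i j" "entry (- X) i j = - entry X i j"
  "entry (X - Y) i j = entry X i j - entry Y i j" "entry (r *\<^sub>R X) i j = r *\<^sub>R entry X i j"
  by (simp_all add: zero_bmat.rep_eq one_bmat.rep_eq plus_bmat.rep_eq uminus_bmat.rep_eq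
      minus_bmat.rep_eq scaleR_bmat.rep_eq)

lemma cmod_entry_le: "cmod (entry X i j) \<le> norm X"
  by (rule schur_le_entry[OF schur_le_norm_bmat])

lemma entry_row_summable: "(\<lambda>k. cmod (entry X i k)) summable_on UNIV"
  and entry_column_summable: "(\<lambda>k. cmod (entry X k i)) summable_on UNIV"
  by (rule schur_le_summable[OF schur_le_norm_bmat])+

lemma entry_mult_summable:
  "(\<lambda>k. cmod (entry X i k * entry Y k j)) summable_on UNIV"
  "(\<lambda>k. entry X i k * entry Y k j) summable_on UNIV"
  by (rule summable_mult_bounded(1,3)[OF entry_row_summable cmod_entry_le])+

lemma bounded_linear_entry: "bounded_linear (\<lambda>X. entry X i j)"
  by (rule bounded_linear_intro[where K = 1]) (auto simp: cmod_entry_le)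

lemma tendsto_entry: "(f \<longlongrightarrow> X) F \<Longrightarrow> ((\<lambda>n. entry (f n) i j)
    \<longlongrightarrow> entry X i j) F"
  by (rule bounded_linear.tendsto[OF bounded_linear_entry])

text \<open>Entrywise limits exist since each entry is bounded by the norm. The Cauchy estimate is a
  family of bounds on finite sums, so it survives letting one of the two indices tend to
  infinity.\<close>

instance bmat :: (type) banach
proof
  fix X :: "nat \<Rightarrow> 'a bmat" assume C: "Cauchy X"
  have "Cauchy (\<lambda>n. entry (X n) i j)" for i j
    by (rule bounded_linear.Cauchy[OF bounded_linear_entry C])
  then obtain L where L: "(\<lambda>n. entry (X n) i j) \<longlonglongrightarrow> L i j" for i j
    unfolding Cauchy_convergent_iff convergent_def by metis
  have diff: "\<exists>N. \<forall>n\<ge>N. schur_le (\<lambda>i j. entry (X n) i j - L i j) e" if "e > 0" for e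
  proof -
    obtain N where N: "norm (X m - X n) < e" if "m \<ge> N" "n \<ge> N" for m n
      using CauchyD[OF C \<open>e > 0\<close>] by blast
    have "schur_le (\<lambda>i j. entry (X n) i j - L i j) e" if n: "n \<ge> N" for n
    proof -
      have *: "schur_le (\<lambda>i j. entry (X n) i j - entry (X m) i j) (norm (X n - X m))" for m
        using schur_le_norm_bmat[of "X n - X m"] by (simp add: minus_bmat.rep_eq)
      have ev: "\<forall>\<^sub>F m in sequentially. norm (X n - X m) \<le> e"
        using N n by (intro eventually_sequentiallyI[of N]) (auto intro: less_imp_le)
      show ?thesis
      proof (rule schur_leI)
        fix i and F :: "'a set" assume F: "finite F"
        have "(\<lambda>m. \<Sum>j\<in>F. cmod (entry (X n) i j - entry (X m) i j)) \<longlonglongrightarrow>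
            (\<Sum>j\<in>F. cmod (entry (X n) i j - L i j))"
          by (intro tendsto_intros L)
        then show "(\<Sum>j\<in>F. cmod (entry (X n) i j - L i j)) \<le> e"
          by (rule tendsto_upperbound) (use ev F in \<open>auto elim!: eventually_mono intro: order_trans[OF
              schur_leD(1)[OF *]]\<close>)
        have "(\<lambda>m. \<Sum>j\<in>F. cmod (entry (X n) j i - entry (X m) j i)) \<longlonglongrightarrow>
            (\<Sum>j\<in>F. cmod (entry (X n) j i - L j i))"
          by (intro tendsto_intros L)
        then show "(\<Sum>j\<in>F. cmod (entry (X n) j i - L j i)) \<le> e"
          by (rule tendsto_upperbound) (use ev F in \<open>auto elim!: eventually_mono intro: order_trans[OF
              schur_leD(2)[OF *]]\<close>)
      qed
    qed
    then show ?thesis by blast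
  qed
  obtain N where N: "schur_le (\<lambda>i j. entry (X N) i j - L i j) 1" using diff[of 1] by auto
  have "schur_le (\<lambda>i j. entry (X N) i j + - (entry (X N) i j - L i j)) (norm (X N) + 1)"
    by (rule schur_le_add[OF schur_le_norm_bmat]) (use N in \<open>simp only: schur_le_uminus\<close>)
  then have entL: "entry (Bmat L) = L" by (intro entry_Bmat) simp
  have "X \<longlonglongrightarrow> Bmat L"
  proof (rule LIMSEQ_I)
    fix r :: real assume "r > 0"
    then obtain N where N: "\<forall>n\<ge>N. schur_le (\<lambda>i j. entry (X n) i j - L i j) (r / 2)"
      using diff[of "r / 2"] by auto
    have "norm (X n - Bmat L) < r" if "n \<ge> N" for n
    proof -
      have "norm (X n - Bmat L) \<le> r / 2"
        using N that by (intro norm_bmat_le) (simp add: entL minus_bmat.rep_eq)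
      then show ?thesis using \<open>r > 0\<close> by simp
    qed
    then show "\<exists>N. \<forall>n\<ge>N. norm (X n - Bmat L) < r" by blast
  qed
  then show "convergent X" by (rule convergentI)
qed

section \<open>Multiplicativity of the Fredholm determinant\<close>

lemma tendsto_entry_mult:
  "((\<lambda>C. \<Sum>k\<in>C. entry X i k * entry Y k j) \<longlongrightarrow> entry (X * Y) i j)
      (finite_subsets_at_top UNIV)"
  unfolding times_bmat.rep_eq by (rule infsum_tendsto[OF entry_mult_summable(2)])

lemma abs_sum_le_transpose: "abs_sum_le K c \<Longrightarrow> abs_sum_le (\<lambda>i j. K j i) c"
  unfolding abs_sum_le_def
proof (intro allI impI)
  fix F :: "('b \<times> 'a) set"
  assume *: "\<forall>F. finite F \<longrightarrow> (\<Sum>(i,j)\<in>F. cmod (K i j)) \<le> c" and F: "finite F"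
  have "(\<Sum>(i,j)\<in>F. cmod (K j i)) = (\<Sum>(i,j)\<in>prod.swap ` F. cmod (K i j))"
    by (subst sum.reindex) (auto simp: case_prod_unfold)
  then show "(\<Sum>(i,j)\<in>F. cmod (K j i)) \<le> c" using * F by simp
qed

lemma abs_sum_leI_rectangle:
  assumes "\<And>A B. finite A \<Longrightarrow> finite B \<Longrightarrow> (\<Sum>i\<in>A. \<Sum>j\<in>B. cmod
      (K i j)) \<le> c"
  shows "abs_sum_le K c"
  unfolding abs_sum_le_def
proof (intro allI impI)
  fix F :: "('a \<times> 'b) set" assume F: "finite F"
  have "(\<Sum>(i,j)\<in>F. cmod (K i j)) \<le> (\<Sum>(i,j)\<in>fst ` F \<times> snd ` F. cmod (K i j))"
    using F by (intro sum_mono2) (auto intro: rev_image_eqI)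
  also have "\<dots> \<le> c" using assms F by (simp add: sum.cartesian_product[symmetric])
  finally show "(\<Sum>(i,j)\<in>F. cmod (K i j)) \<le> c" .
qed

lemma abs_sum_leD_rectangle:
  "abs_sum_le K c \<Longrightarrow> finite A \<Longrightarrow> finite B \<Longrightarrow> (\<Sum>i\<in>A.
      \<Sum>j\<in>B. cmod (K i j)) \<le> c"
  using abs_sum_leD[of K c "A \<times> B"] by (simp add: sum.cartesian_product)

text \<open>Summing over \<open>i\<close> first uses a column sum of \<open>X\<close> and leaves the
  entries of \<open>K\<close>. The inner sum is cut to \<open>C\<close>, since the bound passes to
  the full product as an entrywise limit.\<close>

lemma abs_sum_le_schur_mult:
  fixes X K :: "'a \<Rightarrow> 'a \<Rightarrow> complex"
  assumes X: "schur_le X n" and K: "abs_sum_le K c" and C: "finite C"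
  shows "abs_sum_le (\<lambda>i j. \<Sum>k\<in>C. X i k * K k j) (n * c)"
proof (rule abs_sum_leI_rectangle)
  fix A B :: "'a set" assume AB: "finite A" "finite B"
  have "(\<Sum>i\<in>A. \<Sum>j\<in>B. cmod (\<Sum>k\<in>C. X i k * K k j)) \<le>
      (\<Sum>i\<in>A. \<Sum>j\<in>B. \<Sum>k\<in>C. cmod (X i k) * cmod (K k j))"
    by (intro sum_mono sum_norm_le) (simp add: norm_mult)
  also have "\<dots> = (\<Sum>i\<in>A. \<Sum>k\<in>C. \<Sum>j\<in>B. cmod (X i k) * cmod (K k j))"
    by (rule sum.cong[OF refl], rule sum.swap)
  also have "\<dots> = (\<Sum>k\<in>C. \<Sum>i\<in>A. \<Sum>j\<in>B. cmod (X i k) * cmod (K k j))"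
    by (rule sum.swap)
  also have "\<dots> = (\<Sum>k\<in>C. (\<Sum>i\<in>A. cmod (X i k)) * (\<Sum>j\<in>B. cmod (K k j)))"
    by (simp add: sum_product)
  also have "\<dots> \<le> (\<Sum>k\<in>C. n * (\<Sum>j\<in>B. cmod (K k j)))"
    using schur_leD(2)[OF X AB(1)] by (intro sum_mono mult_right_mono) (auto simp: sum_nonneg)
  also have "\<dots> \<le> n * c"
    using abs_sum_leD_rectangle[OF K C AB(2)] schur_le_nonneg[OF X]
    by (simp add: sum_distrib_left[symmetric] mult_left_mono)
  finally show "(\<Sum>i\<in>A. \<Sum>j\<in>B. cmod (\<Sum>k\<in>C. X i k * K k j)) \<le> n * c" .
qed

lemma abs_sum_le_mult:
  assumes "abs_sum_le (entry K) c"
  shows abs_sum_le_mult_bmat_left: "abs_sum_le (entry (X * K)) (norm X * c)"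
    and abs_sum_le_mult_bmat_right: "abs_sum_le (entry (K * X)) (c * norm X)"
proof -
  have ev: "\<forall>\<^sub>F C in finite_subsets_at_top UNIV. finite C"
    by (rule eventually_finite_subsets_at_top_weakI)
  show "abs_sum_le (entry (X * K)) (norm X * c)"
    by (rule abs_sum_le_tendsto[OF tendsto_entry_mult])
      (auto intro!: eventually_mono[OF ev] abs_sum_le_schur_mult[OF schur_le_norm_bmat assms])
  have "abs_sum_le (\<lambda>i j. \<Sum>k\<in>C. entry X k i * entry K j k) (norm X * c)" if "finite C" for C
    by (rule abs_sum_le_schur_mult[OF iffD2[OF schur_le_transpose schur_le_norm_bmat]
          abs_sum_le_transpose[OF assms] that])
  from abs_sum_le_transpose[OF this]
  have "abs_sum_le (\<lambda>i j. \<Sum>k\<in>C. entry K i k * entry X k j) (c * norm X)" if "finite C" for C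
    using that by (simp add: mult.commute)
  then show "abs_sum_le (entry (K * X)) (c * norm X)"
    by (intro abs_sum_le_tendsto[OF tendsto_entry_mult]) (auto intro!: eventually_mono[OF ev])
qed

lemma abs_sum_le_plus:
  "abs_sum_le (entry K) c \<Longrightarrow> abs_sum_le (entry L) d \<Longrightarrow> abs_sum_le (entry (K + L))
      (c + d)"
  using abs_sum_le_add[of "entry K" c "entry L" d] by (simp add: plus_bmat.rep_eq)

lemma abs_sum_le_scaleR:
  "abs_sum_le (entry K) c \<Longrightarrow> abs_sum_le (entry (r *\<^sub>R K)) (\<bar>r\<bar> * c)"
  using abs_sum_le_mult_left[of "entry K" c "of_real r"]
  by (simp add: scaleR_bmat.rep_eq scaleR_conv_of_real[where 'a = complex])

lemma abs_sum_le_uminus: "abs_sum_le (entry K) c \<Longrightarrow> abs_sum_le (entry (- K)) c"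
  using abs_sum_le_scaleR[of K c "-1"] by simp

lemma abs_sum_le_zero: "abs_sum_le (entry 0) 0"
  by (simp add: abs_sum_le_def)

lemma abs_sum_le_sum:
  assumes "\<And>m. m \<in> A \<Longrightarrow> abs_sum_le (entry (f m)) (c m)"
  shows "abs_sum_le (entry (\<Sum>m\<in>A. f m)) (\<Sum>m\<in>A. c m)"
  using assms by (induction A rule: infinite_finite_induct) (auto simp: abs_sum_le_zero intro: abs_sum_le_plus)

lemma abs_sum_le_sums:
  assumes "f sums X" "c sums d" and le: "\<And>m. abs_sum_le (entry (f m)) (c m)"
  shows "abs_sum_le (entry X) d"
proof -
  have c0: "c m \<ge> 0" for m by (rule abs_sum_le_nonneg[OF le])
  have "(\<Sum>m<n. c m) \<le> d" for n
    using sum_le_suminf[of c "{..<n}"] assms(2) c0 by (simp add: sums_iff)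
  then have *: "abs_sum_le (entry (\<Sum>m<n. f m)) d" for n
    by (rule abs_sum_le_mono[OF abs_sum_le_sum[OF le]])
  show ?thesis
    by (rule abs_sum_le_tendsto[OF tendsto_entry[OF assms(1)[unfolded sums_def]]]) (use * in auto)
qed

text \<open>Products of these majorise all truncated products at once, which provides a dominating
  kernel independent of the truncation.\<close>

definition bmat_abs :: "'a bmat \<Rightarrow> 'a bmat" where
  "bmat_abs X = Bmat (\<lambda>i j. of_real (cmod (entry X i j)))"

lemma entry_bmat_abs: "entry (bmat_abs X) i j = of_real (cmod (entry X i j))"
proof -
  have "schur_le (\<lambda>i j. complex_of_real (cmod (entry X i j))) (norm X)"
    using schur_le_norm_bmat[of X] by (simp add: schur_le_def)
  then show ?thesis unfolding bmat_abs_def by (simp add: entry_Bmat)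
qed

lemma entry_bmat_abs_mult:
  "entry (bmat_abs X * bmat_abs Y) i j = of_real (\<Sum>\<^sub>\<infinity>k. cmod (entry X i k * entry Y k j))"
proof -
  have "((\<lambda>k. complex_of_real (cmod (entry X i k * entry Y k j))) has_sum
      of_real (\<Sum>\<^sub>\<infinity>k. cmod (entry X i k * entry Y k j))) UNIV"
    by (rule has_sum_of_real[OF has_sum_infsum[OF entry_mult_summable(1)]])
  then show ?thesis by (simp add: times_bmat.rep_eq entry_bmat_abs norm_mult infsumI)
qed

lemma cmod_entry_mult_le:
  "cmod (\<Sum>k\<in>C. entry X i k * entry Y k j) \<le> cmod (entry (bmat_abs X * bmat_abs Y) i j)"
proof (cases "finite C")
  case True
  have "cmod (\<Sum>k\<in>C. entry X i k * entry Y k j) \<le> (\<Sum>k\<in>C. cmod (entry X i k * entry Y k j))"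
    by (rule norm_sum)
  also have "\<dots> \<le> (\<Sum>\<^sub>\<infinity>k. cmod (entry X i k * entry Y k j))"
    using True by (intro finite_sum_le_infsum entry_mult_summable) auto
  also have "\<dots> \<le> cmod (entry (bmat_abs X * bmat_abs Y) i j)"
    unfolding entry_bmat_abs_mult norm_of_real by simp
  finally show ?thesis .
qed simp

lemma abs_sum_le_bmat_abs: "abs_sum_le (entry K) c \<Longrightarrow> abs_sum_le (entry (bmat_abs K)) c"
  by (erule abs_sum_le_dominated) (simp add: entry_bmat_abs)

text \<open>The inner summation is truncated to the same finite set as the determinant, so that the
  finite identity applies as it stands. Absolute summability of \<open>A\<close> alone dominates
  both products.\<close>

lemma fredholm_det_Sylvester:
  assumes A: "abs_sum_le (entry A) c"
  shows "fredholm_det (entry (A * B)) = fredholm_det (entry (B * A))"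
proof -
  let ?M = "\<lambda>A B C i j. \<Sum>k\<in>C. entry A i k * entry B k j :: complex"
  have 1: "((\<lambda>C. det_on (\<lambda>i j. of_bool (i = j) + ?M A B C i j) C) \<longlongrightarrow>
      fredholm_det (entry (A * B)))
      (finite_subsets_at_top UNIV)"
    by (rule tendsto_det_on_identity_plus_abs_sum[OF abs_sum_le_mult_bmat_right[OF abs_sum_le_bmat_abs[OF A]]
          cmod_entry_mult_le tendsto_entry_mult])
  have 2: "((\<lambda>C. det_on (\<lambda>i j. of_bool (i = j) + ?M B A C i j) C) \<longlongrightarrow>
      fredholm_det (entry (B * A)))
      (finite_subsets_at_top UNIV)"
    by (rule tendsto_det_on_identity_plus_abs_sum[OF abs_sum_le_mult_bmat_left[OF abs_sum_le_bmat_abs[OF A]]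
          cmod_entry_mult_le tendsto_entry_mult])
  have 3: "\<forall>\<^sub>F C in finite_subsets_at_top UNIV.
      det_on (\<lambda>i j. of_bool (i = j) + ?M B A C i j) C = det_on (\<lambda>i j. of_bool (i = j) + ?M A B
          C i j) C"
    by (rule eventually_finite_subsets_at_top_weakI) (rule det_on_Sylvester)
  show ?thesis
    by (rule tendsto_unique[OF finite_subsets_at_top_neq_bot 1 Lim_transform_eventually[OF 2 3]])
qed

text \<open>\<open>K + L + K * L\<close> is \<open>(1 + K) * (1 + L) - 1\<close>. With the inner sum
  cut to \<open>C\<close> the determinant over \<open>C\<close> is exactly multiplicative, and both
  sides converge.\<close>

lemma fredholm_det_mult:
  assumes K: "abs_sum_le (entry K) c" and L: "abs_sum_le (entry L) d"
  shows "fredholm_det (entry (K + L + K * L)) = fredholm_det (entry K) * fredholm_det (entry L)"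
proof -
  let ?M = "\<lambda>C i j. entry K i j + entry L i j + (\<Sum>k\<in>C. entry K i k * entry L k j)"
  let ?D = "bmat_abs K + bmat_abs L + bmat_abs K * bmat_abs L"
  have 1: "((\<lambda>C. det_on (\<lambda>i j. of_bool (i = j) + entry K i j) C * det_on (\<lambda>i j. of_bool
      (i = j) + entry L i j) C)
      \<longlongrightarrow> fredholm_det (entry K) * fredholm_det (entry L)) (finite_subsets_at_top UNIV)"
    by (intro tendsto_mult tendsto_det_on_identity_plus_abs_sum[OF K] tendsto_det_on_identity_plus_abs_sum[OF L]) auto
  have 2: "((\<lambda>C. det_on (\<lambda>i j. of_bool (i = j) + ?M C i j) C) \<longlongrightarrow>
      fredholm_det (entry (K + L + K * L)))
      (finite_subsets_at_top UNIV)"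
  proof (rule tendsto_det_on_identity_plus_abs_sum)
    show "abs_sum_le (entry ?D) (c + d + c * norm (bmat_abs L))"
      by (intro abs_sum_le_plus abs_sum_le_mult_bmat_right abs_sum_le_bmat_abs K L)
    fix C i j
    have "cmod (?M C i j) \<le> cmod (entry K i j) + cmod (entry L i j) + cmod (\<Sum>k\<in>C. entry K i k *
        entry L k j)"
      by (intro order_trans[OF norm_triangle_ineq] add_right_mono norm_triangle_ineq)
    also have "\<dots> \<le> cmod (entry K i j) + cmod (entry L i j) + cmod (entry (bmat_abs K * bmat_abs L) i j)"
      by (intro add_left_mono cmod_entry_mult_le)
    also have "\<dots> = cmod (entry ?D i j)"
    proof -
      let ?s = "\<Sum>\<^sub>\<infinity>k. cmod (entry K i k * entry L k j)"
      have "?s \<ge> 0" by (rule infsum_nonneg) simp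
      moreover have "entry ?D i j = of_real (cmod (entry K i j) + cmod (entry L i j) + ?s)"
        by (simp add: entry_bmat_abs entry_bmat_abs_mult)
      ultimately show ?thesis unfolding entry_bmat_abs_mult by (simp only: norm_of_real) simp
    qed
    finally show "cmod (?M C i j) \<le> cmod (entry ?D i j)" .
    show "((\<lambda>C. ?M C i j) \<longlongrightarrow> entry (K + L + K * L) i j) (finite_subsets_at_top UNIV)"
      by (simp, intro tendsto_intros tendsto_entry_mult)
  qed
  have 3: "\<forall>\<^sub>F C in finite_subsets_at_top UNIV. det_on (\<lambda>i j. of_bool (i = j) + ?M C i j) C =
      det_on (\<lambda>i j. of_bool (i = j) + entry K i j) C * det_on (\<lambda>i j. of_bool (i = j) + entry L i j) C"
  proof (rule eventually_finite_subsets_at_top_weakI)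
    fix C :: "'a set" assume C: "finite C"
    have sel: "(\<Sum>k\<in>C. of_bool (a = k) * f k) = f a" "(\<Sum>k\<in>C. f k * of_bool (k = a)) = f a" if
        "a \<in> C"
      for a and f :: "'a \<Rightarrow> complex"
      using C that by (simp_all add: of_bool_def if_distrib if_distribR cong: if_cong)
    show "det_on (\<lambda>i j. of_bool (i = j) + ?M C i j) C =
      det_on (\<lambda>i j. of_bool (i = j) + entry K i j) C * det_on (\<lambda>i j. of_bool (i = j) + entry L i j) C"
      unfolding det_on_mult[OF C, symmetric]
      by (rule det_on_cong) (auto simp: distrib_left distrib_right sum.distrib sel)
  qed
  show ?thesis
    by (rule tendsto_unique[OF finite_subsets_at_top_neq_bot Lim_transform_eventually[OF 2 3] 1])
qed

text \<open>Used where \<open>X - 1\<close> has absolutely summable entries; the lemmas below also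
  hand this property on to products and conjugates.\<close>

definition bmat_det :: "'a bmat \<Rightarrow> complex" where
  "bmat_det X = fredholm_det (entry (X - 1))"

lemma bmat_det_1 [simp]: "bmat_det 1 = 1"
proof -
  \<comment> \<open>With the bound 0 the first order estimate is an equality.\<close>
  have "cmod (fredholm_det (entry (0 :: 'a bmat)) - 1 - fredholm_trace (entry (0 :: 'a bmat))) \<le> exp 0 - 1 - 0"
    by (rule fredholm_det_first_order) (rule abs_sum_le_zero)
  then show ?thesis by (simp add: bmat_det_def fredholm_trace_def)
qed

lemma bmat_det_mult:
  assumes "abs_sum_le (entry (X - 1)) c" "abs_sum_le (entry (Y - 1)) d"
  shows "bmat_det (X * Y) = bmat_det X * bmat_det Y"
    and "\<exists>e. abs_sum_le (entry (X * Y - 1)) e"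
proof -
  have *: "X * Y - 1 = (X - 1) + (Y - 1) + (X - 1) * (Y - 1)" by (simp add: algebra_simps)
  show "bmat_det (X * Y) = bmat_det X * bmat_det Y"
    unfolding bmat_det_def * by (rule fredholm_det_mult[OF assms])
  show "\<exists>e. abs_sum_le (entry (X * Y - 1)) e"
    unfolding * by (rule exI, rule abs_sum_le_plus[OF abs_sum_le_plus[OF assms] abs_sum_le_mult_bmat_right[OF
        assms(1)]])
qed

text \<open>By the Sylvester identity \<open>V\<close> may be moved to the front of
  \<open>W * (X - 1) * V\<close>, where it cancels \<open>W\<close>.\<close>

lemma bmat_det_conj:
  assumes "abs_sum_le (entry (X - 1)) c" "W * V = 1" "V * W = 1"
  shows "bmat_det (W * X * V) = bmat_det X"
    and "\<exists>e. abs_sum_le (entry (W * X * V - 1)) e"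
proof -
  have *: "W * X * V - 1 = (W * (X - 1)) * V" using assms(2) by (simp add: algebra_simps)
  have "V * (W * (X - 1)) = X - 1" using assms(3) by (simp flip: mult.assoc)
  then show "bmat_det (W * X * V) = bmat_det X"
    unfolding bmat_det_def *
    by (subst fredholm_det_Sylvester[OF abs_sum_le_mult_bmat_left[OF assms(1)]]) simp
  show "\<exists>e. abs_sum_le (entry (W * X * V - 1)) e"
    unfolding * by (rule exI, rule abs_sum_le_mult_bmat_right[OF abs_sum_le_mult_bmat_left[OF assms(1)]])
qed

section \<open>Determinants of commutators of exponentials\<close>

text \<open>The power is \<open>exp (k * Ln (1 + w))\<close>, and \<open>Ln (1 + w) - w\<close> is
  of order \<open>w\<close> squared, so that \<open>k\<close> times it is a bounded factor
  \<open>k * w\<close> times a factor tending to 0.\<close>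

lemma tendsto_one_plus_power:
  fixes w :: "nat \<Rightarrow> complex" and k :: "nat \<Rightarrow> nat"
  assumes w: "w \<longlonglongrightarrow> 0" and kw: "(\<lambda>n. of_nat (k n) * w n) \<longlonglongrightarrow> z"
  shows "(\<lambda>n. (1 + w n) ^ k n) \<longlonglongrightarrow> exp z"
proof -
  have ev: "\<forall>\<^sub>F n in sequentially. cmod (w n) < 1 / 2"
    using tendstoD[OF w, of "1 / 2"] by simp
  let ?r = "\<lambda>n. of_nat (k n) * (Ln (1 + w n) - w n)"
  have "?r \<longlonglongrightarrow> 0"
  proof (rule Lim_null_comparison)
    show "(\<lambda>n. 2 * cmod (of_nat (k n) * w n) * cmod (w n)) \<longlonglongrightarrow> 0"
      by (rule tendsto_eq_intros kw w refl)+ simp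
    show "\<forall>\<^sub>F n in sequentially. norm (?r n) \<le> 2 * cmod (of_nat (k n) * w n) * cmod (w n)"
      using ev
    proof eventually_elim
      case (elim n)
      have "cmod (Ln (1 + w n) - w n) \<le> (cmod (w n))\<^sup>2 / (1 - cmod (w n))"
        using elim by (intro Ln_approx_linear) simp
      also have "\<dots> \<le> (cmod (w n))\<^sup>2 / (1 / 2)"
        using elim by (intro divide_left_mono) auto
      finally have "cmod (Ln (1 + w n) - w n) \<le> 2 * cmod (w n) * cmod (w n)"
        by (simp add: power2_eq_square)
      then have "real (k n) * cmod (Ln (1 + w n) - w n) \<le> real (k n) * (2 * cmod (w n) * cmod (w n))"
        by (intro mult_left_mono) auto
      then show ?case by (simp add: norm_mult mult_ac)
    qed
  qed
  then have "(\<lambda>n. of_nat (k n) * w n + ?r n) \<longlonglongrightarrow> z + 0" by (intro tendsto_add kw)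
  then have "(\<lambda>n. exp (of_nat (k n) * Ln (1 + w n))) \<longlonglongrightarrow> exp z"
    by (auto intro!: tendsto_exp simp: algebra_simps)
  moreover have "\<forall>\<^sub>F n in sequentially. exp (of_nat (k n) * Ln (1 + w n)) = (1 + w n) ^ k n"
    using ev
  proof eventually_elim
    case (elim n)
    have "1 + w n \<noteq> 0"
    proof
      assume "1 + w n = 0"
      then have "w n = -1" by (simp add: add_eq_0_iff)
      then show False using elim by simp
    qed
    then show ?case by (simp add: exp_of_nat_mult)
  qed
  ultimately show ?thesis by (rule Lim_transform_eventually)
qed

lemma exp_cancel:
  fixes X Z :: "'a::{real_normed_algebra_1,banach}"
  shows "exp X * exp (- X) = 1" "exp (- X) * exp X = 1"
    "exp X * (exp (- X) * Z) = Z" "exp (- X) * (exp X * Z) = Z"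
  using exp_minus_inverse[of X] exp_minus_inverse[of "- X"] by (simp_all flip: mult.assoc)

text \<open>Leibniz rule for the commutator with \<open>Y\<close>: each of the \<open>m\<close>
  factors of the power is differentiated once.\<close>

lemma abs_sum_le_power_commutator:
  assumes "abs_sum_le (entry (A * Y - Y * A)) c"
  shows "abs_sum_le (entry (A ^ m * Y - Y * A ^ m)) (real m * norm A ^ (m - 1) * c)"
proof (induction m)
  case 0
  then show ?case by (simp add: abs_sum_le_def)
next
  case (Suc m)
  have c: "c \<ge> 0" by (rule abs_sum_le_nonneg[OF assms])
  have eq: "A ^ Suc m * Y - Y * A ^ Suc m = A * (A ^ m * Y - Y * A ^ m) + (A * Y - Y * A) * A ^ m"
    by (simp add: algebra_simps)
  \<comment> \<open>The case distinction takes care of the truncated subtraction in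
    \<open>m - 1\<close>; at \<open>m = 0\<close> the factor \<open>real m\<close> vanishes.\<close>
  have "norm A * (real m * norm A ^ (m - 1) * c) = real m * norm A ^ m * c" by (cases m) auto
  then have "norm A * (real m * norm A ^ (m - 1) * c) + c * norm (A ^ m) = real m * norm A ^ m * c + c * norm (A ^ m)"
    by (simp only:)
  also have "\<dots> \<le> real m * norm A ^ m * c + c * norm A ^ m"
    by (intro add_left_mono mult_left_mono norm_power_ineq c)
  also have "\<dots> = real (Suc m) * norm A ^ (Suc m - 1) * c" by (simp add: algebra_simps)
  finally have le: "norm A * (real m * norm A ^ (m - 1) * c) + c * norm (A ^ m) \<le>
      real (Suc m) * norm A ^ (Suc m - 1) * c" .
  show ?case
    unfolding eq
    by (rule abs_sum_le_mono[OF _ le])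
      (intro abs_sum_le_plus abs_sum_le_mult_bmat_left abs_sum_le_mult_bmat_right Suc assms)
qed

text \<open>Subtracting the commutator of \<open>A\<close> itself removes the linear term of the
  series, so the bound tends to 0 with \<open>A\<close>. Mere boundedness would not suffice for the
  scaling by \<open>1 / n\<close>.\<close>

lemma abs_sum_le_exp_commutator:
  assumes c: "abs_sum_le (entry (A * Y - Y * A)) c"
  shows "abs_sum_le (entry (exp A * Y - Y * exp A - (A * Y - Y * A))) (c * (exp (norm A) - 1))"
proof -
  define f where "f = (\<lambda>m. (A ^ m * Y - Y * A ^ m) /\<^sub>R fact m)"
  have "(\<lambda>m. (A ^ m /\<^sub>R fact m) * Y - Y * (A ^ m /\<^sub>R fact m)) sums (exp A * Y - Y * exp A)"
    by (intro sums_diff sums_mult sums_mult2 exp_converges)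
  then have "f sums (exp A * Y - Y * exp A)"
    by (simp add: f_def scaleR_diff_right)
  \<comment> \<open>The term \<open>f 0\<close> vanishes and \<open>f 1\<close> is the commutator of
    \<open>A\<close> and \<open>Y\<close>; both are split off.\<close>
  then have "(\<lambda>m. f (m + 2)) sums (exp A * Y - Y * exp A - (\<Sum>i<2. f i))"
    by (rule sums_split_initial_segment)
  then have 1: "(\<lambda>m. f (m + 2)) sums (exp A * Y - Y * exp A - (A * Y - Y * A))"
    by (simp add: f_def eval_nat_numeral)
  have "(\<lambda>m. norm A ^ m /\<^sub>R fact m) sums exp (norm A)" by (rule exp_converges)
  from sums_split_initial_segment[OF this, of 1]
  have "(\<lambda>m. norm A ^ (m + 1) /\<^sub>R fact (m + 1)) sums (exp (norm A) - 1)" by simp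
  from sums_mult[OF this, of c]
  have 2: "(\<lambda>m. c * (norm A ^ (m + 1) /\<^sub>R fact (m + 1))) sums (c * (exp (norm A) - 1))" .
  show ?thesis
  proof (rule abs_sum_le_sums[OF 1 2])
    fix m
    have "abs_sum_le (entry (f (m + 2))) (\<bar>inverse (fact (m + 2))\<bar> * (real (m + 2) * norm A ^ (m + 2
        - 1) * c))"
      unfolding f_def by (intro abs_sum_le_scaleR abs_sum_le_power_commutator c)
    also have "\<bar>inverse (fact (m + 2))\<bar> * (real (m + 2) * norm A ^ (m + 2 - 1) * c) =
        c * (norm A ^ (m + 1) /\<^sub>R fact (m + 1))"
    proof -
      have "fact (m + 2) = real (m + 2) * (fact (m + 1) :: real)" by (simp add: algebra_simps)
      then have "\<bar>inverse (fact (m + 2))\<bar> * real (m + 2) = inverse (fact (m + 1) :: real)"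
        by (simp add: inverse_mult_distrib del: fact_Suc)
      moreover have "m + 2 - 1 = m + 1" by simp
      ultimately show ?thesis by (simp only: mult.assoc[symmetric] real_scaleR_def) (simp only: mult_ac)
    qed
    finally show "abs_sum_le (entry (f (m + 2))) (c * (norm A ^ (m + 1) /\<^sub>R fact (m + 1)))" .
  qed
qed

definition exp_commutator :: "'a bmat \<Rightarrow> 'a bmat \<Rightarrow> 'a bmat" where
  "exp_commutator A B = exp A * exp B * exp (- A) * exp (- B)"

text \<open>The previous estimate is used twice, first to replace \<open>B\<close> by
  \<open>exp B\<close> and then \<open>A\<close> by \<open>exp A\<close>. The two errors add up to
  the exponential of \<open>norm A + norm B\<close>.\<close>

lemma abs_sum_le_exp_commutator_exp:
  assumes c: "abs_sum_le (entry (A * B - B * A)) c"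
  defines "e \<equiv> exp (norm A + norm B)"
  shows "abs_sum_le (entry (exp A * exp B - exp B * exp A - (A * B - B * A))) (c * (e - 1))"
    and "abs_sum_le (entry (exp A * exp B - exp B * exp A)) (c * e)"
proof -
  have "abs_sum_le (entry (B * A - A * B)) c"
    using abs_sum_le_uminus[OF c] by simp
  note 1 = abs_sum_le_exp_commutator[OF this]
  have "abs_sum_le (entry (A * exp B - exp B * A - (A * B - B * A))) (c * (exp (norm B) - 1))"
    using abs_sum_le_uminus[OF 1] by (simp add: algebra_simps)
  note 2 = this abs_sum_le_plus[OF this c]
  have "abs_sum_le (entry (A * exp B - exp B * A)) (c * exp (norm B))"
    using 2(2) by (simp add: algebra_simps)
  note 3 = abs_sum_le_exp_commutator[OF this]
  show 4: "abs_sum_le (entry (exp A * exp B - exp B * exp A - (A * B - B * A))) (c * (e - 1))"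
    using abs_sum_le_plus[OF 3 2(1)] by (simp add: e_def algebra_simps exp_add)
  show "abs_sum_le (entry (exp A * exp B - exp B * exp A)) (c * e)"
    using abs_sum_le_plus[OF 4 c] by (simp add: algebra_simps)
qed

lemma exp_commutator_minus_1:
  "exp_commutator A B - 1 = (exp A * exp B - exp B * exp A) * (exp (- A) * exp (- B))"
  by (simp add: exp_commutator_def algebra_simps exp_cancel)

lemma abs_sum_le_exp_commutator_minus_1:
  assumes "abs_sum_le (entry (A * B - B * A)) c"
  shows "\<exists>d. abs_sum_le (entry (exp_commutator A B - 1)) d"
  unfolding exp_commutator_minus_1
  by (rule exI, rule abs_sum_le_mult_bmat_right[OF abs_sum_le_exp_commutator_exp(2)[OF assms]])

text \<open>The group identity \<open>(g h, k) = g (h, k) g^-1 (g, k)\<close> for multiplicative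
  commutators, together with invariance of the determinant under conjugation.\<close>

lemma bmat_det_exp_commutator_add_left:
  assumes "abs_sum_le (entry (A * B - B * A)) c" "abs_sum_le (entry (A' * B - B * A')) c'" "A * A' = A' * A"
  shows "bmat_det (exp_commutator (A + A') B) = bmat_det (exp_commutator A B) * bmat_det (exp_commutator A' B)"
proof -
  obtain d d' where d: "abs_sum_le (entry (exp_commutator A B - 1)) d" "abs_sum_le (entry (exp_commutator A' B
      - 1)) d'"
    using abs_sum_le_exp_commutator_minus_1 assms(1,2) by metis
  have "exp (A + A') = exp A * exp A'" "exp (- (A + A')) = exp (- A') * exp (- A)"
    using exp_add_commuting[of A A'] exp_add_commuting[of "- A'" "- A"] assms(3) by (auto simp: algebra_simps)
  then have "exp_commutator (A + A') B = (exp A * exp_commutator A' B * exp (- A)) * exp_commutator A B"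
    by (simp add: exp_commutator_def mult.assoc exp_cancel del: minus_add_distrib)
  moreover note conj = bmat_det_conj[OF d(2) exp_cancel(1,2)[of A]]
  obtain e where "abs_sum_le (entry (exp A * exp_commutator A' B * exp (- A) - 1)) e"
    using conj(2) by blast
  from bmat_det_mult(1)[OF this d(1)] calculation show ?thesis by (simp add: conj(1))
qed

lemma bmat_det_exp_commutator_add_right:
  assumes "abs_sum_le (entry (A * B - B * A)) c" "abs_sum_le (entry (A * B' - B' * A)) c'" "B * B' = B' * B"
  shows "bmat_det (exp_commutator A (B + B')) = bmat_det (exp_commutator A B) * bmat_det (exp_commutator A B')"
proof -
  obtain d d' where d: "abs_sum_le (entry (exp_commutator A B - 1)) d" "abs_sum_le (entry (exp_commutator A B'
      - 1)) d'"
    using abs_sum_le_exp_commutator_minus_1 assms(1,2) by metis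
  have "exp (B + B') = exp B * exp B'" "exp (- (B + B')) = exp (- B') * exp (- B)"
    using exp_add_commuting[of B B'] exp_add_commuting[of "- B'" "- B"] assms(3) by (auto simp: algebra_simps)
  then have "exp_commutator A (B + B') = exp_commutator A B * (exp B * exp_commutator A B' * exp (- B))"
    by (simp add: exp_commutator_def mult.assoc exp_cancel del: minus_add_distrib)
  moreover note conj = bmat_det_conj[OF d(2) exp_cancel(1,2)[of B]]
  obtain e where "abs_sum_le (entry (exp B * exp_commutator A B' * exp (- B) - 1)) e"
    using conj(2) by blast
  from bmat_det_mult(1)[OF d(1) this] calculation show ?thesis by (simp add: conj(1))
qed

lemma exp_commutator_0 [simp]: "exp_commutator 0 B = 1" "exp_commutator A 0 = 1"
  by (simp_all add: exp_commutator_def exp_cancel)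

lemma abs_sum_le_scaleR_commutator:
  assumes "abs_sum_le (entry (A * B - B * A)) c"
  shows "abs_sum_le (entry ((s *\<^sub>R A) * (t *\<^sub>R B) - (t *\<^sub>R B) * (s *\<^sub>R A))) (\<bar>s *
      t\<bar> * c)"
  using abs_sum_le_scaleR[OF assms, of "s * t"] by (simp add: scaleR_diff_right mult.commute)

lemma abs_sum_le_scaleR_commutator_left:
  assumes "abs_sum_le (entry (A * B - B * A)) c"
  shows "abs_sum_le (entry ((s *\<^sub>R A) * B - B * (s *\<^sub>R A))) (\<bar>s\<bar> * c)"
  using abs_sum_le_scaleR_commutator[OF assms, of s 1] by (simp only: scaleR_one mult_1_right)

lemma abs_sum_le_scaleR_commutator_right:
  assumes "abs_sum_le (entry (A * B - B * A)) c"
  shows "abs_sum_le (entry (A * (t *\<^sub>R B) - (t *\<^sub>R B) * A)) (\<bar>t\<bar> * c)"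
  using abs_sum_le_scaleR_commutator[OF assms, of 1 t] by (simp only: scaleR_one mult_1_left)

lemma bmat_det_exp_commutator_multiple:
  assumes c: "abs_sum_le (entry (A * B - B * A)) c"
  shows "bmat_det (exp_commutator (real m *\<^sub>R A) (real n *\<^sub>R B)) = bmat_det (exp_commutator A B) ^
      (m * n)"
proof -
  have 1: "bmat_det (exp_commutator (real m *\<^sub>R A) B) = bmat_det (exp_commutator A B) ^ m"
    if "abs_sum_le (entry (A * B - B * A)) c" for m c and A B :: "'a bmat"
  proof (induction m)
    case (Suc m)
    have "bmat_det (exp_commutator (A + real m *\<^sub>R A) B) =
        bmat_det (exp_commutator A B) * bmat_det (exp_commutator (real m *\<^sub>R A) B)"
      using bmat_det_exp_commutator_add_left[OF that abs_sum_le_scaleR_commutator_left[OF that, of "real m"]]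
      by simp
    then show ?case using Suc by (simp add: algebra_simps)
  qed simp
  have 2: "bmat_det (exp_commutator A (real n *\<^sub>R B)) = bmat_det (exp_commutator A B) ^ n"
  proof (induction n)
    case (Suc n)
    have "bmat_det (exp_commutator A (B + real n *\<^sub>R B)) =
        bmat_det (exp_commutator A B) * bmat_det (exp_commutator A (real n *\<^sub>R B))"
      using bmat_det_exp_commutator_add_right[OF c abs_sum_le_scaleR_commutator_right[OF c, of "real n"]]
      by simp
    then show ?case using Suc by (simp add: algebra_simps)
  qed simp
  show ?thesis
    using 1[OF abs_sum_le_scaleR_commutator_right[OF c, of "real n"]] 2
    by (simp add: mult.commute[of m n] flip: power_mult)
qed

text \<open>Both sides are multiplicative in \<open>A\<close> and in \<open>B\<close>, so it suffices
  to compare them to second order on the commutators of \<open>exp (A / n)\<close> and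
  \<open>exp (B / n)\<close>.\<close>

theorem bmat_det_exp_commutator:
  assumes c: "abs_sum_le (entry (A * B - B * A)) c"
  shows "bmat_det (exp_commutator A B) = exp (fredholm_trace (entry (A * B - B * A)))"
proof -
  let ?C = "A * B - B * A"
  let ?z = "fredholm_trace (entry ?C)"
  have c0: "c \<ge> 0" by (rule abs_sum_le_nonneg[OF c])
  define t where "t = (\<lambda>n. 1 / real (Suc n))"
  have t0: "t n > 0" for n by (simp add: t_def)
  have tlim: "t \<longlonglongrightarrow> 0"
    unfolding t_def using LIMSEQ_inverse_real_of_nat by (simp add: divide_inverse)
  define G where "G = (\<lambda>n. exp_commutator (t n *\<^sub>R A) (t n *\<^sub>R B))"
  define \<eta> where "\<eta> = (\<lambda>n. norm (exp (- (t n *\<^sub>R A)) * exp (- (t n *\<^sub>R B)) - 1))"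
  define E where "E = (\<lambda>n. exp (t n * (norm A + norm B)))"
  \<comment> \<open>A relative error: \<open>G n - 1\<close> differs from \<open>t n\<close> squared
    times the additive commutator by \<open>t n\<close> squared times \<open>c * \<delta> n\<close>.
    The part \<open>E n - 1\<close> comes from expanding the exponentials, the part with
    \<open>\<eta> n\<close> from the right factor in \<open>exp_commutator_minus_1\<close>, which
    tends to 1.\<close>
  define \<delta> where "\<delta> = (\<lambda>n. (E n - 1) + E n * \<eta> n)"
  have explim: "(\<lambda>n. exp (- (t n *\<^sub>R X))) \<longlonglongrightarrow> 1" for X :: "'a bmat"
  proof -
    have "isCont (\<lambda>r. exp (r *\<^sub>R - X)) 0"
      by (rule has_vector_derivative_continuous[OF exp_scaleR_has_vector_derivative_right])
    from isCont_tendsto_compose[OF this tlim] show ?thesis by simp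
  qed
  have "(\<lambda>n. norm (exp (- (t n *\<^sub>R A)) * exp (- (t n *\<^sub>R B)) - 1))
      \<longlonglongrightarrow> norm (1 * 1 - 1 :: 'a bmat)"
    by (intro tendsto_intros explim)
  then have \<eta>: "\<eta> \<longlonglongrightarrow> 0" by (simp add: \<eta>_def)
  have "E \<longlonglongrightarrow> exp (0 * (norm A + norm B))" unfolding E_def by (intro tendsto_intros tlim)
  then have "\<delta> \<longlonglongrightarrow> (1 - 1) + 1 * 0" unfolding \<delta>_def by (intro
      tendsto_intros \<eta>) auto
  then have \<delta>: "\<delta> \<longlonglongrightarrow> 0" by simp
  have E1: "E n \<ge> 1" for n using t0[of n] by (simp add: E_def)
  have \<delta>0: "\<delta> n \<ge> 0" for n
    using E1[of n] by (simp add: \<delta>_def \<eta>_def)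
  have close: "abs_sum_le (entry (G n - 1 - (t n)\<^sup>2 *\<^sub>R ?C)) ((t n)\<^sup>2 * c * \<delta> n)" for n
  proof -
    let ?A = "t n *\<^sub>R A" and ?B = "t n *\<^sub>R B"
    let ?X = "exp ?A * exp ?B - exp ?B * exp ?A"
    have c': "abs_sum_le (entry (?A * ?B - ?B * ?A)) ((t n)\<^sup>2 * c)"
      using abs_sum_le_scaleR_commutator[OF c, of "t n" "t n"] by (simp add: power2_eq_square)
    have C': "?A * ?B - ?B * ?A = (t n)\<^sup>2 *\<^sub>R ?C"
      by (simp add: power2_eq_square scaleR_diff_right)
    have E: "exp (norm ?A + norm ?B) = E n"
      using t0[of n] by (simp add: E_def algebra_simps)
    note X = abs_sum_le_exp_commutator_exp[OF c', unfolded E]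
    have "G n - 1 - (t n)\<^sup>2 *\<^sub>R ?C = (?X - (?A * ?B - ?B * ?A)) + ?X * (exp (- ?A) * exp (- ?B) - 1)"
      unfolding G_def exp_commutator_minus_1 C' by (simp add: right_diff_distrib)
    moreover have "abs_sum_le (entry \<dots>) ((t n)\<^sup>2 * c * (E n - 1) + (t n)\<^sup>2 * c * E n * \<eta> n)"
      unfolding \<eta>_def by (intro abs_sum_le_plus abs_sum_le_mult_bmat_right X)
    moreover have "(t n)\<^sup>2 * c * (E n - 1) + (t n)\<^sup>2 * c * E n * \<eta> n = (t n)\<^sup>2 * c *
        \<delta> n"
      by (simp add: \<delta>_def algebra_simps)
    ultimately show ?thesis by simp
  qed
  have nG: "abs_sum_le (entry (G n - 1)) ((t n)\<^sup>2 * c * (1 + \<delta> n))" for n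
    using abs_sum_le_plus[OF close[of n] abs_sum_le_scaleR[OF c, of "(t n)\<^sup>2"]]
    by (simp add: algebra_simps)
  define w where "w = (\<lambda>n. bmat_det (G n) - 1)"
  have trace: "fredholm_trace (entry (G n - 1)) - (t n)\<^sup>2 * ?z = fredholm_trace (entry (G n - 1 - (t
      n)\<^sup>2 *\<^sub>R ?C))" for n
  proof -
    have "fredholm_trace (entry (G n - 1)) =
        fredholm_trace (\<lambda>i j. entry (G n - 1 - (t n)\<^sup>2 *\<^sub>R ?C) i j + of_real ((t
            n)\<^sup>2) * entry ?C i j)"
      by (intro arg_cong[where f = fredholm_trace] ext) (simp add: scaleR_conv_of_real[where 'a = complex])
    also have "\<dots> = fredholm_trace (entry (G n - 1 - (t n)\<^sup>2 *\<^sub>R ?C)) + of_real ((t n)\<^sup>2) * ?z"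
      by (subst fredholm_trace_add[OF close abs_sum_le_mult_left[OF c]]) (simp only: fredholm_trace_mult_left)
    finally show ?thesis by simp
  qed
  define s where "s = (\<lambda>n. (t n)\<^sup>2 * c * (1 + \<delta> n))"
  have s0: "s n \<ge> 0" for n using c0 \<delta>0[of n] by (simp add: s_def)
  have "s \<longlonglongrightarrow> 0\<^sup>2 * c * (1 + 0)" unfolding s_def by (intro tendsto_intros tlim \<delta>)
  then have slim: "s \<longlonglongrightarrow> 0" by simp
  \<comment> \<open>For \<open>s n \<le> 1\<close> the remainder \<open>exp s - 1 - s\<close> is at
    most \<open>s\<close> squared, which is of fourth order in \<open>t n\<close> and vanishes even
    after multiplication by \<open>k n\<close>.\<close>
  have err: "cmod (w n - (t n)\<^sup>2 * ?z) \<le> (s n)\<^sup>2 + (t n)\<^sup>2 * c * \<delta> n" if "s n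
      \<le> 1" for n
  proof -
    have "cmod (bmat_det (G n) - 1 - fredholm_trace (entry (G n - 1))) \<le> exp (s n) - 1 - s n"
      unfolding bmat_det_def s_def by (rule fredholm_det_first_order[OF nG])
    also have "\<dots> \<le> (s n)\<^sup>2" using exp_bound[OF s0 that] by simp
    finally have 1: "cmod (w n - fredholm_trace (entry (G n - 1))) \<le> (s n)\<^sup>2" by (simp add: w_def)
    have 2: "cmod (fredholm_trace (entry (G n - 1)) - (t n)\<^sup>2 * ?z) \<le> (t n)\<^sup>2 * c * \<delta> n"
      unfolding trace by (rule abs_sum_le_diagonal_summable(2)[OF close])
    show ?thesis
      using norm_triangle_ineq[of "w n - fredholm_trace (entry (G n - 1))" "fredholm_trace (entry (G n - 1)) -
          (t n)\<^sup>2 * ?z"] 1 2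
      by simp
  qed
  \<comment> \<open>The inverse square of \<open>t n\<close>: going back from the scaled matrices to
    \<open>A\<close> and \<open>B\<close> raises the determinant to this power.\<close>
  define k where "k = (\<lambda>n. Suc n * Suc n)"
  have kt: "real (k n) * (t n)\<^sup>2 = 1" for n unfolding k_def t_def of_nat_mult by (simp add:
      power2_eq_square del: of_nat_Suc)
  have "(\<lambda>n. of_nat (k n) * w n - ?z) \<longlonglongrightarrow> 0"
  proof (rule Lim_null_comparison)
    have "(\<lambda>n. s n * (c * (1 + \<delta> n)) + c * \<delta> n) \<longlonglongrightarrow> 0 * (c * (1 +
        0)) + c * 0"
      by (intro tendsto_intros slim \<delta>)
    then show "(\<lambda>n. s n * (c * (1 + \<delta> n)) + c * \<delta> n) \<longlonglongrightarrow> 0" by simp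
    have "\<forall>\<^sub>F n in sequentially. s n < 1" using order_tendstoD(2)[OF slim] by simp
    then show "\<forall>\<^sub>F n in sequentially. norm (of_nat (k n) * w n - ?z) \<le> s n * (c * (1 +
        \<delta> n)) + c * \<delta> n"
    proof eventually_elim
      case (elim n)
      have kt': "of_nat (k n) * (complex_of_real ((t n)\<^sup>2)) = 1"
        by (metis kt of_real_1 of_real_mult of_real_of_nat_eq)
      have "of_nat (k n) * w n - ?z = of_nat (k n) * (w n - (t n)\<^sup>2 * ?z)"
        unfolding right_diff_distrib mult.assoc[symmetric] using kt' by simp
      then have "norm (of_nat (k n) * w n - ?z) = real (k n) * cmod (w n - (t n)\<^sup>2 * ?z)"
        by (simp add: norm_mult del: of_real_power)
      also have "\<dots> \<le> real (k n) * ((s n)\<^sup>2 + (t n)\<^sup>2 * c * \<delta> n)"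
        using elim by (intro mult_left_mono err) auto
      also have "\<dots> = (real (k n) * (t n)\<^sup>2) * (s n * (c * (1 + \<delta> n)) + c * \<delta> n)"
        by (simp add: s_def algebra_simps power2_eq_square)
      finally show ?case by (simp add: kt)
    qed
  qed
  then have kw: "(\<lambda>n. of_nat (k n) * w n) \<longlonglongrightarrow> ?z" by (simp add: LIM_zero_iff)
  have "(\<lambda>n. of_real ((t n)\<^sup>2) * (of_nat (k n) * w n)) \<longlonglongrightarrow> of_real
      (0\<^sup>2) * ?z"
    by (intro tendsto_intros tlim kw)
  moreover have "of_real ((t n)\<^sup>2) * (of_nat (k n) * w n) = w n" for n
  proof -
    have "of_nat (k n) * (complex_of_real ((t n)\<^sup>2)) = 1"
      by (metis kt of_real_1 of_real_mult of_real_of_nat_eq)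
    then show ?thesis by (metis mult.assoc mult.commute mult_1)
  qed
  ultimately have "w \<longlonglongrightarrow> of_real (0\<^sup>2) * ?z" by (simp only:)
  then have "w \<longlonglongrightarrow> 0" by simp
  from tendsto_one_plus_power[OF this kw]
  have "(\<lambda>n. bmat_det (G n) ^ k n) \<longlonglongrightarrow> exp ?z" by (simp add: w_def)
  moreover have "bmat_det (G n) ^ k n = bmat_det (exp_commutator A B)" for n
  proof -
    have "real (Suc n) *\<^sub>R t n *\<^sub>R X = X" for X :: "'a bmat" by (simp add: t_def)
    then show ?thesis
      using bmat_det_exp_commutator_multiple[OF abs_sum_le_scaleR_commutator[OF c, of "t n" "t n"], of "Suc n"
          "Suc n"]
      by (simp add: G_def k_def del: of_nat_Suc)
  qed
  ultimately show ?thesis by (simp add: LIMSEQ_const_iff)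
qed

section \<open>Compressions of exponentials\<close>

text \<open>The relation passes to powers and then to the series. Typically \<open>U\<close> is a
  projection, and \<open>A\<close> or \<open>B\<close> may be 0, which shows how an exponential acts
  on a complement.\<close>

lemma exp_intertwine:
  fixes A B U :: "'a::{real_normed_algebra_1,banach}"
  assumes "A * U = U * B"
  shows "exp A * U = U * exp B"
proof -
  have "A ^ m * U = U * B ^ m" for m
  proof (induction m)
    case (Suc m)
    have "A ^ Suc m * U = A * (A ^ m * U)" by (simp add: mult.assoc)
    also have "\<dots> = A * U * B ^ m" by (simp add: Suc mult.assoc)
    also have "\<dots> = U * B ^ Suc m" by (simp add: assms mult.assoc)
    finally show ?case .
  qed simp
  then have "(A ^ m /\<^sub>R fact m) * U = U * (B ^ m /\<^sub>R fact m)" for m by simp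
  moreover have "(\<lambda>m. (A ^ m /\<^sub>R fact m) * U) sums (exp A * U)"
    by (intro sums_mult2 exp_converges)
  moreover have "(\<lambda>m. U * (B ^ m /\<^sub>R fact m)) sums (U * exp B)"
    by (intro sums_mult exp_converges)
  ultimately show ?thesis by (metis (no_types, lifting) sums_unique2 sums_cong)
qed

text \<open>The derivative of the exponential series, written in the shape that scaling a bound
  \<open>m * x ^ (m - 1) * c\<close> by the inverse factorial produces.\<close>

lemma sums_exp_derivative:
  fixes x c :: real
  shows "(\<lambda>m. \<bar>inverse (fact m)\<bar> * (real m * x ^ (m - 1) * c)) sums (exp x * c)"
proof -
  let ?g = "\<lambda>m. \<bar>inverse (fact m)\<bar> * (real m * x ^ (m - 1) * c)"
  have "(x ^ m /\<^sub>R fact m) * c = ?g (Suc m)" for m by (simp add: field_simps del: of_nat_Suc)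
  then have "(\<lambda>m. ?g (Suc m)) sums (exp x * c)"
    using sums_mult2[OF exp_converges[of x], of c] by (simp only:)
  then have "?g sums (exp x * c + ?g 0)" by (rule sums_Suc)
  then show ?thesis by simp
qed

text \<open>Kept abstract because it is interpreted both with the projection onto nonnegative
  indices as \<open>P\<close> and with the two projections exchanged.\<close>

locale complementary_projections =
  fixes P W :: "'a bmat"
  assumes PP: "P * P = P" and sum_1: "P + W = 1" and norm_P: "norm P \<le> 1"
begin

lemma W_eq: "W = 1 - P" using sum_1 by (simp add: algebra_simps)

lemma proj_simps [simp]: "P * P = P" "P * W = 0" "W * P = 0" "W * W = W"
  "P * (P * Z) = P * Z" "P * (W * Z) = 0" "W * (P * Z) = 0" "W * (W * Z) = W * Z"
  by (simp_all add: W_eq PP algebra_simps flip: mult.assoc)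

text \<open>The summand \<open>W\<close> makes the compression of 1 equal to 1, so that corners can
  be multiplied and inverted in the whole algebra.\<close>

definition compress :: "'a bmat \<Rightarrow> 'a bmat" where
  "compress X = P * X * P + W"

text \<open>Writing the middle \<open>P\<close> as \<open>1 - W\<close> isolates the product of two
  off-diagonal blocks. For Laurent matrices this is the formula
  \<open>T(f) T(1/f) = I - H(f) H(reflect (1/f))\<close>.\<close>

lemma compression_mult_inverse:
  assumes "X * Y = 1"
  shows "P * X * P * Y * P = P - P * X * W * Y * P"
proof -
  have "P * X * P * Y * P = P * X * (1 - W) * Y * P" by (simp add: W_eq)
  also have "\<dots> = P * (X * Y) * P - P * X * W * Y * P" by (simp add: algebra_simps)
  also have "\<dots> = P - P * X * W * Y * P" by (simp add: assms)
  finally show ?thesis .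
qed

lemma compress_mult_inverse:
  assumes "X * Y = 1"
  shows "compress X * compress Y = 1 - P * X * W * Y * P"
proof -
  have "compress X * compress Y = P * X * P * Y * P + W"
    by (simp add: compress_def distrib_left distrib_right mult.assoc)
  also have "\<dots> = (P + W) - P * X * W * Y * P" unfolding compression_mult_inverse[OF assms] by simp
  finally show ?thesis by (simp only: sum_1)
qed

lemma exp_compression:
  shows "P * exp (P * X * P) = exp (P * X * P) * P" "exp (P * X * P) * W = W" "W * exp (P * X * P) = W"
proof -
  show "P * exp (P * X * P) = exp (P * X * P) * P"
    by (rule exp_intertwine[symmetric]) (simp add: mult.assoc)
  show "exp (P * X * P) * W = W"
    using exp_intertwine[of "P * X * P" W 0] by (simp add: mult.assoc)
  show "W * exp (P * X * P) = W"
    using exp_intertwine[of 0 W "P * X * P"] by (simp flip: mult.assoc)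
qed

text \<open>The induction step shared by the absolute sum estimate, with \<open>U = P\<close>, and
  by the Hilbert-Schmidt estimate, with \<open>U = W\<close>.\<close>

lemma telescoping_bound:
  assumes U: "norm U \<le> 1" and c0: "0 \<le> c"
  shows "real m * norm Z ^ (m - 1) * c * norm (Z * P) + norm (U * Z ^ m) * c \<le>
    real (Suc m) * norm Z ^ (Suc m - 1) * c"
proof -
  have ZP: "norm (Z * P) \<le> norm Z"
    using norm_mult_ineq[of Z P] norm_P by (metis mult_left_le norm_ge_zero order_trans)
  have "norm (U * Z ^ m) \<le> norm U * norm (Z ^ m)" by (rule norm_mult_ineq)
  also have "\<dots> \<le> 1 * norm Z ^ m" by (intro mult_mono U norm_power_ineq) auto
  finally have UZ: "norm (U * Z ^ m) \<le> norm Z ^ m" by simp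
  have "real m * norm Z ^ (m - 1) * c * norm (Z * P) + norm (U * Z ^ m) * c \<le>
      real m * norm Z ^ (m - 1) * c * norm Z + norm Z ^ m * c"
    by (intro add_mono mult_left_mono mult_right_mono ZP UZ c0) (simp add: c0)
  also have "real m * norm Z ^ (m - 1) * c * norm Z = real m * norm Z ^ m * c" by (cases m) auto
  also have "real m * norm Z ^ m * c + norm Z ^ m * c = real (Suc m) * norm Z ^ (Suc m - 1) * c"
    by (simp add: algebra_simps)
  finally show ?thesis .
qed

text \<open>Compressed powers and powers of the compression obey the same recursion up to a term
  containing \<open>W * Z * P\<close>. Their difference therefore telescopes, and only this one
  block has to be summable.\<close>

lemma compress_exp_perturbation:
  assumes c: "abs_sum_le (entry (W * Z * P)) c"
  shows "\<exists>d. abs_sum_le (entry (compress (exp Z) - exp (P * Z * P))) d"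
proof -
  let ?A = "P * Z * P"
  define f where "f = (\<lambda>m. P * Z ^ m * P - P * ?A ^ m * P)"
  have c0: "c \<ge> 0" by (rule abs_sum_le_nonneg[OF c])
  have f: "abs_sum_le (entry (f m)) (real m * norm Z ^ (m - 1) * c)" for m
  proof (induction m)
    case 0
    then show ?case by (simp add: f_def abs_sum_le_def)
  next
    case (Suc m)
    have "Z ^ Suc m = Z ^ m * (P + W) * Z" by (simp add: sum_1 power_commutes)
    then have "P * Z ^ Suc m * P = P * Z ^ m * P * Z * P + P * Z ^ m * W * Z * P"
      by (simp add: algebra_simps)
    moreover have "P * ?A ^ Suc m * P = P * ?A ^ m * P * Z * P"
      by (simp add: power_commutes[symmetric] mult.assoc del: power_Suc add: power_Suc2)
    ultimately have eq: "f (Suc m) = f m * (Z * P) + (P * Z ^ m) * (W * Z * P)"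
      by (simp add: f_def algebra_simps)
    show ?case
      unfolding eq
      by (rule abs_sum_le_mono[OF abs_sum_le_plus[OF abs_sum_le_mult_bmat_right[OF Suc]
              abs_sum_le_mult_bmat_left[OF c]] telescoping_bound[OF norm_P c0]])
  qed
  have "(\<lambda>m. P * (Z ^ m /\<^sub>R fact m) * P - P * (?A ^ m /\<^sub>R fact m) * P) sums (P * exp Z * P
      - P * exp ?A * P)"
    by (intro sums_diff sums_mult sums_mult2 exp_converges)
  then have 1: "(\<lambda>m. f m /\<^sub>R fact m) sums (P * exp Z * P - P * exp ?A * P)"
    by (simp add: f_def scaleR_diff_right)
  have "abs_sum_le (entry (P * exp Z * P - P * exp ?A * P)) (exp (norm Z) * c)"
    by (rule abs_sum_le_sums[OF 1 sums_exp_derivative]) (rule abs_sum_le_scaleR[OF f])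
  moreover have "P * exp Z * P - P * exp ?A * P = compress (exp Z) - exp ?A"
  proof -
    have "exp ?A = exp ?A * P + exp ?A * W" by (simp add: sum_1 flip: distrib_left)
    also have "\<dots> = P * exp ?A * P + W"
      unfolding exp_compression(1,2) by (simp only: mult.assoc PP)
    finally have "exp ?A = P * exp ?A * P + W" .
    then show ?thesis unfolding compress_def by (metis add_diff_cancel_right)
  qed
  ultimately show ?thesis by auto
qed

text \<open>A Wiener-Hopf factorisation: triangularity means \<open>P * X = P * X * P\<close> and
  \<open>Y * P = P * Y * P\<close>, so \<open>P\<close> intertwines the exponentials of
  \<open>X\<close> and \<open>Y\<close> with those of their compressions.\<close>

lemma compress_exp_triangular:
  assumes X: "P * X * W = 0" and Y: "W * Y * P = 0"
  shows "compress (exp X * Z * exp Y) = exp (P * X * P) * compress Z * exp (P * Y * P)"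
proof -
  have "P * X = P * X * (P + W)" by (simp add: sum_1)
  then have "P * X = P * X * P" using X by (simp add: distrib_left)
  then have 1: "exp (P * X * P) * P = P * exp X"
    by (intro exp_intertwine) (simp add: mult.assoc)
  have "Y * P = (P + W) * Y * P" by (simp add: sum_1)
  then have "Y * P = P * Y * P" using Y by (simp add: distrib_right)
  then have 2: "exp Y * P = P * exp (P * Y * P)"
    by (intro exp_intertwine) (simp add: mult.assoc)
  have "exp (P * X * P) * compress Z * exp (P * Y * P) =
     (exp (P * X * P) * P) * Z * (P * exp (P * Y * P)) + exp (P * X * P) * W * exp (P * Y * P)"
    by (simp add: compress_def algebra_simps)
  also have "\<dots> = compress (exp X * Z * exp Y)"
    unfolding 1 2[symmetric] exp_compression(2,3) by (simp add: compress_def mult.assoc)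
  finally show ?thesis ..
qed

text \<open>For Laurent matrices of trigonometric polynomials, \<open>X\<close> is the negative and
  \<open>Y\<close> the nonnegative frequency part of the scalar symbol, and \<open>Z\<close> is the
  trace free matrix part. The three traces are those of the additive commutators of the
  compressions.\<close>

theorem bmat_det_compress_exp:
  assumes comm: "X * Y = Y * X" "X * Z = Z * X" "Y * Z = Z * Y"
    and X: "P * X * W = 0" and Y: "W * Y * P = 0"
    and c: "abs_sum_le (entry (W * X * P)) c" and d: "abs_sum_le (entry (W * Z * P)) d"
  shows "bmat_det (compress (exp (X + Y + Z)) * compress (exp (- (X + Y + Z)))) =
    exp (fredholm_trace (entry (P * Z * W * X * P)) + fredholm_trace (entry (P * Y * W * X * P)) +
      fredholm_trace (entry (P * Y * W * Z * P))) *
    bmat_det (compress (exp Z) * compress (exp (- Z)))"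
proof -
  let ?A = "P * X * P" and ?B = "P * Z * P" and ?C = "P * Y * P"
  let ?p = "exp ?A" and ?b = "exp ?B" and ?q = "exp ?C"
  let ?p' = "exp (- ?A)" and ?b' = "exp (- ?B)" and ?q' = "exp (- ?C)"
  have split: "exp (X + Y + Z) = exp X * exp Z * exp Y" "exp (- (X + Y + Z)) = exp (- X) * exp (- Z) * exp (- Y)"
  proof -
    have "exp (X + Y + Z) = exp (X + (Z + Y))" by (simp add: algebra_simps)
    also have "\<dots> = exp X * exp (Z + Y)" by (rule exp_add_commuting) (simp add: distrib_left distrib_right comm)
    also have "exp (Z + Y) = exp Z * exp Y" by (rule exp_add_commuting) (simp add: comm)
    finally show "exp (X + Y + Z) = exp X * exp Z * exp Y" by (simp add: mult.assoc)
    have "exp (- (X + Y + Z)) = exp (- X + (- Z + - Y))" by (simp add: algebra_simps)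
    also have "\<dots> = exp (- X) * exp (- Z + - Y)" by (rule exp_add_commuting) (simp add: algebra_simps comm)
    also have "exp (- Z + - Y) = exp (- Z) * exp (- Y)" by (rule exp_add_commuting) (simp add: comm)
    finally show "exp (- (X + Y + Z)) = exp (- X) * exp (- Z) * exp (- Y)" by (simp add: mult.assoc)
  qed
  have T: "compress (exp (X + Y + Z)) = ?p * compress (exp Z) * ?q"
      "compress (exp (- (X + Y + Z))) = ?p' * compress (exp (- Z)) * ?q'"
    using compress_exp_triangular[OF X Y, of "exp Z"] compress_exp_triangular[of "- X" "- Y" "exp (- Z)"] X Y
    unfolding split by simp_all
  define M where "M = ?b' * compress (exp Z)"
  define M' where "M' = compress (exp (- Z)) * ?b"
  obtain k where k: "abs_sum_le (entry (compress (exp Z) - ?b)) k"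
    using compress_exp_perturbation[OF d] by blast
  obtain k' where k': "abs_sum_le (entry (compress (exp (- Z)) - ?b')) k'"
    using compress_exp_perturbation[of "- Z" d] abs_sum_le_uminus[OF d] by auto
  have "M - 1 = ?b' * (compress (exp Z) - ?b)" by (simp add: M_def right_diff_distrib exp_cancel)
  then have M: "abs_sum_le (entry (M - 1)) (norm ?b' * k)" by (simp add: abs_sum_le_mult_bmat_left[OF k])
  have "M' - 1 = (compress (exp (- Z)) - ?b') * ?b" by (simp add: M'_def left_diff_distrib exp_cancel)
  then have M': "abs_sum_le (entry (M' - 1)) (k' * norm ?b)" by (simp add: abs_sum_le_mult_bmat_right[OF k'])
  have S: "compress (exp Z) = ?b * M" "compress (exp (- Z)) = M' * ?b'"
    by (simp_all add: M_def M'_def exp_cancel mult.assoc)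
  have AX: "P * X = P * X * P" and AY: "Y * P = P * Y * P"
  proof -
    have "P * X = P * X * (P + W)" by (simp add: sum_1)
    then show "P * X = P * X * P" using X by (simp add: distrib_left)
    have "Y * P = (P + W) * Y * P" by (simp add: sum_1)
    then show "Y * P = P * Y * P" using Y by (simp add: distrib_right)
  qed
  have expand: "P * U * V * P = P * U * P * V * P + P * U * W * V * P" for U V
  proof -
    have "P * U * V * P = P * U * (P + W) * V * P" by (simp add: sum_1)
    then show ?thesis by (simp add: algebra_simps)
  qed
  \<comment> \<open>As \<open>X\<close> and \<open>Z\<close> commute and
    \<open>P * X = P * X * P\<close>, the commutator of the compressions is
    \<open>P * Z * X * P - P * Z * P * X * P\<close>, in which only the part through
    \<open>W\<close> remains.\<close>
  have CXZ: "?A * ?B - ?B * ?A = P * Z * W * X * P"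
  proof -
    have "?A * ?B = (P * X * P) * (Z * P)" by (simp add: mult.assoc)
    also have "\<dots> = P * (X * Z) * P" unfolding AX[symmetric] by (simp only: mult.assoc)
    also have "\<dots> = P * Z * X * P" unfolding comm(2) by (simp only: mult.assoc)
    finally show ?thesis unfolding expand[of Z X] by (simp add: mult.assoc)
  qed
  have CXY: "?A * ?C - ?C * ?A = P * Y * W * X * P"
  proof -
    have "?A * ?C = (P * X * P) * (Y * P)" by (simp add: mult.assoc)
    also have "\<dots> = P * (X * Y) * P" unfolding AX[symmetric] by (simp only: mult.assoc)
    also have "\<dots> = P * Y * X * P" unfolding comm(1) by (simp only: mult.assoc)
    finally show ?thesis unfolding expand[of Y X] by (simp add: mult.assoc)
  qed
  have CZY: "?B * ?C - ?C * ?B = P * Y * W * Z * P"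
  proof -
    have "?B * ?C = P * Z * (P * Y * P)" by (simp add: mult.assoc)
    also have "\<dots> = P * (Z * Y) * P" unfolding AY[symmetric] by (simp only: mult.assoc)
    also have "\<dots> = P * Y * Z * P" unfolding comm(3)[symmetric] by (simp only: mult.assoc)
    finally show ?thesis unfolding expand[of Y Z] by (simp add: mult.assoc)
  qed
  have nXZ: "abs_sum_le (entry (?A * ?B - ?B * ?A)) (norm (P * Z) * c)"
    and nXY: "abs_sum_le (entry (?A * ?C - ?C * ?A)) (norm (P * Y) * c)"
    and nZY: "abs_sum_le (entry (?B * ?C - ?C * ?B)) (norm (P * Y) * d)"
    unfolding CXZ CXY CZY
    using abs_sum_le_mult_bmat_left[OF c, of "P * Z"] abs_sum_le_mult_bmat_left[OF c, of "P * Y"]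
      abs_sum_le_mult_bmat_left[OF d, of "P * Y"]
    by (simp_all add: mult.assoc)
  \<comment> \<open>Multiplied out, \<open>?G\<close> is
    \<open>?p * ?b * ?q * ?p' * ?b' * ?q'\<close>, the remainder after \<open>M\<close> and
    \<open>M'\<close> are removed from the product. Writing it with three commutators makes each
    determinant computable.\<close>
  let ?G = "exp_commutator ?A ?B * (?b * exp_commutator ?A ?C * ?b') * exp_commutator ?B ?C"
  obtain g1 where g1: "abs_sum_le (entry (exp_commutator ?A ?B - 1)) g1"
    using abs_sum_le_exp_commutator_minus_1[OF nXZ] by blast
  obtain g2 where g2: "abs_sum_le (entry (exp_commutator ?A ?C - 1)) g2"
    using abs_sum_le_exp_commutator_minus_1[OF nXY] by blast
  obtain g3 where g3: "abs_sum_le (entry (exp_commutator ?B ?C - 1)) g3"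
    using abs_sum_le_exp_commutator_minus_1[OF nZY] by blast
  note conj2 = bmat_det_conj[OF g2 exp_cancel(1,2)[of ?B]]
  obtain g2' where g2': "abs_sum_le (entry (?b * exp_commutator ?A ?C * ?b' - 1)) g2'"
    using conj2(2) by blast
  note mult12 = bmat_det_mult[OF g1 g2']
  obtain g12 where g12: "abs_sum_le (entry (exp_commutator ?A ?B * (?b * exp_commutator ?A ?C * ?b') - 1)) g12"
    using mult12(2) by blast
  note multG = bmat_det_mult[OF g12 g3]
  obtain g where g: "abs_sum_le (entry (?G - 1)) g" using multG(2) by blast
  have detG: "bmat_det ?G = exp (fredholm_trace (entry (P * Z * W * X * P)) +
      fredholm_trace (entry (P * Y * W * X * P)) + fredholm_trace (entry (P * Y * W * Z * P)))"
    unfolding multG(1) mult12(1) conj2(1) bmat_det_exp_commutator[OF nXZ] bmat_det_exp_commutator[OF nXY]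
      bmat_det_exp_commutator[OF nZY] CXZ CXY CZY exp_add ..
  \<comment> \<open>The product of interest is
    \<open>?p * ?b * M * ?q * ?p' * M' * ?b' * ?q'\<close>. Conjugating \<open>M\<close> by
    \<open>?U\<close> and \<open>M'\<close> by \<open>?V\<close> accounts for everything to their
    left, and \<open>?G\<close> is what stands to the right.\<close>
  let ?U = "?p * ?b" and ?U' = "?b' * ?p'" and ?V = "?p * ?b * ?q * ?p'" and ?V' = "?p * ?q' * ?b' * ?p'"
  note conjM = bmat_det_conj[OF M, of ?U ?U'] and conjM' = bmat_det_conj[OF M', of ?V ?V']
  have U: "?U * ?U' = 1" "?U' * ?U = 1" and V: "?V * ?V' = 1" "?V' * ?V = 1"
    by (simp_all add: mult.assoc exp_cancel)
  obtain m where m: "abs_sum_le (entry (?U * M * ?U' - 1)) m" using conjM(2)[OF U] by blast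
  obtain m' where m': "abs_sum_le (entry (?V * M' * ?V' - 1)) m'" using conjM'(2)[OF V] by blast
  obtain mm where mm: "abs_sum_le (entry (?U * M * ?U' * (?V * M' * ?V') - 1)) mm"
    using bmat_det_mult(2)[OF m m'] by blast
  obtain l where l: "abs_sum_le (entry (M * M' - 1)) l" using bmat_det_mult(2)[OF M M'] by blast
  have "bmat_det (compress (exp (X + Y + Z)) * compress (exp (- (X + Y + Z)))) =
      bmat_det (?U * M * ?U' * (?V * M' * ?V') * ?G)"
    unfolding T S by (simp add: exp_commutator_def mult.assoc exp_cancel)
  also have "\<dots> = bmat_det M * bmat_det M' * bmat_det ?G"
    by (simp only: bmat_det_mult(1)[OF mm g] bmat_det_mult(1)[OF m m'] conjM(1)[OF U] conjM'(1)[OF V])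
  also have "bmat_det M * bmat_det M' = bmat_det (?b * (M * M') * ?b')"
    unfolding bmat_det_conj(1)[OF l exp_cancel(1,2)] bmat_det_mult(1)[OF M M'] ..
  also have "?b * (M * M') * ?b' = compress (exp Z) * compress (exp (- Z))"
    by (simp add: S mult.assoc)
  finally show ?thesis by (simp add: detG)
qed

end

section \<open>Hilbert-Schmidt bounds and domination of entries\<close>

definition hs_le :: "('a \<Rightarrow> 'a \<Rightarrow> complex) \<Rightarrow> real \<Rightarrow> bool" where
  "hs_le K c \<longleftrightarrow> (\<forall>F. finite F \<longrightarrow> L2_set (\<lambda>(i,j). cmod (K i
      j)) F \<le> c)"

lemma hs_leD: "hs_le K c \<Longrightarrow> finite F \<Longrightarrow> L2_set (\<lambda>(i,j). cmod (K i j)) F \<le> c"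
  by (simp add: hs_le_def)

lemma hs_le_nonneg: "hs_le K c \<Longrightarrow> 0 \<le> c"
  using hs_leD[of K c "{}"] by simp

lemma hs_le_mono: "hs_le K c \<Longrightarrow> c \<le> d \<Longrightarrow> hs_le K d"
  unfolding hs_le_def by (meson order_trans)

lemma hs_leI_rectangle:
  assumes "\<And>A B. finite A \<Longrightarrow> finite B \<Longrightarrow> (\<Sum>i\<in>A. \<Sum>j\<in>B.
      (cmod (K i j))\<^sup>2) \<le> c\<^sup>2" "0 \<le> c"
  shows "hs_le K c"
  unfolding hs_le_def
proof (intro allI impI)
  fix F :: "('a \<times> 'a) set" assume F: "finite F"
  have "(\<Sum>p\<in>F. (case p of (i,j) \<Rightarrow> cmod (K i j))\<^sup>2) \<le> (\<Sum>p\<in>fst ` F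
      \<times> snd ` F. (case p of (i,j) \<Rightarrow> cmod (K i j))\<^sup>2)"
    using F by (intro sum_mono2) (auto intro: rev_image_eqI)
  also have "\<dots> = (\<Sum>i\<in>fst ` F. \<Sum>j\<in>snd ` F. (cmod (K i j))\<^sup>2)"
    by (simp add: sum.cartesian_product case_prod_unfold)
  also have "\<dots> \<le> c\<^sup>2" using assms F by simp
  finally show "L2_set (\<lambda>(i,j). cmod (K i j)) F \<le> c"
    unfolding L2_set_def using assms(2) by (rule real_le_lsqrt[rotated])
qed

lemma hs_leD_rectangle:
  assumes "hs_le K c" "finite A" "finite B"
  shows "(\<Sum>i\<in>A. \<Sum>j\<in>B. (cmod (K i j))\<^sup>2) \<le> c\<^sup>2"
proof -
  have "(L2_set (\<lambda>(i,j). cmod (K i j)) (A \<times> B))\<^sup>2 \<le> c\<^sup>2"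
    using assms by (intro power_mono hs_leD L2_set_nonneg) auto
  then show ?thesis
    by (simp add: L2_set_def sum_nonneg sum.cartesian_product case_prod_unfold)
qed

lemma hs_le_transpose: "hs_le K c \<Longrightarrow> hs_le (\<lambda>i j. K j i) c"
proof (rule hs_leI_rectangle)
  fix A B :: "'a set" assume "hs_le K c" "finite A" "finite B"
  then show "(\<Sum>i\<in>A. \<Sum>j\<in>B. (cmod (K j i))\<^sup>2) \<le> c\<^sup>2"
    using hs_leD_rectangle[of K c B A] by (subst sum.swap) simp
qed (rule hs_le_nonneg)

lemma hs_le_tendsto:
  assumes "\<And>i j. ((\<lambda>n. K n i j) \<longlongrightarrow> K' i j) G" "\<forall>\<^sub>F n in G. hs_le
      (K n) c" "G \<noteq> bot"
  shows "hs_le K' c"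
  unfolding hs_le_def
proof (intro allI impI)
  fix F :: "('a \<times> 'a) set" assume F: "finite F"
  have "((\<lambda>n. L2_set (\<lambda>(i,j). cmod (K n i j)) F) \<longlongrightarrow> L2_set (\<lambda>(i,j).
      cmod (K' i j)) F) G"
    unfolding case_prod_unfold L2_set_def by (intro tendsto_intros assms)
  then show "L2_set (\<lambda>(i,j). cmod (K' i j)) F \<le> c"
    by (rule tendsto_upperbound[OF _ _ assms(3)])
      (use assms(2) F in \<open>auto elim!: eventually_mono intro: hs_leD\<close>)
qed

text \<open>Schur test: one square root of \<open>cmod (X i k)\<close> goes to each factor of
  Cauchy-Schwarz. The row sums bound the first factor, and the column sums enter when the second is
  summed over \<open>i\<close>.\<close>

lemma hs_le_schur_mult:
  fixes X K :: "'a \<Rightarrow> 'a \<Rightarrow> complex"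
  assumes X: "schur_le X n" and K: "hs_le K c" and C: "finite C"
  shows "hs_le (\<lambda>i j. \<Sum>k\<in>C. X i k * K k j) (n * c)"
proof (rule hs_leI_rectangle)
  have n: "n \<ge> 0" by (rule schur_le_nonneg[OF X])
  show "0 \<le> n * c" using n hs_le_nonneg[OF K] by simp
  fix A B :: "'a set" assume AB: "finite A" "finite B"
  have CS: "(cmod (\<Sum>k\<in>C. X i k * K k j))\<^sup>2 \<le> n * (\<Sum>k\<in>C. cmod (X i k) * (cmod (K k
      j))\<^sup>2)" for i j
  proof -
    have "cmod (\<Sum>k\<in>C. X i k * K k j) \<le> (\<Sum>k\<in>C. sqrt (cmod (X i k)) * (sqrt (cmod (X i k))
        * cmod (K k j)))"
      by (intro sum_norm_le) (simp add: norm_mult flip: mult.assoc)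
    then have "(cmod (\<Sum>k\<in>C. X i k * K k j))\<^sup>2 \<le> (\<Sum>k\<in>C. sqrt (cmod (X i k)) * (sqrt
        (cmod (X i k)) * cmod (K k j)))\<^sup>2"
      by (intro power_mono) auto
    also have "\<dots> \<le> (\<Sum>k\<in>C. (sqrt (cmod (X i k)))\<^sup>2) * (\<Sum>k\<in>C. (sqrt (cmod (X i
        k)) * cmod (K k j))\<^sup>2)"
      by (rule Cauchy_Schwarz_ineq_sum)
    also have "\<dots> = (\<Sum>k\<in>C. cmod (X i k)) * (\<Sum>k\<in>C. cmod (X i k) * (cmod (K k j))\<^sup>2)"
      by (simp add: power_mult_distrib)
    also have "\<dots> \<le> n * (\<Sum>k\<in>C. cmod (X i k) * (cmod (K k j))\<^sup>2)"
      by (intro mult_right_mono schur_leD(1)[OF X C] sum_nonneg) auto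
    finally show ?thesis .
  qed
  have "(\<Sum>i\<in>A. \<Sum>j\<in>B. (cmod (\<Sum>k\<in>C. X i k * K k j))\<^sup>2) \<le>
      (\<Sum>i\<in>A. \<Sum>j\<in>B. n * (\<Sum>k\<in>C. cmod (X i k) * (cmod (K k j))\<^sup>2))"
    by (intro sum_mono CS)
  also have "\<dots> = n * (\<Sum>i\<in>A. \<Sum>j\<in>B. \<Sum>k\<in>C. cmod (X i k) * (cmod (K k j))\<^sup>2)"
    by (simp add: sum_distrib_left)
  also have "(\<Sum>i\<in>A. \<Sum>j\<in>B. \<Sum>k\<in>C. cmod (X i k) * (cmod (K k j))\<^sup>2) =
      (\<Sum>i\<in>A. \<Sum>k\<in>C. \<Sum>j\<in>B. cmod (X i k) * (cmod (K k j))\<^sup>2)"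
    by (rule sum.cong[OF refl], rule sum.swap)
  also have "\<dots> = (\<Sum>k\<in>C. \<Sum>i\<in>A. \<Sum>j\<in>B. cmod (X i k) * (cmod (K k j))\<^sup>2)"
    by (rule sum.swap)
  also have "\<dots> = (\<Sum>k\<in>C. (\<Sum>i\<in>A. cmod (X i k)) * (\<Sum>j\<in>B. (cmod (K k j))\<^sup>2))"
    by (simp add: sum_product)
  also have "n * \<dots> \<le> n * (\<Sum>k\<in>C. n * (\<Sum>j\<in>B. (cmod (K k j))\<^sup>2))"
    using schur_leD(2)[OF X AB(1)] n by (intro mult_left_mono sum_mono mult_right_mono) (auto simp: sum_nonneg)
  also have "\<dots> = n * n * (\<Sum>k\<in>C. \<Sum>j\<in>B. (cmod (K k j))\<^sup>2)"
    by (simp add: sum_distrib_left mult.assoc)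
  also have "\<dots> \<le> n * n * c\<^sup>2"
    using hs_leD_rectangle[OF K C AB(2)] n by (intro mult_left_mono) auto
  finally show "(\<Sum>i\<in>A. \<Sum>j\<in>B. (cmod (\<Sum>k\<in>C. X i k * K k j))\<^sup>2) \<le> (n * c)\<^sup>2"
    by (simp add: power2_eq_square mult_ac)
qed

lemma hs_le_mult:
  assumes "hs_le (entry K) c"
  shows hs_le_mult_left: "hs_le (entry (X * K)) (norm X * c)"
    and hs_le_mult_right: "hs_le (entry (K * X)) (c * norm X)"
proof -
  have ev: "\<forall>\<^sub>F C in finite_subsets_at_top UNIV. finite C"
    by (rule eventually_finite_subsets_at_top_weakI)
  show "hs_le (entry (X * K)) (norm X * c)"
    by (rule hs_le_tendsto[OF tendsto_entry_mult])
      (auto intro!: eventually_mono[OF ev] hs_le_schur_mult[OF schur_le_norm_bmat assms])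
  have "hs_le (\<lambda>i j. \<Sum>k\<in>C. entry X k i * entry K j k) (norm X * c)" if "finite C" for C
    by (rule hs_le_schur_mult[OF iffD2[OF schur_le_transpose schur_le_norm_bmat]
          hs_le_transpose[OF assms] that])
  from hs_le_transpose[OF this]
  have "hs_le (\<lambda>i j. \<Sum>k\<in>C. entry K i k * entry X k j) (c * norm X)" if "finite C" for C
    using that by (simp add: mult.commute)
  then show "hs_le (entry (K * X)) (c * norm X)"
    by (intro hs_le_tendsto[OF tendsto_entry_mult]) (auto intro!: eventually_mono[OF ev])
qed

lemma hs_le_plus:
  assumes "hs_le (entry K) c" "hs_le (entry L) d"
  shows "hs_le (entry (K + L)) (c + d)"
  unfolding hs_le_def
proof (intro allI impI)
  fix F :: "('a \<times> 'a) set" assume F: "finite F"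
  have "L2_set (\<lambda>(i,j). cmod (entry (K + L) i j)) F \<le>
      L2_set (\<lambda>p. (case p of (i,j) \<Rightarrow> cmod (entry K i j)) + (case p of (i,j) \<Rightarrow>
          cmod (entry L i j))) F"
    by (rule L2_set_mono) (auto intro: norm_triangle_ineq)
  also have "\<dots> \<le> L2_set (\<lambda>(i,j). cmod (entry K i j)) F + L2_set (\<lambda>(i,j). cmod (entry
      L i j)) F"
    by (rule L2_set_triangle_ineq)
  also have "\<dots> \<le> c + d" using assms F by (intro add_mono hs_leD)
  finally show "L2_set (\<lambda>(i,j). cmod (entry (K + L) i j)) F \<le> c + d" .
qed

lemma hs_le_zero: "hs_le (entry 0) 0"
  by (simp add: hs_le_def L2_set_def case_prod_unfold)

lemma hs_le_scaleR:
  assumes "hs_le (entry K) c"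
  shows "hs_le (entry (r *\<^sub>R K)) (\<bar>r\<bar> * c)"
proof -
  have "norm (r *\<^sub>R (1 :: 'a bmat)) = \<bar>r\<bar>" by simp
  then show ?thesis using hs_le_mult_left[OF assms, of "r *\<^sub>R 1"] by simp
qed

lemma hs_le_sum:
  assumes "\<And>m. m \<in> A \<Longrightarrow> hs_le (entry (f m)) (c m)"
  shows "hs_le (entry (\<Sum>m\<in>A. f m)) (\<Sum>m\<in>A. c m)"
  using assms
  by (induction A rule: infinite_finite_induct) (auto simp: hs_le_zero intro: hs_le_plus simp del: entry_simps)

lemma hs_le_sums:
  assumes "f sums X" "c sums d" and le: "\<And>m. hs_le (entry (f m)) (c m)"
  shows "hs_le (entry X) d"
proof -
  have c0: "c m \<ge> 0" for m by (rule hs_le_nonneg[OF le])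
  have "(\<Sum>m<n. c m) \<le> d" for n
    using sum_le_suminf[of c "{..<n}"] assms(2) c0 by (simp add: sums_iff)
  then have *: "hs_le (entry (\<Sum>m<n. f m)) d" for n
    by (rule hs_le_mono[OF hs_le_sum[OF le]])
  show ?thesis
    by (rule hs_le_tendsto[OF tendsto_entry[OF assms(1)[unfolded sums_def]]]) (use * in auto)
qed

context complementary_projections
begin

text \<open>Inserting \<open>P + W\<close> before the last factor of a power gives the same
  telescoping recursion as for absolute sums, now in the Hilbert-Schmidt norm.\<close>

lemma hs_le_exp_offdiagonal:
  assumes c: "hs_le (entry (W * Z * P)) c" and norm_W: "norm W \<le> 1"
  shows "\<exists>d. hs_le (entry (W * exp Z * P)) d"
proof -
  define f where "f = (\<lambda>m. W * Z ^ m * P)"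
  have c0: "c \<ge> 0" by (rule hs_le_nonneg[OF c])
  have f: "hs_le (entry (f m)) (real m * norm Z ^ (m - 1) * c)" for m
  proof (induction m)
    case 0
    then show ?case by (simp add: f_def hs_le_zero del: entry_simps)
  next
    case (Suc m)
    have "Z ^ Suc m = Z ^ m * (P + W) * Z" by (simp add: sum_1 power_commutes)
    then have eq: "f (Suc m) = f m * (Z * P) + (W * Z ^ m) * (W * Z * P)"
      by (simp add: f_def algebra_simps)
    show ?case
      unfolding eq
      by (rule hs_le_mono[OF hs_le_plus[OF hs_le_mult_right[OF Suc] hs_le_mult_left[OF c]] telescoping_bound[OF
          norm_W c0]])
  qed
  have "(\<lambda>m. W * (Z ^ m /\<^sub>R fact m) * P) sums (W * exp Z * P)"
    by (intro sums_mult sums_mult2 exp_converges)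
  then have 1: "(\<lambda>m. f m /\<^sub>R fact m) sums (W * exp Z * P)"
    by (simp add: f_def)
  show ?thesis
    by (rule exI, rule hs_le_sums[OF 1 sums_exp_derivative]) (rule hs_le_scaleR[OF f])
qed

end

section \<open>Diagonal projections and minors of products of Hilbert-Schmidt matrices\<close>

definition proj :: "'a set \<Rightarrow> 'a bmat" where
  "proj A = Bmat (\<lambda>i j. of_bool (i = j \<and> i \<in> A))"

lemma schur_le_proj: "schur_le (\<lambda>i j. of_bool (i = j \<and> i \<in> A)) 1"
proof (rule schur_leI)
  fix i and F :: "'a set" assume F: "finite F"
  have "(\<Sum>j\<in>F. cmod (of_bool (i = j \<and> i \<in> A))) \<le> (\<Sum>j\<in>F. of_bool (i = j))"
    by (intro sum_mono) auto
  then show "(\<Sum>j\<in>F. cmod (of_bool (i = j \<and> i \<in> A))) \<le> 1"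
    using F by (simp add: of_bool_def split: if_splits)
  have "(\<Sum>j\<in>F. cmod (of_bool (j = i \<and> j \<in> A))) \<le> (\<Sum>j\<in>F. of_bool (i = j))"
    by (intro sum_mono) auto
  then show "(\<Sum>j\<in>F. cmod (of_bool (j = i \<and> j \<in> A))) \<le> 1"
    using F by (simp add: of_bool_def split: if_splits)
qed

lemma entry_proj: "entry (proj A) i j = of_bool (i = j \<and> i \<in> A)"
  unfolding proj_def by (simp add: entry_Bmat[OF schur_le_proj])

lemma norm_proj: "norm (proj A) \<le> 1"
  by (rule norm_bmat_le) (simp add: entry_proj[abs_def] schur_le_proj)

lemma entry_proj_mult: "entry (proj A * X) i j = of_bool (i \<in> A) * entry X i j"
proof -
  have "(\<Sum>\<^sub>\<infinity>k. of_bool (i = k \<and> i \<in> A) * entry X k j) =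
      (\<Sum>\<^sub>\<infinity>k\<in>{i}. of_bool (i \<in> A) * entry X k j)"
    by (rule infsum_cong_neutral) auto
  then show ?thesis by (simp add: times_bmat.rep_eq entry_proj)
qed

lemma entry_mult_proj: "entry (X * proj A) i j = entry X i j * of_bool (j \<in> A)"
proof -
  have "(\<Sum>\<^sub>\<infinity>k. entry X i k * of_bool (k = j \<and> k \<in> A)) =
      (\<Sum>\<^sub>\<infinity>k\<in>{j}. entry X i k * of_bool (j \<in> A))"
    by (rule infsum_cong_neutral) auto
  then show ?thesis by (simp add: times_bmat.rep_eq entry_proj)
qed

lemma proj_mult_proj: "proj A * proj B = proj (A \<inter> B)"
  by (rule bmat_eqI) (auto simp: entry_proj_mult entry_proj)

lemma complementary_projections_proj: "complementary_projections (proj A) (proj (- A))"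
proof
  show "proj A * proj A = proj A" by (simp add: proj_mult_proj)
  show "proj A + proj (- A) = 1" by (rule bmat_eqI) (auto simp: entry_proj)
qed (rule norm_proj)

lemma hs_le_row_summable:
  assumes "hs_le K c"
  shows "(\<lambda>j. (cmod (K i j))\<^sup>2) summable_on UNIV"
    and "(\<lambda>i. \<Sum>\<^sub>\<infinity>j. (cmod (K i j))\<^sup>2) summable_on UNIV"
proof -
  have "abs_sum_le (\<lambda>i j. of_real ((cmod (K i j))\<^sup>2)) (c\<^sup>2)"
    by (rule abs_sum_leI_rectangle) (use hs_leD_rectangle[OF assms] in \<open>simp add: norm_power\<close>)
  from abs_sum_le_row_summable(1,2)[OF this]
  show "(\<lambda>j. (cmod (K i j))\<^sup>2) summable_on UNIV"
    "(\<lambda>i. \<Sum>\<^sub>\<infinity>j. (cmod (K i j))\<^sup>2) summable_on UNIV"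
    by (simp_all add: norm_power)
qed

text \<open>The Hadamard bound contains the geometric mean of these two terms for each index; their
  sum is a cruder majorant that is visibly summable.\<close>

definition hs_bound :: "('a \<Rightarrow> 'a \<Rightarrow> complex) \<Rightarrow> ('a \<Rightarrow> 'a
    \<Rightarrow> complex) \<Rightarrow> 'a \<Rightarrow> real" where
  "hs_bound D E i = (\<Sum>\<^sub>\<infinity>k. (cmod (D i k))\<^sup>2) + (\<Sum>\<^sub>\<infinity>k. (cmod (E
      k i))\<^sup>2)"

lemma hs_bound_nonneg: "hs_bound D E i \<ge> 0"
  unfolding hs_bound_def by (intro add_nonneg_nonneg infsum_nonneg) auto

lemma hs_bound_summable: "hs_le D c \<Longrightarrow> hs_le E d \<Longrightarrow> hs_bound D E summable_on UNIV"
  unfolding hs_bound_def[abs_def]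
  by (intro summable_on_add hs_le_row_summable hs_le_row_summable(2)[OF hs_le_transpose])

text \<open>The Hadamard bound holds for all truncations \<open>J\<close> of the inner sum, and a
  minor is continuous in its finitely many entries. Since only \<open>D\<close> and \<open>E\<close>
  occur in the bound, it is uniform over all dominated \<open>A\<close> and
  \<open>B\<close>.\<close>

lemma cmod_det_on_mult_le:
  assumes D: "hs_le D c" "\<And>i j. cmod (entry A i j) \<le> cmod (D i j)"
    and E: "hs_le E d" "\<And>i j. cmod (entry B i j) \<le> cmod (E i j)"
    and S: "finite S"
  shows "cmod (det_on (entry (A * B)) S) \<le> (\<Prod>i\<in>S. hs_bound D E i)"
proof -
  let ?a = "\<lambda>i. \<Sum>\<^sub>\<infinity>k. (cmod (D i k))\<^sup>2" and ?b = "\<lambda>i.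
      \<Sum>\<^sub>\<infinity>k. (cmod (E k i))\<^sup>2"
  have a0: "?a i \<ge> 0" and b0: "?b i \<ge> 0" for i by (intro infsum_nonneg; simp)+
  have le: "cmod (det_on (\<lambda>i j. \<Sum>k\<in>J. entry A i k * entry B k j) S) \<le> (\<Prod>i\<in>S.
      hs_bound D E i)"
    if J: "finite J" for J
  proof (rule power2_le_imp_le)
    have "(cmod (det_on (\<lambda>i j. \<Sum>k\<in>J. entry A i k * entry B k j) S))\<^sup>2 \<le>
        (\<Prod>i\<in>S. (\<Sum>k\<in>J. (cmod (entry A i k))\<^sup>2) * (\<Sum>k\<in>J. (cmod (entry B k
            i))\<^sup>2))"
      by (rule cmod_det_on_sum_product_le[OF S J])
    also have "\<dots> \<le> (\<Prod>i\<in>S. (hs_bound D E i)\<^sup>2)"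
    proof (rule prod_mono, rule conjI)
      fix i
      show "0 \<le> (\<Sum>k\<in>J. (cmod (entry A i k))\<^sup>2) * (\<Sum>k\<in>J. (cmod (entry B k i))\<^sup>2)"
        by (simp add: sum_nonneg)
      have "(\<Sum>k\<in>J. (cmod (entry A i k))\<^sup>2) \<le> (\<Sum>k\<in>J. (cmod (D i k))\<^sup>2)"
        by (intro sum_mono power_mono D) auto
      also have "\<dots> \<le> ?a i"
        by (rule finite_sum_le_infsum[OF hs_le_row_summable(1)[OF D(1)] J]) auto
      finally have 1: "(\<Sum>k\<in>J. (cmod (entry A i k))\<^sup>2) \<le> hs_bound D E i"
        using b0[of i] by (simp add: hs_bound_def)
      have "(\<Sum>k\<in>J. (cmod (entry B k i))\<^sup>2) \<le> (\<Sum>k\<in>J. (cmod (E k i))\<^sup>2)"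
        by (intro sum_mono power_mono E) auto
      also have "\<dots> \<le> ?b i"
        by (rule finite_sum_le_infsum[OF hs_le_row_summable(1)[OF hs_le_transpose[OF E(1)]] J]) auto
      finally have 2: "(\<Sum>k\<in>J. (cmod (entry B k i))\<^sup>2) \<le> hs_bound D E i"
        using a0[of i] by (simp add: hs_bound_def)
      show "(\<Sum>k\<in>J. (cmod (entry A i k))\<^sup>2) * (\<Sum>k\<in>J. (cmod (entry B k i))\<^sup>2) \<le>
          (hs_bound D E i)\<^sup>2"
        unfolding power2_eq_square[of "hs_bound D E i"] by (intro mult_mono 1 2 sum_nonneg hs_bound_nonneg) auto
    qed
    finally show "(cmod (det_on (\<lambda>i j. \<Sum>k\<in>J. entry A i k * entry B k j) S))\<^sup>2 \<le>
        (\<Prod>i\<in>S. hs_bound D E i)\<^sup>2"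
      by (simp add: prod_power_distrib)
    show "0 \<le> (\<Prod>i\<in>S. hs_bound D E i)" by (intro prod_nonneg hs_bound_nonneg)
  qed
  have "((\<lambda>J. cmod (det_on (\<lambda>i j. \<Sum>k\<in>J. entry A i k * entry B k j) S))
      \<longlongrightarrow> cmod (det_on (entry (A * B)) S))
      (finite_subsets_at_top UNIV)"
    by (intro tendsto_norm tendsto_det_on tendsto_entry_mult)
  then show ?thesis
    by (rule tendsto_upperbound) (auto intro!: eventually_finite_subsets_at_top_weakI le)
qed

text \<open>The dominating matrix has nonnegative real entries, so nothing cancels in its products,
  and domination is inherited by products and exponentials.\<close>

definition entries_dominated :: "'a bmat \<Rightarrow> 'a bmat \<Rightarrow> bool" where
  "entries_dominated X D \<longleftrightarrow> (\<forall>i j. Im (entry D i j) = 0 \<and> cmod (entry X i j)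
      \<le> Re (entry D i j))"

lemma entries_dominated_cmod: "entries_dominated X D \<Longrightarrow> cmod (entry X i j) \<le> cmod (entry D i j)"
  unfolding entries_dominated_def using complex_Re_le_cmod order_trans by blast

lemma entries_dominated_mult:
  assumes X: "entries_dominated X D" and Y: "entries_dominated Y E"
  shows "entries_dominated (X * Y) (D * E)"
  unfolding entries_dominated_def
proof (intro allI conjI)
  fix i j
  have s: "(\<lambda>k. entry D i k * entry E k j) summable_on UNIV" by (rule entry_mult_summable(2))
  have "(\<Sum>\<^sub>\<infinity>k. Im (entry D i k * entry E k j)) = Im (entry (D * E) i j)"
    unfolding times_bmat.rep_eq by (rule infsum_Im[OF s])
  then show "Im (entry (D * E) i j) = 0"
    using X Y by (simp add: entries_dominated_def)
  have "cmod (entry (X * Y) i j) \<le> (\<Sum>\<^sub>\<infinity>k. cmod (entry X i k * entry Y k j))"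
    unfolding times_bmat.rep_eq by (rule norm_infsum_bound[OF entry_mult_summable(1)])
  also have "\<dots> \<le> (\<Sum>\<^sub>\<infinity>k. Re (entry D i k * entry E k j))"
  proof (rule infsum_mono[OF entry_mult_summable(1) summable_on_Re[OF s]])
    fix k
    show "cmod (entry X i k * entry Y k j) \<le> Re (entry D i k * entry E k j)"
      using X Y by (auto simp: norm_mult entries_dominated_def intro!: mult_mono intro: order_trans[OF norm_ge_zero])
  qed
  also have "\<dots> = Re (entry (D * E) i j)"
    unfolding times_bmat.rep_eq by (rule infsum_Re[OF s])
  finally show "cmod (entry (X * Y) i j) \<le> Re (entry (D * E) i j)" .
qed

lemma entries_dominated_power: "entries_dominated X D \<Longrightarrow> entries_dominated (X ^ m) (D ^ m)"
  by (induction m) (auto simp: entries_dominated_mult, simp add: entries_dominated_def of_bool_def)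

lemma sums_entry: "f sums X \<Longrightarrow> (\<lambda>m. entry (f m) i j) sums entry X i j"
  by (rule bounded_linear.sums[OF bounded_linear_entry])

lemma entry_exp_sums: "(\<lambda>m. entry (X ^ m) i j /\<^sub>R fact m) sums entry (exp X) i j"
  using sums_entry[OF exp_converges[of X], of i j] by simp

lemma entries_dominated_exp:
  assumes "entries_dominated X D"
  shows "entries_dominated (exp X) (exp D)"
  unfolding entries_dominated_def
proof (intro allI conjI)
  fix i j
  have D: "Im (entry (D ^ m) i j) = 0" "cmod (entry (X ^ m) i j) \<le> Re (entry (D ^ m) i j)" for m
    using entries_dominated_power[OF assms, of m] by (auto simp: entries_dominated_def)
  have "(\<lambda>m. Im (entry (D ^ m) i j /\<^sub>R fact m)) sums Im (entry (exp D) i j)"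
    by (rule sums_Im[OF entry_exp_sums])
  then show "Im (entry (exp D) i j) = 0" by (simp add: D sums_iff)
  have Re: "(\<lambda>m. Re (entry (D ^ m) i j /\<^sub>R fact m)) sums Re (entry (exp D) i j)"
    by (rule sums_Re[OF entry_exp_sums])
  have le: "norm (entry (X ^ m) i j /\<^sub>R fact m) \<le> Re (entry (D ^ m) i j /\<^sub>R fact m)" for m
    using D(2)[of m] by (simp add: mult_left_mono)
  have "cmod (entry (exp X) i j) = cmod (\<Sum>m. entry (X ^ m) i j /\<^sub>R fact m)"
    using entry_exp_sums[of X i j] by (simp add: sums_iff)
  also have "\<dots> \<le> (\<Sum>m. Re (entry (D ^ m) i j /\<^sub>R fact m))"
    using le by (rule norm_suminf_le) (use Re in \<open>simp add: sums_iff\<close>)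
  also have "\<dots> = Re (entry (exp D) i j)" using Re by (simp add: sums_iff)
  finally show "cmod (entry (exp X) i j) \<le> Re (entry (exp D) i j)" .
qed

lemma tendsto_entry_mult_dominated:
  assumes X: "\<And>n. entries_dominated (X n) D" "\<And>i j. ((\<lambda>n. entry (X n) i j)
      \<longlongrightarrow> entry X' i j) G"
    and Y: "\<And>n. entries_dominated (Y n) E" "\<And>i j. ((\<lambda>n. entry (Y n) i j)
        \<longlongrightarrow> entry Y' i j) G"
  shows "((\<lambda>n. entry (X n * Y n) i j) \<longlongrightarrow> entry (X' * Y') i j) G"
  unfolding times_bmat.rep_eq
proof (rule tendsto_infsum_dominated[OF _ entry_mult_summable(1)[of D i E j]])
  show "norm (entry (X n) i k * entry (Y n) k j) \<le> norm (entry D i k * entry E k j)" for n k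
    unfolding norm_mult by (intro mult_mono entries_dominated_cmod X Y) auto
  show "((\<lambda>n. entry (X n) i k * entry (Y n) k j) \<longlongrightarrow> entry X' i k * entry Y' k j) G" for k
    by (intro tendsto_mult X Y)
qed

text \<open>Dominated convergence twice: in the inner sums of each power, and in the exponential
  series with the majorant built from \<open>norm D\<close>.\<close>

lemma tendsto_entry_exp_dominated:
  assumes X: "\<And>n. entries_dominated (X n) D" "\<And>i j. ((\<lambda>n. entry (X n) i j)
      \<longlongrightarrow> entry X' i j) G"
  shows "((\<lambda>n. entry (exp (X n)) i j) \<longlongrightarrow> entry (exp X') i j) G"
proof -
  have pow: "((\<lambda>n. entry (X n ^ m) i j) \<longlongrightarrow> entry (X' ^ m) i j) G" for m i j
  proof (induction m arbitrary: i j)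
    case (Suc m)
    have "((\<lambda>n. entry (X n * X n ^ m) i j) \<longlongrightarrow> entry (X' * X' ^ m) i j) G"
      by (rule tendsto_entry_mult_dominated[OF X entries_dominated_power[OF X(1)] Suc])
    then show ?case by simp
  qed simp
  have E: "entry (exp X) i j = (\<Sum>\<^sub>\<infinity>m. entry (X ^ m) i j /\<^sub>R fact m)" for X :: "'b bmat"
  proof -
    have "summable (\<lambda>m. norm (entry (X ^ m) i j /\<^sub>R fact m))"
    proof (rule summable_comparison_test')
      show "summable (\<lambda>m. norm X ^ m /\<^sub>R fact m)" using exp_converges[of "norm X"] by (simp add:
          sums_iff)
      show "norm (norm (entry (X ^ m) i j /\<^sub>R fact m)) \<le> norm X ^ m /\<^sub>R fact m" for m
        using order_trans[OF cmod_entry_le norm_power_ineq, of X m i j] by (simp add: mult_left_mono)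
    qed
    from norm_summable_imp_has_sum[OF this entry_exp_sums] show ?thesis by (simp add: infsumI)
  qed
  have s: "(\<lambda>m. norm D ^ m /\<^sub>R fact m) summable_on UNIV"
    using exp_converges[of "norm D"] by (intro summable_nonneg_imp_summable_on) (auto simp: sums_iff)
  show ?thesis
    unfolding E
  proof (rule tendsto_infsum_dominated[OF _ s])
    fix n m
    have "cmod (entry (X n ^ m) i j) \<le> norm D ^ m"
      using entries_dominated_cmod[OF entries_dominated_power[OF X(1)], of n m i j]
        order_trans[OF cmod_entry_le norm_power_ineq, of D m i j] by linarith
    then show "norm (entry (X n ^ m) i j /\<^sub>R fact m) \<le> norm D ^ m /\<^sub>R fact m"
      by (simp add: mult_left_mono)
    show "((\<lambda>n. entry (X n ^ m) i j /\<^sub>R fact m) \<longlongrightarrow> entry (X' ^ m) i j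
        /\<^sub>R fact m) G"
      by (intro tendsto_intros pow)
  qed
qed

section \<open>Laurent matrices\<close>

definition wiener :: "(int \<Rightarrow> 'n \<Rightarrow> 'n \<Rightarrow> complex) \<Rightarrow> bool" where
  "wiener c \<longleftrightarrow> (\<forall>\<alpha> \<beta>. (\<lambda>k. cmod (c k \<alpha> \<beta>))
      summable_on UNIV)"

definition krein :: "(int \<Rightarrow> 'n \<Rightarrow> 'n \<Rightarrow> complex) \<Rightarrow> bool" where
  "krein c \<longleftrightarrow> wiener c \<and> (\<forall>\<alpha> \<beta>. (\<lambda>k. of_int \<bar>k\<bar>
      * (cmod (c k \<alpha> \<beta>))\<^sup>2) summable_on UNIV)"

definition laurent :: "(int \<Rightarrow> 'n \<Rightarrow> 'n \<Rightarrow> complex) \<Rightarrow> (int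
    \<times> 'n) bmat" where
  "laurent c = Bmat (\<lambda>p q. c (fst p - fst q) (snd p) (snd q))"

definition scalar_symbol :: "(int \<Rightarrow> complex) \<Rightarrow> int \<Rightarrow> 'n \<Rightarrow> 'n
    \<Rightarrow> complex" where
  "scalar_symbol d k \<alpha> \<beta> = of_bool (\<alpha> = \<beta>) * d k"

definition restrict_symbol :: "int set \<Rightarrow> (int \<Rightarrow> 'n \<Rightarrow> 'n \<Rightarrow>
    complex) \<Rightarrow> int \<Rightarrow> 'n \<Rightarrow> 'n \<Rightarrow> complex" where
  "restrict_symbol K c k \<alpha> \<beta> = of_bool (k \<in> K) * c k \<alpha> \<beta>"

definition pos :: "(int \<times> 'n) set" where "pos = {p. fst p \<ge> 0}"

lemma sum_subset_times_UNIV_le: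
  fixes f :: "'b \<times> 'n::finite \<Rightarrow> real"
  assumes "finite F" "\<And>p. f p \<ge> 0"
  shows "(\<Sum>p\<in>F. f p) \<le> (\<Sum>\<beta>\<in>UNIV. \<Sum>k\<in>fst ` F. f (k, \<beta>))"
proof -
  have "(\<Sum>p\<in>F. f p) \<le> (\<Sum>p\<in>fst ` F \<times> UNIV. f p)"
    using assms by (intro sum_mono2) (auto intro: rev_image_eqI)
  also have "\<dots> = (\<Sum>k\<in>fst ` F. \<Sum>\<beta>\<in>UNIV. f (k, \<beta>))" by (simp add:
      sum.cartesian_product)
  finally show ?thesis by (subst sum.swap)
qed

lemma schur_le_laurent:
  fixes c :: "int \<Rightarrow> 'n::finite \<Rightarrow> 'n \<Rightarrow> complex"
  assumes "wiener c"
  shows "schur_le (\<lambda>p q. c (fst p - fst q) (snd p) (snd q)) (\<Sum>\<alpha>\<in>UNIV.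
      \<Sum>\<beta>\<in>UNIV. \<Sum>\<^sub>\<infinity>k. cmod (c k \<alpha> \<beta>))"
proof (rule schur_leI)
  let ?s = "\<lambda>\<alpha> \<beta>. \<Sum>\<^sub>\<infinity>k. cmod (c k \<alpha> \<beta>)"
  have s0: "?s \<alpha> \<beta> \<ge> 0" for \<alpha> \<beta> by (rule infsum_nonneg) simp
  have le: "(\<Sum>k\<in>A. cmod (c (h k) \<alpha> \<beta>)) \<le> ?s \<alpha> \<beta>" if "finite A" "inj h"
      for A and h :: "int \<Rightarrow> int" and \<alpha> \<beta>
  proof -
    have "(\<Sum>k\<in>A. cmod (c (h k) \<alpha> \<beta>)) = (\<Sum>k\<in>h ` A. cmod (c k \<alpha> \<beta>))"
      using that by (subst sum.reindex) (auto intro: inj_on_subset)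
    also have "\<dots> \<le> ?s \<alpha> \<beta>"
      using assms that by (intro finite_sum_le_infsum) (auto simp: wiener_def)
    finally show ?thesis .
  qed
  fix p :: "int \<times> 'n" and F :: "(int \<times> 'n) set" assume F: "finite F"
  have "(\<Sum>q\<in>F. cmod (c (fst p - fst q) (snd p) (snd q))) \<le> (\<Sum>\<beta>\<in>UNIV. ?s (snd p) \<beta>)"
    using F by (intro order_trans[OF sum_subset_times_UNIV_le[OF F]] sum_mono) (auto intro!: le injI)
  also have "\<dots> \<le> (\<Sum>\<alpha>\<in>UNIV. \<Sum>\<beta>\<in>UNIV. ?s \<alpha> \<beta>)"
    by (intro member_le_sum sum_nonneg s0) auto
  finally show "(\<Sum>q\<in>F. cmod (c (fst p - fst q) (snd p) (snd q))) \<le> (\<Sum>\<alpha>\<in>UNIV.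
      \<Sum>\<beta>\<in>UNIV. ?s \<alpha> \<beta>)" .
  have "(\<Sum>q\<in>F. cmod (c (fst q - fst p) (snd q) (snd p))) \<le> (\<Sum>\<alpha>\<in>UNIV. ?s \<alpha>
      (snd p))"
    using F by (intro order_trans[OF sum_subset_times_UNIV_le[OF F]] sum_mono) (auto intro!: le injI)
  also have "\<dots> \<le> (\<Sum>\<alpha>\<in>UNIV. \<Sum>\<beta>\<in>UNIV. ?s \<alpha> \<beta>)"
    by (intro sum_mono member_le_sum s0) auto
  finally show "(\<Sum>q\<in>F. cmod (c (fst q - fst p) (snd q) (snd p))) \<le> (\<Sum>\<alpha>\<in>UNIV.
      \<Sum>\<beta>\<in>UNIV. ?s \<alpha> \<beta>)" .
qed

lemma entry_laurent:
  fixes c :: "int \<Rightarrow> 'n::finite \<Rightarrow> 'n \<Rightarrow> complex"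
  assumes "wiener c"
  shows "entry (laurent c) p q = c (fst p - fst q) (snd p) (snd q)"
  unfolding laurent_def by (simp add: entry_Bmat[OF schur_le_laurent[OF assms]])

lemma wiener_restrict_symbol: "wiener c \<Longrightarrow> wiener (restrict_symbol K c)"
  unfolding wiener_def restrict_symbol_def
proof (intro allI)
  fix \<alpha> \<beta> assume "\<forall>\<alpha> \<beta>. (\<lambda>k. cmod (c k \<alpha> \<beta>)) summable_on UNIV"
  then show "(\<lambda>k. cmod (of_bool (k \<in> K) * c k \<alpha> \<beta>)) summable_on UNIV"
    by (rule_tac Infinite_Sum.abs_summable_on_comparison_test'[where g = "\<lambda>k. cmod (c k \<alpha>
        \<beta>)"]) auto
qed

lemma wiener_scalar_symbol:
  assumes "(\<lambda>k. cmod (d k)) summable_on UNIV"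
  shows "wiener (scalar_symbol d)"
  unfolding wiener_def scalar_symbol_def using assms by (auto simp: of_bool_def)

lemma krein_scalar_symbol:
  assumes "(\<lambda>k. cmod (d k)) summable_on UNIV" "(\<lambda>k. of_int \<bar>k\<bar> * (cmod (d
      k))\<^sup>2) summable_on UNIV"
  shows "krein (scalar_symbol d)"
  using wiener_scalar_symbol[OF assms(1)] assms(2) by (auto simp: krein_def scalar_symbol_def of_bool_def)

lemma restrict_scalar_symbol: "restrict_symbol K (scalar_symbol d) = scalar_symbol (\<lambda>k. of_bool (k
    \<in> K) * d k)"
  by (auto simp: restrict_symbol_def scalar_symbol_def fun_eq_iff)

lemma infsum_int_times_finite:
  fixes f :: "int \<times> 'n::finite \<Rightarrow> complex"
  assumes "f summable_on UNIV"
  shows "infsum f UNIV = (\<Sum>\<^sub>\<infinity>k. \<Sum>\<gamma>\<in>UNIV. f (k, \<gamma>))"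
  using infsum_Sigma'_banach[of "\<lambda>k \<gamma>. f (k, \<gamma>)" UNIV "\<lambda>_. UNIV"] assms by simp

lemma entry_mult_int_times_finite:
  fixes X Y :: "(int \<times> 'n::finite) bmat"
  shows "entry (X * Y) p q = (\<Sum>\<^sub>\<infinity>k. \<Sum>\<gamma>\<in>UNIV. entry X p (k, \<gamma>) *
      entry Y (k, \<gamma>) q)"
  unfolding times_bmat.rep_eq by (rule infsum_int_times_finite) (rule entry_mult_summable(2))

text \<open>The reflection \<open>m \<mapsto> fst p + fst q - m\<close> exchanges the two
  convolutions, and scalar coefficients commute with matrix coefficients.\<close>

lemma laurent_scalar_commute:
  fixes c :: "int \<Rightarrow> 'n::finite \<Rightarrow> 'n \<Rightarrow> complex"
  assumes d: "(\<lambda>k. cmod (d k)) summable_on UNIV" and c: "wiener c"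
  shows "laurent (scalar_symbol d) * laurent c = laurent c * laurent (scalar_symbol d)"
proof (rule bmat_eqI)
  fix p q :: "int \<times> 'n"
  note e = entry_laurent[OF c] entry_laurent[OF wiener_scalar_symbol[OF d]]
  have "bij (\<lambda>m. fst p + fst q - m :: int)"
    by (rule bij_betw_byWitness[where f' = "\<lambda>m. fst p + fst q - m"]) auto
  from infsum_reindex_bij_betw[OF this, of "\<lambda>m. d (fst p - m) * c (m - fst q) (snd p) (snd q)"]
  have "(\<Sum>\<^sub>\<infinity>m. d (fst p - m) * c (m - fst q) (snd p) (snd q)) =
      (\<Sum>\<^sub>\<infinity>m. c (fst p - m) (snd p) (snd q) * d (m - fst q))"
    by (simp add: algebra_simps)
  then show "entry (laurent (scalar_symbol d) * laurent c) p q = entry (laurent c * laurent (scalar_symbol d)) p q"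
    by (simp add: entry_mult_int_times_finite e scalar_symbol_def of_bool_def if_distrib if_distribR cong: if_cong)
qed

section \<open>Off-diagonal blocks of Laurent matrices\<close>

lemma sum_Hankel_le:
  fixes d :: "int \<Rightarrow> real"
  assumes d0: "\<And>k. d k \<ge> 0" and d: "(\<lambda>k. of_int \<bar>k\<bar> * d k) summable_on UNIV" and
      fin: "finite A" "finite B"
  shows "(\<Sum>j\<in>A. \<Sum>k\<in>B. of_bool (j < 0 \<and> 0 \<le> k) * d (j - k)) \<le>
      (\<Sum>\<^sub>\<infinity>k. of_int \<bar>k\<bar> * d k)"
proof -
  define F where "F = {(j,k) \<in> A \<times> B. j < 0 \<and> 0 \<le> k}"
  define M where "M = (\<lambda>(j,k). j - k) ` F"
  have finF: "finite F" using fin by (auto simp: F_def intro: finite_subset[of _ "A \<times> B"])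
  have "(\<Sum>j\<in>A. \<Sum>k\<in>B. of_bool (j < 0 \<and> 0 \<le> k) * d (j - k)) =
      (\<Sum>(j,k)\<in>A \<times> B. of_bool (j < 0 \<and> 0 \<le> k) * d (j - k))"
    by (simp add: sum.cartesian_product)
  also have "\<dots> = (\<Sum>(j,k)\<in>F. d (j - k))"
    using fin by (intro sum.mono_neutral_cong_right) (auto simp: F_def)
  also have "\<dots> = (\<Sum>(m,j)\<in>(\<lambda>(j,k). (j - k, j)) ` F. d m)"
    by (subst sum.reindex) (auto simp: inj_on_def case_prod_unfold)
  also have "\<dots> \<le> (\<Sum>(m,j)\<in>Sigma M (\<lambda>m. {m..<0}). d m)"
    using finF d0 by (intro sum_mono2) (auto simp: M_def F_def)
  \<comment> \<open>A difference \<open>m < 0\<close> arises from exactly \<open>- m\<close> pairs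
    of indices \<open>j < 0\<close> and \<open>k \<ge> 0\<close>. This is the origin of the weight
    in the second part of the norm.\<close>
  also have "\<dots> = (\<Sum>m\<in>M. real (nat (- m)) * d m)"
    using finF by (subst sum.Sigma[symmetric]) (auto simp: M_def)
  also have "\<dots> \<le> (\<Sum>m\<in>M. of_int \<bar>m\<bar> * d m)"
    using d0 by (intro sum_mono mult_right_mono) auto
  also have "\<dots> \<le> (\<Sum>\<^sub>\<infinity>k. of_int \<bar>k\<bar> * d k)"
    using d d0 finF by (intro finite_sum_le_infsum) (auto simp: M_def)
  finally show ?thesis .
qed

lemma sum_Hankel_le':
  fixes d :: "int \<Rightarrow> real"
  assumes d0: "\<And>k. d k \<ge> 0" and d: "(\<lambda>k. of_int \<bar>k\<bar> * d k) summable_on UNIV" and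
      fin: "finite A" "finite B"
  shows "(\<Sum>j\<in>A. \<Sum>k\<in>B. of_bool (0 \<le> j \<and> k < 0) * d (j - k)) \<le>
      (\<Sum>\<^sub>\<infinity>k. of_int \<bar>k\<bar> * d k)"
proof -
  have bij: "bij (uminus :: int \<Rightarrow> int)" by (rule bij_uminus)
  have s: "(\<lambda>k. of_int \<bar>k\<bar> * d (- k)) summable_on UNIV"
    using summable_on_reindex_bij_betw[OF bij, of "\<lambda>k. of_int \<bar>k\<bar> * d k"] d by simp
  have i: "(\<Sum>\<^sub>\<infinity>k. of_int \<bar>k\<bar> * d (- k)) = (\<Sum>\<^sub>\<infinity>k. of_int
      \<bar>k\<bar> * d k)"
    using infsum_reindex_bij_betw[OF bij, of "\<lambda>k. of_int \<bar>k\<bar> * d k"] by simp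
  have "(\<Sum>k\<in>B. \<Sum>j\<in>A. of_bool (k < 0 \<and> 0 \<le> j) * d (- (k - j))) \<le>
      (\<Sum>\<^sub>\<infinity>k. of_int \<bar>k\<bar> * d (- k))"
    using d0 by (intro sum_Hankel_le s fin)
  then show ?thesis
    unfolding i by (subst sum.swap) (simp add: conj_commute)
qed

text \<open>Stated for the absolute values, since the matrix dominating all truncations is built
  from these.\<close>

lemma hs_le_laurent:
  fixes c :: "int \<Rightarrow> 'n::finite \<Rightarrow> 'n \<Rightarrow> complex"
  assumes "krein c"
  defines "X \<equiv> bmat_abs (laurent c)"
  shows "\<exists>e. hs_le (entry (proj (- pos) * X * proj pos)) e" "\<exists>e. hs_le (entry (proj pos * X *
      proj (- pos))) e"
proof -
  have c: "wiener c" and k: "(\<lambda>k. of_int \<bar>k\<bar> * (cmod (c k \<alpha> \<beta>))\<^sup>2)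
      summable_on UNIV" for \<alpha> \<beta>
    using assms(1) by (auto simp: krein_def)
  let ?s = "\<lambda>\<alpha> \<beta>. \<Sum>\<^sub>\<infinity>k. of_int \<bar>k\<bar> * (cmod (c k \<alpha>
      \<beta>))\<^sup>2"
  let ?e = "\<Sum>\<beta>\<in>UNIV. \<Sum>\<alpha>\<in>UNIV. ?s \<alpha> \<beta>"
  have e0: "?e \<ge> 0" by (intro sum_nonneg infsum_nonneg) auto
  have gen: "hs_le (entry (proj S * X * proj T)) (sqrt ?e)"
    if ST: "\<And>A B \<alpha> \<beta>. finite A \<Longrightarrow> finite B \<Longrightarrow>
      (\<Sum>j\<in>A. \<Sum>k\<in>B. of_bool ((j, \<alpha>) \<in> S \<and> (k, \<beta>) \<in> T) * (cmod (c (j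
          - k) \<alpha> \<beta>))\<^sup>2) \<le> ?s \<alpha> \<beta>" for S T
  proof (rule hs_leI_rectangle)
    fix A B :: "(int \<times> 'n) set" assume AB: "finite A" "finite B"
    let ?f = "\<lambda>p q. of_bool (p \<in> S \<and> q \<in> T) * (cmod (c (fst p - fst q) (snd p) (snd q)))\<^sup>2"
    have "(\<Sum>p\<in>A. \<Sum>q\<in>B. (cmod (entry (proj S * X * proj T) p q))\<^sup>2) = (\<Sum>p\<in>A.
        \<Sum>q\<in>B. ?f p q)"
      by (intro sum.cong refl)
        (auto simp: entry_mult_proj entry_proj_mult X_def entry_bmat_abs entry_laurent[OF c] of_bool_def)
    also have "\<dots> \<le> (\<Sum>p\<in>A. \<Sum>\<beta>\<in>UNIV. \<Sum>k\<in>fst ` B. ?f p (k, \<beta>))"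
      by (intro sum_mono sum_subset_times_UNIV_le AB) auto
    also have "\<dots> = (\<Sum>\<beta>\<in>UNIV. \<Sum>p\<in>A. \<Sum>k\<in>fst ` B. ?f p (k, \<beta>))"
      by (rule sum.swap)
    also have "\<dots> \<le> (\<Sum>\<beta>\<in>UNIV. \<Sum>\<alpha>\<in>UNIV. \<Sum>j\<in>fst ` A.
        \<Sum>k\<in>fst ` B. ?f (j, \<alpha>) (k, \<beta>))"
      by (intro sum_mono sum_subset_times_UNIV_le AB sum_nonneg) auto
    also have "\<dots> \<le> ?e"
    proof (intro sum_mono)
      fix \<alpha> \<beta>
      show "(\<Sum>j\<in>fst ` A. \<Sum>k\<in>fst ` B. ?f (j, \<alpha>) (k, \<beta>)) \<le> ?s \<alpha> \<beta>"
        using ST[of "fst ` A" "fst ` B" \<alpha> \<beta>] AB by simp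
    qed
    finally show "(\<Sum>p\<in>A. \<Sum>q\<in>B. (cmod (entry (proj S * X * proj T) p q))\<^sup>2) \<le> (sqrt
        ?e)\<^sup>2"
      using e0 by simp
  qed (use e0 in simp)
  show "\<exists>e. hs_le (entry (proj (- pos) * X * proj pos)) e"
    by (rule exI, rule gen) (use sum_Hankel_le[OF _ k] in \<open>auto simp: pos_def not_le\<close>)
  show "\<exists>e. hs_le (entry (proj pos * X * proj (- pos))) e"
    by (rule exI, rule gen) (use sum_Hankel_le'[OF _ k] in \<open>auto simp: pos_def not_le\<close>)
qed

lemma abs_sum_le_finite_support:
  assumes "finite S" "\<And>i j. (i, j) \<notin> S \<Longrightarrow> K i j = 0"
  shows "abs_sum_le K (\<Sum>(i,j)\<in>S. cmod (K i j))"
  unfolding abs_sum_le_def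
proof (intro allI impI)
  fix F :: "('a \<times> 'b) set" assume F: "finite F"
  have "(\<Sum>(i,j)\<in>F. cmod (K i j)) = (\<Sum>(i,j)\<in>F \<inter> S. cmod (K i j))"
  proof (rule sum.mono_neutral_right[OF F])
    show "\<forall>p\<in>F - F \<inter> S. (case p of (i, j) \<Rightarrow> cmod (K i j)) = 0"
    proof
      fix p assume "p \<in> F - F \<inter> S"
      then show "(case p of (i, j) \<Rightarrow> cmod (K i j)) = 0" using assms(2) by (cases p) auto
    qed
  qed simp
  also have "\<dots> \<le> (\<Sum>(i,j)\<in>S. cmod (K i j))"
    using assms(1) by (intro sum_mono2) auto
  finally show "(\<Sum>(i,j)\<in>F. cmod (K i j)) \<le> (\<Sum>(i,j)\<in>S. cmod (K i j))" .
qed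

text \<open>In a banded matrix only finitely many entries have a negative row index and a
  nonnegative column index.\<close>

lemma abs_sum_le_laurent_polynomial:
  fixes c :: "int \<Rightarrow> 'n::finite \<Rightarrow> 'n \<Rightarrow> complex"
  assumes "wiener c" and K: "K \<subseteq> {- int n..int n}"
  shows "\<exists>e. abs_sum_le (entry (proj (- pos) * laurent (restrict_symbol K c) * proj pos)) e"
proof (rule exI, rule abs_sum_le_finite_support)
  let ?S = "({- int n..int n} \<times> UNIV) \<times> ({- int n..int n} \<times> UNIV) :: ((int \<times> 'n)
      \<times> (int \<times> 'n)) set"
  show "finite ?S" by auto
  fix p q assume "(p, q) \<notin> ?S"
  then show "entry (proj (- pos) * laurent (restrict_symbol K c) * proj pos) p q = 0"
    using K unfolding entry_mult_proj entry_proj_mult entry_laurent[OF wiener_restrict_symbol[OF assms(1)]]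
    by (cases p; cases q) (auto simp: pos_def restrict_symbol_def subset_iff)
qed

section \<open>The determinant identity for Laurent matrices\<close>

text \<open>By \<open>compress_mult_inverse\<close> this is the determinant of
  \<open>compress (exp Z) * compress (exp (- Z))\<close>, the operator determinant \<open>E\<close>
  of the exponential.\<close>

definition widom_det :: "(int \<times> 'n::finite) bmat \<Rightarrow> complex" where
  "widom_det Z = fredholm_det (entry (- (proj pos * exp Z * proj (- pos) * exp (- Z) * proj pos)))"

lemma entries_dominated_proj: "entries_dominated (proj A) (proj A)"
  by (auto simp: entries_dominated_def entry_proj of_bool_def)

lemma entries_dominated_uminus: "entries_dominated X D \<Longrightarrow> entries_dominated (- X) D"
  by (simp add: entries_dominated_def)

text \<open>The kernel factors into two off-diagonal blocks, each dominated by the corresponding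
  block of \<open>exp D\<close>. These are Hilbert-Schmidt, so all minors have one common summable
  bound.\<close>

lemma tendsto_widom_det:
  fixes D :: "(int \<times> 'n::finite) bmat"
  assumes dom: "\<And>n. entries_dominated (U n) D"
    and lim: "\<And>p q. ((\<lambda>n. entry (U n) p q) \<longlongrightarrow> entry U' p q) G"
    and hs: "hs_le (entry (proj (- pos) * D * proj pos)) c" "hs_le (entry (proj pos * D * proj (- pos))) d"
  shows "((\<lambda>n. widom_det (U n)) \<longlongrightarrow> widom_det U') G"
proof -
  let ?P = "proj pos :: (int \<times> 'n) bmat" and ?W = "proj (- pos) :: (int \<times> 'n) bmat"
  interpret PW: complementary_projections ?P ?W by (rule complementary_projections_proj)
  \<comment> \<open>Exchanging the two projections yields the estimate for the other off-diagonal
    block of \<open>exp D\<close>.\<close>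
  interpret WP: complementary_projections ?W ?P
    using complementary_projections_proj[of "- pos"] by simp
  obtain c' where c': "hs_le (entry (?W * exp D * ?P)) c'"
    using PW.hs_le_exp_offdiagonal[OF hs(1) norm_proj] by blast
  obtain d' where d': "hs_le (entry (?P * exp D * ?W)) d'"
    using WP.hs_le_exp_offdiagonal[OF hs(2) norm_proj] by blast
  have split: "- (?P * exp Z * ?W * exp (- Z) * ?P) = - (?P * exp Z * ?W) * (?W * exp (- Z) * ?P)" for Z
    by (simp add: mult.assoc)
  have E: "entries_dominated (exp (U n)) (exp D)" "entries_dominated (exp (- U n)) (exp D)" for n
    by (intro entries_dominated_exp entries_dominated_uminus dom)+
  have E': "entries_dominated (?P * exp (U n) * ?W) (?P * exp D * ?W)"
    "entries_dominated (?W * exp (- U n) * ?P) (?W * exp D * ?P)" for n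
    by (intro entries_dominated_mult entries_dominated_proj E)+
  have lim': "((\<lambda>n. entry (exp (U n)) p q) \<longlongrightarrow> entry (exp U') p q) G"
    "((\<lambda>n. entry (exp (- U n)) p q) \<longlongrightarrow> entry (exp (- U')) p q) G" for p q
    by (rule tendsto_entry_exp_dominated[OF dom lim])
      (rule tendsto_entry_exp_dominated[OF entries_dominated_uminus[OF dom]], simp add: tendsto_minus lim)
  have lim'': "((\<lambda>n. entry (?P * exp (U n) * ?W) p q) \<longlongrightarrow> entry (?P * exp U' * ?W) p q) G"
    "((\<lambda>n. entry (?W * exp (- U n) * ?P) p q) \<longlongrightarrow> entry (?W * exp (- U') * ?P) p q)
        G" for p q
    unfolding entry_mult_proj entry_proj_mult by (intro tendsto_intros lim')+
  show ?thesis
    unfolding widom_det_def split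
  proof (rule tendsto_fredholm_det)
    show "0 \<le> hs_bound (entry (?P * exp D * ?W)) (entry (?W * exp D * ?P)) i" for i
      by (rule hs_bound_nonneg)
    show "hs_bound (entry (?P * exp D * ?W)) (entry (?W * exp D * ?P)) summable_on UNIV"
      by (rule hs_bound_summable[OF d' c'])
    show "cmod (det_on (entry (- (?P * exp (U n) * ?W) * (?W * exp (- U n) * ?P))) S) \<le>
        (\<Prod>i\<in>S. hs_bound (entry (?P * exp D * ?W)) (entry (?W * exp D * ?P)) i)" if "finite S" for n S
      by (rule cmod_det_on_mult_le[OF d' _ c' _ that])
        (use entries_dominated_cmod[OF E'(1)] entries_dominated_cmod[OF E'(2)] in auto)
    show "((\<lambda>n. entry (- (?P * exp (U n) * ?W) * (?W * exp (- U n) * ?P)) p q) \<longlongrightarrow>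
        entry (- (?P * exp U' * ?W) * (?W * exp (- U') * ?P)) p q) G" for p q
      by (rule tendsto_entry_mult_dominated[OF entries_dominated_uminus[OF E'(1)] _ E'(2) lim''(2)])
        (simp add: tendsto_minus lim''(1))
  qed
qed

lemma tendsto_offdiagonal_trace:
  fixes D :: "(int \<times> 'n::finite) bmat"
  assumes dom: "\<And>n. entries_dominated (Y n) D" "\<And>n. entries_dominated (X n) D"
    and lim: "\<And>p q. ((\<lambda>n. entry (Y n) p q) \<longlongrightarrow> entry Y' p q) G"
      "\<And>p q. ((\<lambda>n. entry (X n) p q) \<longlongrightarrow> entry X' p q) G"
    and hs: "hs_le (entry (proj (- pos) * D * proj pos)) c" "hs_le (entry (proj pos * D * proj (- pos))) d"
  shows "((\<lambda>n. fredholm_trace (entry (proj pos * Y n * proj (- pos) * X n * proj pos))) \<longlongrightarrow>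
    fredholm_trace (entry (proj pos * Y' * proj (- pos) * X' * proj pos))) G"
proof -
  let ?P = "proj pos :: (int \<times> 'n) bmat" and ?W = "proj (- pos) :: (int \<times> 'n) bmat"
  interpret PW: complementary_projections ?P ?W by (rule complementary_projections_proj)
  have split: "?P * Y * ?W * X * ?P = (?P * Y * ?W) * (?W * X * ?P)" for X Y
    by (simp add: mult.assoc)
  have E: "entries_dominated (?P * Y n * ?W) (?P * D * ?W)" "entries_dominated (?W * X n * ?P) (?W * D * ?P)" for n
    by (intro entries_dominated_mult entries_dominated_proj dom)+
  have lim': "((\<lambda>n. entry (?P * Y n * ?W) p q) \<longlongrightarrow> entry (?P * Y' * ?W) p q) G"
    "((\<lambda>n. entry (?W * X n * ?P) p q) \<longlongrightarrow> entry (?W * X' * ?P) p q) G" for p q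
    unfolding entry_mult_proj entry_proj_mult by (intro tendsto_intros lim)+
  show ?thesis
    unfolding fredholm_trace_def split
  proof (rule tendsto_infsum_dominated[OF _ hs_bound_summable[OF hs(2,1)]])
    \<comment> \<open>A diagonal entry is a minor of order one, so the bound for minors serves here
      too.\<close>
    show "cmod (entry ((?P * Y n * ?W) * (?W * X n * ?P)) i i) \<le>
        hs_bound (entry (?P * D * ?W)) (entry (?W * D * ?P)) i" for n i
      using cmod_det_on_mult_le[OF hs(2) _ hs(1), of "?P * Y n * ?W" "?W * X n * ?P" "{i}"]
        entries_dominated_cmod[OF E(1)] entries_dominated_cmod[OF E(2)] by auto
    show "((\<lambda>n. entry ((?P * Y n * ?W) * (?W * X n * ?P)) i i) \<longlongrightarrow>
        entry ((?P * Y' * ?W) * (?W * X' * ?P)) i i) G" for i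
      by (rule tendsto_entry_mult_dominated[OF E(1) lim'(1) E(2) lim'(2)])
  qed
qed

lemma fredholm_trace_block_zero:
  fixes K :: "(int \<times> 'n::finite) bmat"
  assumes "abs_sum_le (entry K) c" "\<And>j. (\<Sum>\<alpha>\<in>UNIV. entry K (j, \<alpha>) (j, \<alpha>)) = 0"
  shows "fredholm_trace (entry K) = 0"
  unfolding fredholm_trace_def
  by (subst infsum_int_times_finite)
    (use assms(2) in simp_all, rule abs_summable_summable, rule abs_sum_le_diagonal_summable(1)[OF assms(1)])

lemma entry_offdiagonal_block:
  fixes c d :: "int \<Rightarrow> 'n::finite \<Rightarrow> 'n \<Rightarrow> complex"
  assumes "wiener c" "wiener d"
  shows "entry (proj pos * laurent c * proj (- pos) * laurent d * proj pos) (j, \<alpha>) (j, \<alpha>) =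
    of_bool (0 \<le> j) * (\<Sum>\<^sub>\<infinity>k\<in>{..<0}. \<Sum>\<gamma>\<in>UNIV. c (j - k) \<alpha>
        \<gamma> * d (k - j) \<gamma> \<alpha>)"
proof -
  have "entry (laurent c * (proj (- pos) * laurent d)) (j, \<alpha>) (j, \<alpha>) =
      (\<Sum>\<^sub>\<infinity>k. \<Sum>\<gamma>\<in>UNIV. of_bool (k < 0) * (c (j - k) \<alpha> \<gamma> * d
          (k - j) \<gamma> \<alpha>))"
    unfolding entry_mult_int_times_finite[of "laurent c"] entry_proj_mult
    by (simp add: entry_laurent assms pos_def not_le mult_ac)
  also have "\<dots> = (\<Sum>\<^sub>\<infinity>k\<in>{..<0}. \<Sum>\<gamma>\<in>UNIV. c (j - k) \<alpha>
      \<gamma> * d (k - j) \<gamma> \<alpha>)"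
    by (rule infsum_cong_neutral) auto
  finally show ?thesis
    by (simp add: mult.assoc) (simp add: mult.assoc[symmetric] entry_mult_proj entry_proj_mult pos_def, simp
        add: mult.assoc entry_proj_mult)
qed

lemma trace_scalar_product_zero:
  fixes q :: "int \<Rightarrow> 'n::finite \<Rightarrow> 'n \<Rightarrow> complex"
  assumes "\<And>k. (\<Sum>\<alpha>\<in>UNIV. q k \<alpha> \<alpha>) = 0"
  shows "(\<Sum>\<alpha>\<in>UNIV. \<Sum>\<gamma>\<in>UNIV. q k \<alpha> \<gamma> * scalar_symbol d m \<gamma>
      \<alpha>) = 0"
    and "(\<Sum>\<alpha>\<in>UNIV. \<Sum>\<gamma>\<in>UNIV. scalar_symbol d m \<alpha> \<gamma> * q k \<gamma>
        \<alpha>) = 0"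
  using assms
  by (simp_all add: scalar_symbol_def of_bool_def if_distrib if_distribR sum_distrib_right[symmetric]
      sum_distrib_left[symmetric] cong: if_cong)

text \<open>The diagonal is summed block by block. The trace of each block is an infinite sum of
  traces of coefficient products, every one of which vanishes.\<close>

lemma fredholm_trace_offdiagonal_zero:
  fixes c d :: "int \<Rightarrow> 'n::finite \<Rightarrow> 'n \<Rightarrow> complex"
  assumes cd: "wiener c" "wiener d"
    and n: "abs_sum_le (entry (proj (- pos) * laurent d * proj pos)) e"
    and z: "\<And>k m. (\<Sum>\<alpha>\<in>UNIV. \<Sum>\<gamma>\<in>UNIV. c k \<alpha> \<gamma> * d m \<gamma>
        \<alpha>) = 0"
  shows "fredholm_trace (entry (proj pos * laurent c * proj (- pos) * laurent d * proj pos)) = 0"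
proof (rule fredholm_trace_block_zero)
  have "abs_sum_le (entry ((proj pos * laurent c) * (proj (- pos) * laurent d * proj pos)))
      (norm (proj pos * laurent c) * e)"
    by (rule abs_sum_le_mult_bmat_left[OF n])
  then show "abs_sum_le (entry (proj pos * laurent c * proj (- pos) * laurent d * proj pos))
      (norm (proj pos * laurent c) * e)"
    by (simp add: mult.assoc)
  fix j
  have s: "(\<lambda>k. \<Sum>\<gamma>\<in>UNIV. c (j - k) \<alpha> \<gamma> * d (k - j) \<gamma> \<alpha>)
      summable_on {..<0}" for \<alpha>
  proof (rule summable_on_finite_sum)
    fix \<gamma>
    have "bij (\<lambda>k. j - k)" by (rule bij_betw_byWitness[where f' = "\<lambda>k. j - k"]) auto
    then have "(\<lambda>k. cmod (c (j - k) \<alpha> \<gamma>)) summable_on UNIV"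
      using summable_on_reindex_bij_betw[of "\<lambda>k. j - k" UNIV UNIV "\<lambda>k. cmod (c k \<alpha>
          \<gamma>)"] cd(1)
      by (simp add: wiener_def)
    then have "(\<lambda>k. c (j - k) \<alpha> \<gamma> * d (k - j) \<gamma> \<alpha>) summable_on UNIV"
    proof (rule summable_mult_bounded(3))
      show "cmod (d (k - j) \<gamma> \<alpha>) \<le> norm (laurent d)" for k
        using cmod_entry_le[of "laurent d" "(k, \<gamma>)" "(j, \<alpha>)"] by (simp add: entry_laurent[OF cd(2)])
    qed
    then show "(\<lambda>k. c (j - k) \<alpha> \<gamma> * d (k - j) \<gamma> \<alpha>) summable_on {..<0}"
      by (rule summable_on_subset_banach) simp
  qed simp
  have "(\<Sum>\<alpha>\<in>UNIV. \<Sum>\<^sub>\<infinity>k\<in>{..<0}. \<Sum>\<gamma>\<in>UNIV. c (j - k)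
      \<alpha> \<gamma> * d (k - j) \<gamma> \<alpha>) = 0"
    by (subst infsum_finite_sum[symmetric]) (simp_all add: s z)
  then show "(\<Sum>\<alpha>\<in>UNIV. entry (proj pos * laurent c * proj (- pos) * laurent d * proj pos) (j,
      \<alpha>) (j, \<alpha>)) = 0"
    by (simp add: entry_offdiagonal_block[OF cd] sum_distrib_left[symmetric])
qed

lemma entries_dominated_bmat_abs: "entries_dominated X (bmat_abs X)"
  by (simp add: entries_dominated_def entry_bmat_abs)

lemma entries_dominated_add:
  "entries_dominated X D \<Longrightarrow> entries_dominated Y E \<Longrightarrow> entries_dominated (X + Y) (D + E)"
  unfolding entries_dominated_def by (auto intro!: order_trans[OF norm_triangle_ineq] add_mono)

lemma entries_dominated_add_left:
  assumes "entries_dominated X D" "entries_dominated Z E" shows "entries_dominated X (D + E)"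
  unfolding entries_dominated_def
proof (intro allI conjI)
  fix i j
  have "0 \<le> Re (entry E i j)" "Im (entry E i j) = 0"
    using assms(2) unfolding entries_dominated_def by (auto intro: order_trans[OF norm_ge_zero])
  moreover have "cmod (entry X i j) \<le> Re (entry D i j)" "Im (entry D i j) = 0"
    using assms(1) by (auto simp: entries_dominated_def)
  ultimately show "Im (entry (D + E) i j) = 0" "cmod (entry X i j) \<le> Re (entry (D + E) i j)" by auto
qed

lemma entries_dominated_add_right:
  assumes "entries_dominated X D" "entries_dominated Z E" shows "entries_dominated X (E + D)"
  using entries_dominated_add_left[OF assms] by (simp add: add.commute)

lemma entries_dominated_restrict_symbol:
  fixes c :: "int \<Rightarrow> 'n::finite \<Rightarrow> 'n \<Rightarrow> complex"
  assumes "wiener c"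
  shows "entries_dominated (laurent (restrict_symbol K c)) (bmat_abs (laurent c))"
  by (auto simp: entries_dominated_def entry_bmat_abs entry_laurent assms wiener_restrict_symbol restrict_symbol_def)

lemma tendsto_restrict_symbol:
  fixes c :: "int \<Rightarrow> 'n::finite \<Rightarrow> 'n \<Rightarrow> complex"
  assumes c: "wiener c"
  shows "(\<lambda>n. entry (laurent (restrict_symbol (K \<inter> {- int n..int n}) c)) p q)
      \<longlonglongrightarrow> entry (laurent (restrict_symbol K c)) p q"
proof (rule tendsto_eventually, rule eventually_sequentiallyI)
  fix n assume "nat \<bar>fst p - fst q\<bar> \<le> n"
  then show "entry (laurent (restrict_symbol (K \<inter> {- int n..int n}) c)) p q = entry (laurent
      (restrict_symbol K c)) p q"
    by (auto simp: entry_laurent c wiener_restrict_symbol restrict_symbol_def)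
qed

lemma restrict_symbol_UNIV [simp]: "restrict_symbol UNIV c = c"
  by (simp add: restrict_symbol_def fun_eq_iff)

theorem widom_det_scalar_plus:
  fixes q :: "int \<Rightarrow> 'n::finite \<Rightarrow> 'n \<Rightarrow> complex"
  assumes a: "(\<lambda>k. cmod (a k)) summable_on UNIV" "(\<lambda>k. of_int \<bar>k\<bar> * (cmod (a
      k))\<^sup>2) summable_on UNIV"
    and q: "krein q" and trace: "\<And>k. (\<Sum>\<alpha>\<in>UNIV. q k \<alpha> \<alpha>) = 0"
  defines "s \<equiv> scalar_symbol a"
  shows "widom_det (laurent s + laurent q) =
    exp (fredholm_trace (entry (proj pos * laurent (restrict_symbol {0..} s) * proj (- pos) *
      laurent (restrict_symbol {..<0} s) * proj pos))) * widom_det (laurent q)"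
proof -
  let ?P = "proj pos :: (int \<times> 'n) bmat" and ?W = "proj (- pos) :: (int \<times> 'n) bmat"
  interpret PW: complementary_projections ?P ?W by (rule complementary_projections_proj)
  have ks: "krein s" unfolding s_def by (rule krein_scalar_symbol[OF a])
  have ws: "wiener s" and wq: "wiener q" using ks q by (auto simp: krein_def)
  \<comment> \<open>A single matrix with Hilbert-Schmidt off-diagonal blocks that dominates all
    truncated parts and their sum.\<close>
  define D where "D = bmat_abs (laurent s) + bmat_abs (laurent q)"
  obtain c c' d d' where "hs_le (entry (?W * bmat_abs (laurent s) * ?P)) c" "hs_le (entry (?P * bmat_abs
      (laurent s) * ?W)) d"
    "hs_le (entry (?W * bmat_abs (laurent q) * ?P)) c'" "hs_le (entry (?P * bmat_abs (laurent q) * ?W)) d'"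
    using hs_le_laurent[OF ks] hs_le_laurent[OF q] by metis
  then have hs: "hs_le (entry (?W * D * ?P)) (c + c')" "hs_le (entry (?P * D * ?W)) (d + d')"
    unfolding D_def distrib_left distrib_right by (blast intro: hs_le_plus)+
  let ?I = "\<lambda>n. {- int n..int n}"
  \<comment> \<open>Truncation to frequencies of modulus at most \<open>n\<close>. The constant
    coefficient of the scalar symbol is counted with \<open>Y\<close>.\<close>
  define X where "X = (\<lambda>n. laurent (restrict_symbol ({..<0} \<inter> ?I n) s))"
  define Y where "Y = (\<lambda>n. laurent (restrict_symbol ({0..} \<inter> ?I n) s))"
  define Z where "Z = (\<lambda>n. laurent (restrict_symbol (UNIV \<inter> ?I n) q))"
  \<comment> \<open>The two parts add up to one truncation of \<open>s\<close>, so one copy of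
    \<open>bmat_abs (laurent s)\<close> in \<open>D\<close> dominates their sum.\<close>
  have XY: "X n + Y n = laurent (restrict_symbol (UNIV \<inter> ?I n) s)" for n
    by (rule bmat_eqI) (auto simp: X_def Y_def entry_laurent ws wiener_restrict_symbol restrict_symbol_def)
  have domX: "entries_dominated (X n) D" and domY: "entries_dominated (Y n) D"
    and domXY: "entries_dominated (X n + Y n + Z n) D" and domZ: "entries_dominated (Z n) D" for n
    unfolding D_def XY
    by (unfold X_def Y_def Z_def,
        (intro entries_dominated_add entries_dominated_add_left[OF _ entries_dominated_bmat_abs]
          entries_dominated_add_right[OF _ entries_dominated_bmat_abs] entries_dominated_restrict_symbol ws wq;
              fail)+)
  have lim: "(\<lambda>n. entry (Z n) p r) \<longlonglongrightarrow> entry (laurent q) p r"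
    "(\<lambda>n. entry (X n + Y n + Z n) p r) \<longlonglongrightarrow> entry (laurent s + laurent q) p r" for p r
    using tendsto_restrict_symbol[OF wq, of UNIV p r] tendsto_restrict_symbol[OF ws, of UNIV p r]
    unfolding XY by (auto simp: Z_def intro: tendsto_add)
  have commute: "X n * Y n = Y n * X n" "X n * Z n = Z n * X n" "Y n * Z n = Z n * Y n" for n
  proof -
    have fin: "(\<lambda>k. cmod (of_bool (k \<in> K \<inter> ?I n) * a k)) summable_on UNIV" for K
      by (rule Infinite_Sum.abs_summable_on_comparison_test'[OF a(1)]) auto
    show "X n * Y n = Y n * X n" "X n * Z n = Z n * X n" "Y n * Z n = Z n * Y n"
      unfolding X_def Y_def Z_def s_def restrict_scalar_symbol
      by (intro laurent_scalar_commute fin wiener_scalar_symbol wiener_restrict_symbol wq)+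
  qed
  have tri: "?P * X n * ?W = 0" "?W * Y n * ?P = 0" for n
    by (rule bmat_eqI, auto simp: entry_mult_proj entry_proj_mult X_def Y_def entry_laurent ws wiener_restrict_symbol
        restrict_symbol_def pos_def)+
  have det: "bmat_det (PW.compress (exp U) * PW.compress (exp (- U))) = widom_det U" for U
    by (simp add: PW.compress_mult_inverse[OF exp_cancel(1)] bmat_det_def widom_det_def)
  have eq: "widom_det (X n + Y n + Z n) =
      exp (fredholm_trace (entry (?P * Y n * ?W * X n * ?P))) * widom_det (Z n)" for n
  proof -
    obtain e1 where e1: "abs_sum_le (entry (?W * X n * ?P)) e1"
      unfolding X_def using abs_sum_le_laurent_polynomial[OF ws, of _ n] by blast
    obtain e2 where e2: "abs_sum_le (entry (?W * Z n * ?P)) e2"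
      unfolding Z_def using abs_sum_le_laurent_polynomial[OF wq, of _ n] by blast
    have trq: "(\<Sum>\<alpha>\<in>UNIV. restrict_symbol K q k \<alpha> \<alpha>) = 0" for K k
      by (simp add: restrict_symbol_def trace sum_distrib_left[symmetric])
    \<comment> \<open>The commutators with the matrix part have trace zero, because a scalar times a
      trace free coefficient is trace free.\<close>
    have "fredholm_trace (entry (?P * Z n * ?W * X n * ?P)) = 0"
      unfolding X_def Z_def
    proof (rule fredholm_trace_offdiagonal_zero[OF _ _ e1[unfolded X_def]])
      show "(\<Sum>\<alpha>\<in>UNIV. \<Sum>\<gamma>\<in>UNIV. restrict_symbol (UNIV \<inter> ?I n) q k
          \<alpha> \<gamma> *
          restrict_symbol ({..<0} \<inter> ?I n) s m \<gamma> \<alpha>) = 0" for k m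
        unfolding s_def restrict_scalar_symbol by (intro trace_scalar_product_zero(1)) (rule trq)
    qed (intro wiener_restrict_symbol ws wq)+
    moreover have "fredholm_trace (entry (?P * Y n * ?W * Z n * ?P)) = 0"
      unfolding Y_def Z_def
    proof (rule fredholm_trace_offdiagonal_zero[OF _ _ e2[unfolded Z_def]])
      show "(\<Sum>\<alpha>\<in>UNIV. \<Sum>\<gamma>\<in>UNIV. restrict_symbol ({0..} \<inter> ?I n) s k
          \<alpha> \<gamma> *
          restrict_symbol (UNIV \<inter> ?I n) q m \<gamma> \<alpha>) = 0" for k m
        unfolding s_def restrict_scalar_symbol by (intro trace_scalar_product_zero(2)) (rule trq)
    qed (intro wiener_restrict_symbol ws wq)+
    ultimately show ?thesis
      using PW.bmat_det_compress_exp[OF commute[of n] tri[of n] e1 e2] unfolding det by simp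
  qed
  have "(\<lambda>n. widom_det (X n + Y n + Z n)) \<longlonglongrightarrow> widom_det (laurent s + laurent q)"
    by (rule tendsto_widom_det[OF domXY lim(2) hs])
  moreover have "(\<lambda>n. exp (fredholm_trace (entry (?P * Y n * ?W * X n * ?P))) * widom_det (Z n))
      \<longlonglongrightarrow>
      exp (fredholm_trace (entry (?P * laurent (restrict_symbol {0..} s) * ?W * laurent (restrict_symbol {..<0}
          s) * ?P)))
        * widom_det (laurent q)"
    by (intro tendsto_mult tendsto_exp tendsto_widom_det[OF domZ lim(1) hs]
        tendsto_offdiagonal_trace[OF domY domX _ _ hs])
      (unfold X_def Y_def, (rule tendsto_restrict_symbol[OF ws])+)
  ultimately show ?thesis unfolding eq by (rule LIMSEQ_unique)
qed

section \<open>Fourier series\<close>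

lemma circle_cis:
  assumes "z \<in> sphere (0::complex) 1"
  obtains x where "x \<in> {0..2 * pi}" "z = cis x"
proof -
  have "z = cis (Arg2pi z)"
    using Arg2pi_eq[of z] assms by (simp add: cis_conv_exp)
  then show ?thesis
    using Arg2pi_ge_0[of z] Arg2pi_lt_2pi[of z] by (intro that[of "Arg2pi z"]) auto
qed

lemma continuous_on_circle_cis:
  "continuous_on (sphere (0::complex) 1) f \<Longrightarrow> continuous_on A (\<lambda>x. f (cis x))"
  by (rule continuous_on_compose2[where f = cis and s = A]) (auto intro!: continuous_intros)

lemma fourier_integrable:
  assumes "continuous_on (sphere 0 1) \<phi>"
  shows "(\<lambda>x. \<phi> (cis x) * cis (- (of_int k * x))) integrable_on {0..2 * pi}"
  by (intro integrable_continuous_interval continuous_intros continuous_on_circle_cis assms)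

lemma fourier_cong:
  assumes "\<And>z. z \<in> sphere 0 1 \<Longrightarrow> \<phi> z = \<psi> z"
  shows "fourier \<phi> k = fourier \<psi> k"
  by (simp add: fourier_def assms)

lemma fourier_add:
  assumes "continuous_on (sphere 0 1) \<phi>" "continuous_on (sphere 0 1) \<psi>"
  shows "fourier (\<lambda>z. \<phi> z + \<psi> z) k = fourier \<phi> k + fourier \<psi> k"
  using Henstock_Kurzweil_Integration.integral_add[OF fourier_integrable[OF assms(1)] fourier_integrable[OF
      assms(2)], of k k]
  by (simp add: fourier_def distrib_right add_divide_distrib)

lemma fourier_mult_left: "fourier (\<lambda>z. c * \<phi> z) k = c * fourier \<phi> k"
  by (simp add: fourier_def mult.assoc)

lemma fourier_mult_z: "fourier (\<lambda>z. \<phi> z * z) k = fourier \<phi> (k - 1)"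
proof -
  have "cis x * cis (- (of_int k * x)) = cis (- (of_int (k - 1) * x))" for x
    unfolding cis_mult by (rule arg_cong[where f = cis]) (simp add: algebra_simps)
  then show ?thesis by (simp add: fourier_def mult.assoc)
qed

lemma fourier_mult_cnj: "fourier (\<lambda>z. \<phi> z * cnj z) k = fourier \<phi> (k + 1)"
proof -
  have "cnj (cis x) * cis (- (of_int k * x)) = cis (- (of_int (k + 1) * x))" for x
    unfolding cis_cnj cis_mult by (rule arg_cong[where f = cis]) (simp add: algebra_simps)
  then show ?thesis by (simp add: fourier_def mult.assoc)
qed

text \<open>A real linear function of \<open>z\<close> is a combination of \<open>z\<close> and
  \<open>cnj z\<close>, and multiplication by these shifts the Fourier coefficients. With
  \<open>g\<close> arbitrary in the induction, a product of polynomials is handled one factor at a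
  time.\<close>

lemma fourier_zero_mult_polynomial:
  assumes "real_polynomial_function p"
    and "continuous_on (sphere 0 1) g" "\<And>k. fourier g k = 0"
  shows "fourier (\<lambda>z. g z * of_real (p z)) k = 0"
  using assms
proof (induction arbitrary: g k rule: real_polynomial_function.induct)
  case (linear f)
  then interpret bounded_linear f by simp
  \<comment> \<open>The Wirtinger coefficients of the linear function \<open>f\<close>.\<close>
  define \<alpha> \<beta> where "\<alpha> = (of_real (f 1) - \<i> * of_real (f \<i>)) / 2" and "\<beta> =
      (of_real (f 1) + \<i> * of_real (f \<i>)) / 2"
  have f: "of_real (f z) = \<alpha> * z + \<beta> * cnj z" for z
  proof -
    have "f z = f (Re z *\<^sub>R 1 + Im z *\<^sub>R \<i>)"
      by (rule arg_cong[where f = f]) (simp add: complex_eq_iff)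
    also have "\<dots> = Re z * f 1 + Im z * f \<i>" by (simp add: add scaleR)
    finally show ?thesis by (simp add: \<alpha>_def \<beta>_def complex_eq_iff field_simps)
  qed
  have "(\<lambda>z. g z * of_real (f z)) = (\<lambda>z. \<alpha> * (g z * z) + \<beta> * (g z * cnj z))"
    by (simp add: f algebra_simps)
  then have "fourier (\<lambda>z. g z * of_real (f z)) k =
      fourier (\<lambda>z. \<alpha> * (g z * z)) k + fourier (\<lambda>z. \<beta> * (g z * cnj z)) k"
    using linear.prems by (simp add: fourier_add continuous_intros)
  then show ?case by (simp only: fourier_mult_left fourier_mult_z fourier_mult_cnj linear.prems) simp
next
  case (const c)
  then show ?case using fourier_mult_left[of "of_real c" g k] by (simp add: mult.commute)
next
  case (add p q)
  have "continuous_on (sphere 0 1) p" "continuous_on (sphere 0 1) q"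
    using add.hyps by (simp_all add: continuous_on_polymonial_function real_polynomial_function_eq)
  then show ?case
    using add.IH[OF add.prems] add.prems by (simp add: distrib_left fourier_add continuous_intros)
next
  case (mult p q)
  have "continuous_on (sphere 0 1) p"
    using mult.hyps by (simp add: continuous_on_polymonial_function real_polynomial_function_eq)
  then have "fourier (\<lambda>z. (g z * of_real (p z)) * of_real (q z)) k = 0"
    using mult.IH(1)[OF mult.prems] mult.prems by (intro mult.IH(2)) (auto intro!: continuous_intros)
  then show ?case by (simp add: mult.assoc)
qed

text \<open>The function \<open>g\<close> is orthogonal to all real polynomials, and so is its real
  part. Approximating \<open>Re g\<close> uniformly by such a polynomial \<open>p\<close>, the
  integral of its square equals that of \<open>Re g * (Re g - p)\<close>, which is arbitrarily
  small.\<close>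

lemma fourier_zero_imp_Re_zero:
  assumes g: "continuous_on (sphere 0 1) g" "\<And>k. fourier g k = 0" and z: "z \<in> sphere 0 1"
  shows "Re (g z) = 0"
proof -
  let ?I = "{0..2 * pi}"
  let ?r = "\<lambda>x. Re (g (cis x))"
  have cr: "continuous_on (sphere 0 1) (\<lambda>z. Re (g z))" by (intro continuous_intros g)
  have cr': "continuous_on ?I ?r" by (rule continuous_on_circle_cis[OF cr])
  define M where "M = integral ?I (\<lambda>x. \<bar>?r x\<bar>)"
  have M0: "M \<ge> 0" unfolding M_def by (intro Henstock_Kurzweil_Integration.integral_nonneg
      integrable_continuous_interval continuous_intros cr') auto
  have le: "integral ?I (\<lambda>x. (?r x)\<^sup>2) \<le> e * M" if e: "e > 0" for e
  proof -
    obtain p where p: "real_polynomial_function p" "\<And>z. z \<in> sphere 0 1 \<Longrightarrow> \<bar>Re (g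
        z) - p z\<bar> < e"
      using Stone_Weierstrass_real_polynomial_function[OF compact_sphere cr e] by blast
    have cp: "continuous_on (sphere 0 1) p"
      using p(1) by (simp add: continuous_on_polymonial_function real_polynomial_function_eq)
    have cp': "continuous_on ?I (\<lambda>x. p (cis x))" by (rule continuous_on_circle_cis[OF cp])
    have cg': "continuous_on ?I (\<lambda>x. g (cis x))" by (rule continuous_on_circle_cis[OF g(1)])
    have int: "(\<lambda>x. g (cis x) * of_real (p (cis x))) integrable_on ?I"
      by (intro integrable_continuous_interval continuous_intros cg' cp')
    have "integral ?I (\<lambda>x. g (cis x) * of_real (p (cis x))) = 0"
      using fourier_zero_mult_polynomial[OF p(1) g, of 0] by (simp add: fourier_def)
    then have "((\<lambda>x. g (cis x) * of_real (p (cis x))) has_integral 0) ?I"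
      using int by (metis has_integral_integral)
    from has_integral_linear[OF this bounded_linear_Re]
    have zero: "integral ?I (\<lambda>x. ?r x * p (cis x)) = 0"
      by (simp add: o_def integral_unique)
    have "integral ?I (\<lambda>x. (?r x)\<^sup>2) = integral ?I (\<lambda>x. (?r x)\<^sup>2 - ?r x * p (cis x))"
      by (subst Henstock_Kurzweil_Integration.integral_diff)
        (auto simp: zero intro!: integrable_continuous_interval continuous_intros cr' cp')
    also have "\<dots> \<le> integral ?I (\<lambda>x. e * \<bar>?r x\<bar>)"
    proof (rule integral_le)
      fix x
      have "(?r x)\<^sup>2 - ?r x * p (cis x) = ?r x * (?r x - p (cis x))"
        by (simp add: algebra_simps power2_eq_square)
      also have "\<dots> \<le> \<bar>?r x\<bar> * \<bar>?r x - p (cis x)\<bar>" by (metis abs_ge_self abs_mult)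
      also have "\<dots> \<le> \<bar>?r x\<bar> * e" using p(2)[of "cis x"] by (intro mult_left_mono) auto
      finally show "(?r x)\<^sup>2 - ?r x * p (cis x) \<le> e * \<bar>?r x\<bar>" by (simp add: mult.commute)
    qed (intro integrable_continuous_interval continuous_intros cr' cp')+
    also have "\<dots> = e * M" by (simp add: M_def)
    finally show ?thesis .
  qed
  have "integral ?I (\<lambda>x. (?r x)\<^sup>2) \<le> 0"
  proof (rule field_le_epsilon)
    fix \<epsilon> :: real assume "\<epsilon> > 0"
    \<comment> \<open>Division by \<open>M + 1\<close> is safe even when
      \<open>M = 0\<close>.\<close>
    then have "integral ?I (\<lambda>x. (?r x)\<^sup>2) \<le> (\<epsilon> / (M + 1)) * M" using M0 by (intro le) simp
    also have "\<dots> \<le> \<epsilon>" using M0 \<open>\<epsilon> > 0\<close> by (simp add: field_simps)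
    finally show "integral ?I (\<lambda>x. (?r x)\<^sup>2) \<le> 0 + \<epsilon>" by simp
  qed
  moreover have "integral ?I (\<lambda>x. (?r x)\<^sup>2) \<ge> 0"
    by (intro Henstock_Kurzweil_Integration.integral_nonneg integrable_continuous_interval continuous_intros cr') auto
  ultimately have "integral ?I (\<lambda>x. (?r x)\<^sup>2) = 0" by simp
  then have "\<forall>x\<in>?I. (?r x)\<^sup>2 = 0"
    by (subst (asm) integral_eq_0_iff) (auto intro!: continuous_intros cr')
  then show ?thesis using z by (metis circle_cis power_eq_0_iff)
qed

lemma fourier_zero_imp_zero:
  assumes g: "continuous_on (sphere 0 1) g" "\<And>k. fourier g k = 0" and z: "z \<in> sphere 0 1"
  shows "g z = 0"
proof -
  have "Re (- \<i> * g z) = 0"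
    by (rule fourier_zero_imp_Re_zero[OF _ _ z]) (auto intro!: continuous_intros g simp: fourier_mult_left[of
        "- \<i>", simplified] g)
  then show ?thesis using fourier_zero_imp_Re_zero[OF g z] by (simp add: complex_eq_iff)
qed

section \<open>Absolutely convergent Fourier series\<close>

definition fourier_series :: "(int \<Rightarrow> complex) \<Rightarrow> complex \<Rightarrow> complex" where
  "fourier_series c z = (\<Sum>\<^sub>\<infinity>k. c k * z powi k)"

lemma fourier_series_uniform_limit:
  assumes "(\<lambda>k. cmod (c k)) summable_on UNIV"
  shows "uniform_limit (sphere 0 1) (\<lambda>X z. \<Sum>k\<in>X. c k * z powi k) (fourier_series c)
      (finite_subsets_at_top UNIV)"
  unfolding fourier_series_def[abs_def]
  by (rule Weierstrass_m_test_general[OF _ assms]) (auto simp: norm_mult norm_power_int)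

lemma continuous_on_fourier_series:
  assumes "(\<lambda>k. cmod (c k)) summable_on UNIV"
  shows "continuous_on (sphere 0 1) (fourier_series c)"
  by (rule uniform_limit_theorem[OF _ fourier_series_uniform_limit[OF assms]])
    (auto intro!: always_eventually continuous_intros)

lemma integral_cis_int:
  "integral {0..2 * pi} (\<lambda>x. cis (of_int n * x)) = (if n = 0 then of_real (2 * pi) else 0)"
proof (cases "n = 0")
  case False
  have "((\<lambda>x. cis (of_int n * x)) has_integral
      (cis (of_int n * (2 * pi)) / (\<i> * of_int n) - cis (of_int n * 0) / (\<i> * of_int n))) {0..2 * pi}"
  proof (rule fundamental_theorem_of_calculus)
    fix x
    have "((\<lambda>z. exp (\<i> * of_int n * z) / (\<i> * of_int n)) has_field_derivative exp (\<i> * of_int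
        n * of_real x)) (at (of_real x))"
      using False by (auto intro!: derivative_eq_intros)
    from has_vector_derivative_real_field[OF this]
    show "((\<lambda>x. cis (of_int n * x) / (\<i> * of_int n)) has_vector_derivative cis (of_int n * x)) (at x
        within {0..2 * pi})"
      by (simp add: cis_conv_exp mult.assoc)
  qed simp
  moreover have "cis (of_int n * (2 * pi)) = 1"
    using cis_multiple_2pi[of "of_int n"] by (simp add: mult.commute)
  ultimately show ?thesis using False by (simp add: integral_unique)
qed (simp add: scaleR_conv_of_real)

text \<open>Uniform convergence permits termwise integration, and the integral of a partial sum is
  constant as soon as the index set contains \<open>m\<close>.\<close>

lemma fourier_fourier_series:
  assumes c: "(\<lambda>k. cmod (c k)) summable_on UNIV"
  shows "fourier (fourier_series c) m = c m"
proof -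
  let ?I = "{0..2 * pi}"
  let ?f = "\<lambda>X x. \<Sum>k\<in>X. c k * cis (of_int (k - m) * x)"
  have e: "cis x powi k * cis (- (of_int m * x)) = cis (of_int (k - m) * x)" for x k
    unfolding cis_power_int cis_mult by (rule arg_cong[where f = cis]) (simp add: algebra_simps)
  have "uniform_limit ?I ?f (\<lambda>x. fourier_series c (cis x) * cis (- (of_int m * x)))
      (finite_subsets_at_top UNIV)"
  proof -
    have "uniform_limit ?I (\<lambda>X x. \<Sum>k\<in>X. c k * cis (of_int (k - m) * x))
        (\<lambda>x. \<Sum>\<^sub>\<infinity>k. c k * cis (of_int (k - m) * x)) (finite_subsets_at_top UNIV)"
      by (rule Weierstrass_m_test_general[OF _ c]) (auto simp: norm_mult)
    moreover have "(\<Sum>\<^sub>\<infinity>k. c k * cis (of_int (k - m) * x)) = fourier_series c (cis x) * cis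
        (- (of_int m * x))" for x
      unfolding fourier_series_def e[symmetric] mult.assoc[symmetric] by (rule infsum_cmult_left')
    ultimately show ?thesis by simp
  qed
  then obtain I J where IJ: "\<And>X. (?f X has_integral I X) ?I"
      "((\<lambda>x. fourier_series c (cis x) * cis (- (of_int m * x))) has_integral J) ?I" "(I
          \<longlongrightarrow> J) (finite_subsets_at_top UNIV)"
    by (rule uniform_limit_integral) (auto intro!: continuous_intros)
  have "I X = 2 * pi * c m" if X: "finite X" "m \<in> X" for X
  proof -
    have "I X = integral ?I (?f X)" using IJ(1)[of X] by (simp add: integral_unique)
    also have "\<dots> = (\<Sum>k\<in>X. integral ?I (\<lambda>x. c k * cis (of_int (k - m) * x)))"
      by (rule integral_sum[OF X(1)]) (auto intro!: integrable_continuous_interval continuous_intros)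
    also have "\<dots> = (\<Sum>k\<in>X. if k = m then 2 * pi * c m else 0)"
      by (intro sum.cong refl) (simp only: integral_mult_right integral_cis_int, simp)
    finally show ?thesis using X by simp
  qed
  then have "\<forall>\<^sub>F X in finite_subsets_at_top UNIV. I X = 2 * pi * c m"
    unfolding eventually_finite_subsets_at_top by (intro exI[of _ "{m}"]) auto
  then have "(I \<longlongrightarrow> 2 * pi * c m) (finite_subsets_at_top UNIV)" by (rule tendsto_eventually)
  then have "J = 2 * pi * c m" using IJ(3) tendsto_unique finite_subsets_at_top_neq_bot by blast
  then show ?thesis using IJ(2) by (simp add: fourier_def integral_unique)
qed

text \<open>The function and its series are continuous with the same coefficients, so their
  difference vanishes by uniqueness.\<close>

lemma fourier_series_fourier:
  assumes "continuous_on (sphere 0 1) \<phi>" "(\<lambda>k. cmod (fourier \<phi> k)) summable_on UNIV" "z \<in>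
      sphere 0 1"
  shows "fourier_series (fourier \<phi>) z = \<phi> z"
proof -
  let ?g = "\<lambda>z. \<phi> z + -1 * fourier_series (fourier \<phi>) z"
  have c: "continuous_on (sphere 0 1) (fourier_series (fourier \<phi>))"
    by (rule continuous_on_fourier_series[OF assms(2)])
  have "?g z = 0"
  proof (rule fourier_zero_imp_zero[OF _ _ assms(3)])
    show "continuous_on (sphere 0 1) ?g" by (intro continuous_intros assms c)
    show "fourier ?g k = 0" for k
      by (subst fourier_add) (auto intro!: continuous_intros assms c simp only: fourier_mult_left
          fourier_fourier_series[OF assms(2)], simp)
  qed
  then show ?thesis by simp
qed

text \<open>On the circle \<open>cnj z\<close> is \<open>inverse z\<close>, which reverses the
  exponents of the series. The coefficients are then read off without substitution in the
  integral.\<close>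

lemma fourier_reflect:
  assumes "continuous_on (sphere 0 1) \<phi>" "(\<lambda>k. cmod (fourier \<phi> k)) summable_on UNIV"
  shows "fourier (reflect \<phi>) k = fourier \<phi> (- k)"
proof -
  let ?c = "\<lambda>k. fourier \<phi> (- k)"
  have bij: "bij (uminus :: int \<Rightarrow> int)" by (rule bij_uminus)
  have c: "(\<lambda>k. cmod (?c k)) summable_on UNIV"
    using summable_on_reindex_bij_betw[OF bij, of "\<lambda>k. cmod (fourier \<phi> k)"] assms(2) by simp
  have "reflect \<phi> z = fourier_series ?c z" if z: "z \<in> sphere 0 1" for z
  proof -
    have "z * cnj z = 1" using complex_norm_square[of z] z by simp
    then have "cnj z = inverse z" by (metis inverse_unique)
    then have "cnj z powi k = z powi (- k)" for k
      by (simp only: power_int_inverse power_int_minus)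
    then have "fourier_series (fourier \<phi>) (cnj z) = (\<Sum>\<^sub>\<infinity>k. fourier \<phi> k * z powi (- k))"
      by (simp add: fourier_series_def)
    also have "\<dots> = fourier_series ?c z"
      unfolding fourier_series_def
      using infsum_reindex_bij_betw[OF bij, of "\<lambda>k. fourier \<phi> k * z powi (- k)"] by simp
    finally show ?thesis
      using fourier_series_fourier[OF assms, of "cnj z"] z by (simp add: reflect_def)
  qed
  then have "fourier (reflect \<phi>) k = fourier (fourier_series ?c) k" by (rule fourier_cong)
  then show ?thesis by (simp add: fourier_fourier_series[OF c])
qed

section \<open>Symbols of shift invariant matrices\<close>

text \<open>The intrinsic description of Laurent matrices. It passes to products and exponentials at
  once, so exponentials are known to be Laurent matrices without computing their
  coefficients.\<close>

definition shift_invariant :: "(int \<times> 'n) bmat \<Rightarrow> bool" where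
  "shift_invariant X \<longleftrightarrow> (\<forall>m j k \<alpha> \<beta>. entry X (j + m, \<alpha>) (k + m,
      \<beta>) = entry X (j, \<alpha>) (k, \<beta>))"

lemma shift_invariantD: "shift_invariant X \<Longrightarrow> entry X (j + m, \<alpha>) (k + m, \<beta>) = entry
    X (j, \<alpha>) (k, \<beta>)"
  by (simp add: shift_invariant_def)

lemma bij_shift: "bij (\<lambda>p. (fst p + m, snd p) :: int \<times> 'n)"
  by (rule bij_betw_byWitness[where f' = "\<lambda>p. (fst p - m, snd p)"]) auto

lemma shift_invariant_mult:
  assumes "shift_invariant X" "shift_invariant Y"
  shows "shift_invariant (X * Y)"
  unfolding shift_invariant_def
proof (intro allI)
  fix m j k \<alpha> \<beta>
  have "entry X (j + m, \<alpha>) (fst p + m, snd p) * entry Y (fst p + m, snd p) (k + m, \<beta>) =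
      entry X (j, \<alpha>) p * entry Y p (k, \<beta>)" for p
    using shift_invariantD[OF assms(1), of j m \<alpha> "fst p" "snd p"]
      shift_invariantD[OF assms(2), of "fst p" m "snd p" k \<beta>] by simp
  then show "entry (X * Y) (j + m, \<alpha>) (k + m, \<beta>) = entry (X * Y) (j, \<alpha>) (k, \<beta>)"
    using infsum_reindex_bij_betw[OF bij_shift[of m], of "\<lambda>p. entry X (j + m, \<alpha>) p * entry Y p
        (k + m, \<beta>)"]
    by (simp add: times_bmat.rep_eq)
qed

lemma shift_invariant_power: "shift_invariant X \<Longrightarrow> shift_invariant (X ^ m)"
  by (induction m) (auto simp: shift_invariant_mult, simp add: shift_invariant_def)

lemma shift_invariant_exp: "shift_invariant X \<Longrightarrow> shift_invariant (exp X)"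
  unfolding shift_invariant_def
  using shift_invariantD[OF shift_invariant_power] entry_exp_sums[of X]
  by (metis (no_types, lifting) shift_invariant_def sums_cong sums_unique2)

lemma shift_invariant_uminus: "shift_invariant X \<Longrightarrow> shift_invariant (- X)"
  and shift_invariant_add: "shift_invariant X \<Longrightarrow> shift_invariant Y \<Longrightarrow>
      shift_invariant (X + Y)"
  by (auto simp: shift_invariant_def)

lemma shift_invariant_laurent:
  fixes c :: "int \<Rightarrow> 'n::finite \<Rightarrow> 'n \<Rightarrow> complex"
  shows "wiener c \<Longrightarrow> shift_invariant (laurent c)"
  by (simp add: shift_invariant_def entry_laurent)

text \<open>A shift invariant matrix maps the bounded sequence \<open>k \<mapsto> z powi (- k)\<close>, with
  values in a coordinate axis, to a combination of sequences of the same form. The symbol at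
  \<open>z\<close> collects the coefficients.\<close>

definition wave :: "complex \<Rightarrow> 'n \<Rightarrow> int \<times> 'n \<Rightarrow> complex" where
  "wave z \<beta> p = of_bool (snd p = \<beta>) * z powi (- fst p)"

definition symbol :: "(int \<times> 'n) bmat \<Rightarrow> complex \<Rightarrow> complex^'n^'n" where
  "symbol X z = (\<chi> \<alpha> \<beta>. \<Sum>\<^sub>\<infinity>p. entry X (0, \<alpha>) p * wave z \<beta> p)"

lemma cmod_wave_le: "z \<in> sphere 0 1 \<Longrightarrow> cmod (wave z \<beta> p) \<le> 1"
  by (auto simp: wave_def norm_mult norm_power_int of_bool_def)

lemma wave_summable:
  assumes "z \<in> sphere 0 1"
  shows "(\<lambda>p. cmod (entry X q p * wave z \<beta> p)) summable_on UNIV"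
    and "(\<lambda>p. entry X q p * wave z \<beta> p) summable_on UNIV"
  by (rule summable_mult_bounded[OF entry_row_summable cmod_wave_le[OF assms]])+

text \<open>Shifting the summation by \<open>fst p\<close> moves the row to block 0 and multiplies
  the wave by a power of \<open>z\<close>.\<close>

lemma shift_invariant_wave:
  fixes X :: "(int \<times> 'n::finite) bmat"
  assumes X: "shift_invariant X" and z: "z \<in> sphere 0 1"
  shows "(\<Sum>\<^sub>\<infinity>q. entry X p q * wave z \<beta> q) = z powi (- fst p) * symbol X z $ snd p $
      \<beta>"
proof -
  have z0: "z \<noteq> 0" using z by auto
  have "entry X p (fst q + fst p, snd q) * wave z \<beta> (fst q + fst p, snd q) =
      z powi (- fst p) * (entry X (0, snd p) q * wave z \<beta> q)" for q
    using shift_invariantD[OF X, of 0 "fst p" "snd p" "fst q" "snd q"] z0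
    by (simp add: wave_def power_int_add[symmetric] power_int_diff power_int_minus field_simps
        flip: power_int_add)
  then have "(\<Sum>\<^sub>\<infinity>q. entry X p q * wave z \<beta> q) = (\<Sum>\<^sub>\<infinity>q. z powi
      (- fst p) * (entry X (0, snd p) q * wave z \<beta> q))"
    using infsum_reindex_bij_betw[OF bij_shift[of "fst p"], of "\<lambda>q. entry X p q * wave z \<beta> q"] by simp
  also have "\<dots> = z powi (- fst p) * symbol X z $ snd p $ \<beta>"
    by (simp add: symbol_def infsum_cmult_right')
  finally show ?thesis .
qed

text \<open>By associativity for bounded columns, \<open>X\<close> may be applied to the image of a
  wave under \<open>Y\<close>, which is a combination of waves with the symbol of \<open>Y\<close>
  as coefficients.\<close>

lemma symbol_mult:
  fixes X Y :: "(int \<times> 'n::finite) bmat"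
  assumes Y: "shift_invariant Y" and z: "z \<in> sphere 0 1"
  shows "symbol (X * Y) z = symbol X z ** symbol Y z"
proof (simp add: vec_eq_iff, intro allI)
  fix \<alpha> \<beta>
  have "symbol (X * Y) z $ \<alpha> $ \<beta> = (\<Sum>\<^sub>\<infinity>p. entry X (0, \<alpha>) p *
      (\<Sum>\<^sub>\<infinity>q. entry Y p q * wave z \<beta> q))"
    by (simp add: symbol_def times_bmat.rep_eq
        schur_mult_assoc[OF entry_row_summable schur_le_norm_bmat cmod_wave_le[OF z]])
  also have "\<dots> = (\<Sum>\<^sub>\<infinity>p. \<Sum>\<gamma>\<in>UNIV. entry X (0, \<alpha>) p * wave z
      \<gamma> p * symbol Y z $ \<gamma> $ \<beta>)"
    unfolding shift_invariant_wave[OF Y z]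
    by (simp add: wave_def of_bool_def if_distrib if_distribR mult_ac cong: if_cong)
  also have "\<dots> = (\<Sum>\<gamma>\<in>UNIV. \<Sum>\<^sub>\<infinity>p. entry X (0, \<alpha>) p * wave z
      \<gamma> p * symbol Y z $ \<gamma> $ \<beta>)"
    by (rule infsum_finite_sum) (auto intro!: summable_on_cmult_left wave_summable[OF z])
  also have "\<dots> = (symbol X z ** symbol Y z) $ \<alpha> $ \<beta>"
    by (simp add: matrix_matrix_mult_def symbol_def infsum_cmult_left')
  finally show "symbol (X * Y) z $ \<alpha> $ \<beta> = (symbol X z ** symbol Y z) $ \<alpha> $ \<beta>" .
qed

lemma symbol_1: "symbol (1 :: (int \<times> 'n::finite) bmat) z = mat 1"
proof (simp add: vec_eq_iff, intro allI)
  fix \<alpha> \<beta> :: 'n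
  have "(\<Sum>\<^sub>\<infinity>p. of_bool ((0, \<alpha>) = p) * wave z \<beta> p) =
      (\<Sum>\<^sub>\<infinity>p\<in>{(0, \<alpha>)}. wave z \<beta> p)"
    by (rule infsum_cong_neutral) auto
  then show "symbol (1 :: (int \<times> 'n) bmat) z $ \<alpha> $ \<beta> = mat 1 $ \<alpha> $ \<beta>"
    by (simp add: symbol_def wave_def mat_def)
qed

lemma bounded_linear_symbol:
  fixes z :: complex
  assumes z: "z \<in> sphere 0 1"
  shows "bounded_linear (\<lambda>X :: (int \<times> 'n::finite) bmat. symbol X z $ \<alpha> $ \<beta>)"
proof (rule bounded_linear_intro[where K = 1])
  fix X Y :: "(int \<times> 'n) bmat" and r :: real
  show "symbol (X + Y) z $ \<alpha> $ \<beta> = symbol X z $ \<alpha> $ \<beta> + symbol Y z $ \<alpha> $ \<beta>"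
    by (simp add: symbol_def distrib_right infsum_add wave_summable[OF z])
  show "symbol (r *\<^sub>R X) z $ \<alpha> $ \<beta> = r *\<^sub>R symbol X z $ \<alpha> $ \<beta>"
    by (simp add: symbol_def infsum_scaleR_right)
  have "cmod (\<Sum>\<^sub>\<infinity>p. entry X (0, \<alpha>) p * wave z \<beta> p) \<le>
      (\<Sum>\<^sub>\<infinity>p. cmod (entry X (0, \<alpha>) p * wave z \<beta> p))"
    by (rule norm_infsum_bound[OF wave_summable(1)[OF z]])
  also have "\<dots> \<le> (\<Sum>\<^sub>\<infinity>p. cmod (entry X (0, \<alpha>) p))"
    using mult_left_mono[OF cmod_wave_le[OF z] norm_ge_zero]
    by (intro infsum_mono wave_summable[OF z] entry_row_summable) (simp add: norm_mult)
  also have "\<dots> \<le> norm X" by (rule schur_le_infsum(1)[OF schur_le_norm_bmat])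
  finally show "norm (symbol X z $ \<alpha> $ \<beta>) \<le> norm X * 1" by (simp add: symbol_def)
qed

text \<open>Multiplicativity handles the powers, and norm continuity of each component of the symbol
  carries the series over.\<close>

lemma symbol_exp:
  fixes X :: "(int \<times> 'n::finite) bmat"
  assumes X: "shift_invariant X" and z: "z \<in> sphere 0 1"
  shows "symbol (exp X) z = matrix_exp (symbol X z)"
proof -
  have pow: "symbol (X ^ m) z = (((**) (symbol X z)) ^^ m) (mat 1)" for m
    by (induction m) (auto simp: symbol_1 symbol_mult[OF shift_invariant_power[OF X] z])
  have "(\<lambda>m. symbol (X ^ m /\<^sub>R fact m) z $ \<alpha> $ \<beta>) sums symbol (exp X) z $ \<alpha> $
      \<beta>" for \<alpha> \<beta>
    by (rule bounded_linear.sums[OF bounded_linear_symbol[OF z] exp_converges])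
  then have "(\<lambda>m. ((1 / fact m) *\<^sub>R (((**) (symbol X z)) ^^ m) (mat 1)) $ \<alpha> $ \<beta>)
      sums symbol (exp X) z $ \<alpha> $ \<beta>" for \<alpha> \<beta>
    by (simp add: linear_cmul[OF bounded_linear.linear[OF bounded_linear_symbol[OF z]]] pow inverse_eq_divide)
  then have "(\<lambda>m. (1 / fact m) *\<^sub>R (((**) (symbol X z)) ^^ m) (mat 1)) sums symbol (exp X) z"
    unfolding sums_def by (intro vec_tendstoI) (simp add: sum_component)
  then show ?thesis by (simp add: matrix_exp_def sums_iff)
qed

lemma symbol_eq_fourier_series:
  fixes X :: "(int \<times> 'n::finite) bmat"
  assumes X: "shift_invariant X" and z: "z \<in> sphere 0 1"
  shows "symbol X z $ \<alpha> $ \<beta> = fourier_series (\<lambda>k. entry X (k, \<alpha>) (0, \<beta>)) z"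
proof -
  \<comment> \<open>Row 0 and column \<open>k\<close> hold the coefficient of index
    \<open>- k\<close>, which matches the exponent in \<open>wave\<close>.\<close>
  have "entry X (0, \<alpha>) (k, \<beta>) = entry X (- k, \<alpha>) (0, \<beta>)" for k
    using shift_invariantD[OF X, of "- k" k \<alpha> 0 \<beta>] by simp
  then have "symbol X z $ \<alpha> $ \<beta> = (\<Sum>\<^sub>\<infinity>k. entry X (- k, \<alpha>) (0, \<beta>)
      * z powi (- k))"
    by (simp add: symbol_def infsum_int_times_finite[OF wave_summable(2)[OF z]])
      (simp add: wave_def of_bool_def if_distrib if_distribR cong: if_cong)
  also have "\<dots> = fourier_series (\<lambda>k. entry X (k, \<alpha>) (0, \<beta>)) z"
    unfolding fourier_series_def
    using infsum_reindex_bij_betw[OF bij_uminus, of "\<lambda>k. entry X (k, \<alpha>) (0, \<beta>) * z powi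
        k"] by simp
  finally show ?thesis .
qed

text \<open>Applied to \<open>exp L\<close>, this yields the Fourier coefficients of the pointwise
  exponential without any analysis of that function itself.\<close>

lemma fourier_symbol:
  fixes X :: "(int \<times> 'n::finite) bmat"
  assumes X: "shift_invariant X"
  shows "fourier (\<lambda>z. symbol X z $ \<alpha> $ \<beta>) k = entry X (k, \<alpha>) (0, \<beta>)"
proof -
  have "(\<lambda>k. cmod (entry X (k, \<alpha>) (0, \<beta>))) summable_on UNIV"
  proof -
    have "(\<lambda>p. cmod (entry X p (0, \<beta>))) summable_on range (\<lambda>k. (k, \<alpha>))"
      by (rule summable_on_subset_banach[OF entry_column_summable]) simp
    then show ?thesis by (subst (asm) summable_on_reindex) (auto simp: inj_def o_def)
  qed
  from fourier_fourier_series[OF this, of k] show ?thesis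
    using fourier_cong[of "\<lambda>z. symbol X z $ \<alpha> $ \<beta>", OF symbol_eq_fourier_series[OF X]] by simp
qed

section \<open>Comparison with operators on sequences\<close>

lemma infsum_vec_nth:
  fixes f :: "'a \<Rightarrow> complex^'n"
  assumes "\<And>i. (\<lambda>x. f x $ i) summable_on A"
  shows "infsum f A $ i = (\<Sum>\<^sub>\<infinity>x\<in>A. f x $ i)"
proof -
  have "(f has_sum (\<chi> i. \<Sum>\<^sub>\<infinity>x\<in>A. f x $ i)) A"
    unfolding has_sum_def
    by (rule vec_tendstoI) (use infsum_tendsto[OF assms] in \<open>simp add: sum_component\<close>)
  then show ?thesis by (simp add: infsumI)
qed

lemma infsum_nonneg_int: "(\<Sum>\<^sub>\<infinity>k\<in>{0..}. f k) = (\<Sum>\<^sub>\<infinity>n::nat. f (int n))"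
proof -
  have "range int = {0..}" by (auto simp: image_iff) (metis nat_0_le)
  then show ?thesis using infsum_reindex[of int UNIV f] by (simp add: o_def)
qed

lemma summable_nonneg_int: "f summable_on {0..} \<longleftrightarrow> (\<lambda>n::nat. f (int n)) summable_on UNIV"
proof -
  have "range int = {0..}" by (auto simp: image_iff) (metis nat_0_le)
  then show ?thesis using summable_on_reindex[of int UNIV f] by (simp add: o_def)
qed

lemma std_basis_infsum:
  fixes M :: "nat \<Rightarrow> complex^'n^'n"
  shows "(\<Sum>\<^sub>\<infinity>l. M l *v std_basis (k, \<beta>) l) $ \<gamma> = M k $ \<gamma> $ \<beta>"
proof -
  have "(\<Sum>\<^sub>\<infinity>l. M l *v std_basis (k, \<beta>) l) = (\<Sum>\<^sub>\<infinity>l\<in>{k}. M l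
      *v axis \<beta> 1)"
    by (rule infsum_cong_neutral) (auto simp: std_basis_def)
  then show ?thesis
    by (simp add: matrix_vector_mult_def axis_def if_distrib[where f = "\<lambda>x. _ * x"] cong: if_cong)
qed

lemma compression_entry:
  fixes X Y :: "(int \<times> 'n::finite) bmat"
  assumes "shift_invariant X" "shift_invariant Y"
  shows "(\<lambda>l::nat. \<Sum>\<gamma>\<in>UNIV. entry X (int j - int l, \<alpha>) (0, \<gamma>) * entry Y
      (int l - int k, \<gamma>) (0, \<beta>)) summable_on UNIV"
    and "(\<Sum>\<^sub>\<infinity>l::nat. \<Sum>\<gamma>\<in>UNIV. entry X (int j - int l, \<alpha>) (0,
        \<gamma>) * entry Y (int l - int k, \<gamma>) (0, \<beta>)) =
    entry (proj pos * X * proj pos * Y * proj pos) (int j, \<alpha>) (int k, \<beta>)"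
proof -
  let ?f = "\<lambda>l. \<Sum>\<gamma>\<in>UNIV. entry X (int j, \<alpha>) (l, \<gamma>) * entry Y (l,
      \<gamma>) (int k, \<beta>)"
  have e: "entry X (int j - l, \<alpha>) (0, \<gamma>) = entry X (int j, \<alpha>) (l, \<gamma>)"
    "entry Y (l - int k, \<gamma>) (0, \<beta>) = entry Y (l, \<gamma>) (int k, \<beta>)" for l \<gamma>
    using shift_invariantD[OF assms(1), of "int j - l" l \<alpha> 0 \<gamma>]
      shift_invariantD[OF assms(2), of "l - int k" "int k" \<gamma> 0 \<beta>] by simp_all
  have "(\<lambda>l. ?f l) summable_on UNIV"
    using summable_on_Sigma_banach[of "\<lambda>l \<gamma>. entry X (int j, \<alpha>) (l, \<gamma>) * entry Y
        (l, \<gamma>) (int k, \<beta>)" UNIV "\<lambda>_. UNIV"]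
      entry_mult_summable(2)[of X "(int j, \<alpha>)" Y "(int k, \<beta>)"]
    by (simp add: case_prod_unfold)
  then have "(\<lambda>l. ?f l) summable_on {0..}" by (rule summable_on_subset_banach) simp
  then show "(\<lambda>l::nat. \<Sum>\<gamma>\<in>UNIV. entry X (int j - int l, \<alpha>) (0, \<gamma>) * entry
      Y (int l - int k, \<gamma>) (0, \<beta>)) summable_on UNIV"
    by (simp add: e summable_nonneg_int)
  have "entry (proj pos * X * proj pos * Y * proj pos) (int j, \<alpha>) (int k, \<beta>) =
      entry (X * (proj pos * Y)) (int j, \<alpha>) (int k, \<beta>)"
    unfolding entry_mult_proj by (simp add: mult.assoc entry_proj_mult pos_def)
  also have "\<dots> = (\<Sum>\<^sub>\<infinity>l. of_bool (0 \<le> l) * ?f l)"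
    unfolding entry_mult_int_times_finite[of X] entry_proj_mult
    by (simp add: pos_def sum_distrib_left mult_ac)
  also have "\<dots> = (\<Sum>\<^sub>\<infinity>l\<in>{0..}. ?f l)" by (rule infsum_cong_neutral) auto
  finally show "(\<Sum>\<^sub>\<infinity>l::nat. \<Sum>\<gamma>\<in>UNIV. entry X (int j - int l, \<alpha>) (0,
      \<gamma>) * entry Y (int l - int k, \<gamma>) (0, \<beta>)) =
    entry (proj pos * X * proj pos * Y * proj pos) (int j, \<alpha>) (int k, \<beta>)"
    by (simp add: e infsum_nonneg_int)
qed

lemma op_entry_toeplitz_product:
  fixes X Y :: "(int \<times> 'n::finite) bmat"
  assumes X: "shift_invariant X" and Y: "shift_invariant Y"
    and \<phi>: "\<And>k. matrix_fourier \<phi> k = (\<chi> \<alpha> \<beta>. entry X (k, \<alpha>) (0, \<beta>))"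
    and \<psi>: "\<And>k. matrix_fourier \<psi> k = (\<chi> \<alpha> \<beta>. entry Y (k, \<alpha>) (0, \<beta>))"
  shows "op_entry (toeplitz \<phi> \<circ> toeplitz \<psi>) (j, \<alpha>) (k, \<beta>) =
    entry (proj pos * X * proj pos * Y * proj pos) (int j, \<alpha>) (int k, \<beta>)"
proof -
  let ?g = "\<lambda>l::nat. matrix_fourier \<phi> (int j - int l) *v toeplitz \<psi> (std_basis (k, \<beta>)) l"
  have "toeplitz \<psi> (std_basis (k, \<beta>)) l $ \<gamma> = entry Y (int l - int k, \<gamma>) (0, \<beta>)"
      for l \<gamma>
    by (simp add: toeplitz_def std_basis_infsum \<psi>)
  then have g: "?g l $ \<delta> = (\<Sum>\<gamma>\<in>UNIV. entry X (int j - int l, \<delta>) (0, \<gamma>) *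
      entry Y (int l - int k, \<gamma>) (0, \<beta>))" for l \<delta>
    by (simp add: matrix_vector_mult_def \<phi>)
  have "op_entry (toeplitz \<phi> \<circ> toeplitz \<psi>) (j, \<alpha>) (k, \<beta>) = infsum ?g UNIV $ \<alpha>"
    by (simp add: op_entry_def toeplitz_def[of \<phi>])
  also have "\<dots> = (\<Sum>\<^sub>\<infinity>l. ?g l $ \<alpha>)"
    by (rule infsum_vec_nth) (unfold g, rule compression_entry(1)[OF X Y])
  finally show ?thesis unfolding g compression_entry(2)[OF X Y] .
qed

lemma det_on_zero_row:
  assumes "finite S" "i \<in> S" "\<And>j. M i j = 0"
  shows "det_on M S = 0"
  using det_on_diag_rows[of "{i}" "S - {i}" M "\<lambda>_. 0"] assms by (simp add: insert_absorb)

text \<open>A finite set not contained in \<open>pos\<close> gives a minor with a zero row. The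
  other finite sets are the images of finite sets of natural indices, and their minors
  agree.\<close>

lemma op_det_eq_fredholm_det:
  fixes A :: "'n::finite seq_operator" and K :: "(int \<times> 'n) bmat"
  assumes K: "\<And>j \<alpha> k \<beta>. op_entry A (j, \<alpha>) (k, \<beta>) - of_bool ((j, \<alpha>) = (k,
      \<beta>)) = entry K (int j, \<alpha>) (int k, \<beta>)"
    and supp: "\<And>p q. p \<notin> pos \<Longrightarrow> entry K p q = 0"
  shows "op_det A = fredholm_det (entry K)"
proof -
  define \<iota> :: "nat \<times> 'n \<Rightarrow> int \<times> 'n" where "\<iota> = (\<lambda>p. (int (fst p),
      snd p))"
  have inj: "inj \<iota>" by (auto simp: inj_def \<iota>_def prod_eq_iff)
  have range: "range \<iota> = pos"
  proof (intro set_eqI iffI)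
    fix p :: "int \<times> 'n" assume "p \<in> pos"
    then have "p = \<iota> (nat (fst p), snd p)" by (simp add: \<iota>_def pos_def)
    then show "p \<in> range \<iota>" by blast
  qed (auto simp: \<iota>_def pos_def)
  have ent: "op_entry (\<lambda>f j. A f j - f j) p q = entry K (\<iota> p) (\<iota> q)" for p q
  proof -
    have "op_entry (\<lambda>f j. A f j - f j) p q = op_entry A p q - std_basis q (fst p) $ snd p"
      by (simp add: op_entry_def)
    also have "std_basis q (fst p) $ snd p = of_bool (p = q)"
      by (auto simp: std_basis_def axis_def prod_eq_iff)
    finally show ?thesis using K[of "fst p" "snd p" "fst q" "snd q"] by (simp add: \<iota>_def)
  qed
  have minor: "principal_minor (\<lambda>f j. A f j - f j) S = det_on (entry K) (\<iota> ` S)" if "finite S" for S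
  proof -
    have "principal_minor (\<lambda>f j. A f j - f j) S = det_on (\<lambda>p q. entry K (\<iota> p) (\<iota> q)) S"
      by (simp add: principal_minor_def det_on_def ent)
    also have "\<dots> = det_on (entry K) (\<iota> ` S)"
      using inj that by (intro det_on_reindex) (auto intro: inj_on_subset)
    finally show ?thesis .
  qed
  have "fredholm_det (entry K) = infsum (det_on (entry K)) {S. finite S \<and> S \<subseteq> pos}"
    unfolding fredholm_det_def
  proof (rule infsum_cong_neutral)
    fix S :: "(int \<times> 'n) set" assume "S \<in> {S. finite S} - {S. finite S \<and> S \<subseteq> pos}"
    then obtain p where "p \<in> S" "p \<notin> pos" "finite S" by auto
    then show "det_on (entry K) S = 0" using supp by (intro det_on_zero_row[of S p]) auto
  qed auto
  also have "{S. finite S \<and> S \<subseteq> pos} = (`) \<iota> ` {S. finite S}"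
    unfolding range[symmetric] by (auto simp: image_iff) (metis finite_subset_image)
  also have "infsum (det_on (entry K)) \<dots> = infsum (det_on (entry K) \<circ> (`) \<iota>) {S. finite S}"
    by (rule infsum_reindex) (use inj in \<open>auto simp: inj_on_def inj_image_eq_iff\<close>)
  also have "\<dots> = op_det A"
    unfolding op_det_def by (rule infsum_cong) (simp add: minor)
  finally show ?thesis ..
qed

lemma matrix_inv_eqI:
  fixes A B :: "complex^'n^'n"
  assumes "A ** B = mat 1" "B ** A = mat 1"
  shows "matrix_inv A = B"
proof -
  have "A ** matrix_inv A = mat 1 \<and> matrix_inv A ** A = mat 1"
    unfolding matrix_inv_def by (rule someI[of _ B]) (use assms in simp)
  then have "matrix_inv A = (B ** A) ** matrix_inv A" "B ** (A ** matrix_inv A) = B"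
    using assms by simp_all
  then show ?thesis by (simp add: matrix_mul_assoc)
qed

lemma E_det_matrix_exp:
  fixes L :: "(int \<times> 'n::finite) bmat" and P :: "complex \<Rightarrow> complex^'n^'n"
  assumes L: "shift_invariant L" and P: "\<And>z. z \<in> sphere 0 1 \<Longrightarrow> P z = symbol L z"
  shows "E_det (\<lambda>z. matrix_exp (P z)) = widom_det L"
proof -
  interpret PW: complementary_projections "proj pos" "proj (- pos) :: (int \<times> 'n) bmat"
    by (rule complementary_projections_proj)
  note L' = shift_invariant_uminus[OF L]
  note E = shift_invariant_exp[OF L] and E' = shift_invariant_exp[OF L']
  have \<phi>: "matrix_exp (P z) = symbol (exp L) z" if "z \<in> sphere 0 1" for z
    using symbol_exp[OF L that] P[OF that] by simp
  \<comment> \<open>Since \<open>exp L\<close> and \<open>exp (- L)\<close> are inverse in the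
    algebra, multiplicativity makes their symbols inverse matrices at every point of the
    circle.\<close>
  have \<psi>: "matrix_inv (matrix_exp (P z)) = symbol (exp (- L)) z" if z: "z \<in> sphere 0 1" for z
    unfolding \<phi>[OF z]
    by (rule matrix_inv_eqI) (simp_all add: symbol_mult[OF E z, symmetric] symbol_mult[OF E' z, symmetric]
        exp_cancel symbol_1)
  have m\<phi>: "matrix_fourier (\<lambda>z. matrix_exp (P z)) k = (\<chi> \<alpha> \<beta>. entry (exp L) (k,
      \<alpha>) (0, \<beta>))" for k
    unfolding matrix_fourier_def fourier_symbol[OF E, symmetric]
    by (simp add: vec_eq_iff) (intro allI fourier_cong, simp add: \<phi>)
  have m\<psi>: "matrix_fourier (\<lambda>z. matrix_inv (matrix_exp (P z))) k = (\<chi> \<alpha> \<beta>. entry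
      (exp (- L)) (k, \<alpha>) (0, \<beta>))" for k
    unfolding matrix_fourier_def fourier_symbol[OF E', symmetric]
    by (simp add: vec_eq_iff) (intro allI fourier_cong, simp add: \<psi>)
  show ?thesis
    unfolding E_det_def widom_det_def
  proof (rule op_det_eq_fredholm_det)
    fix j k :: nat and \<alpha> \<beta> :: 'n
    show "op_entry (toeplitz (\<lambda>z. matrix_exp (P z)) \<circ> toeplitz (\<lambda>z. matrix_inv
        (matrix_exp (P z)))) (j, \<alpha>) (k, \<beta>)
        - of_bool ((j, \<alpha>) = (k, \<beta>)) =
      entry (- (proj pos * exp L * proj (- pos) * exp (- L) * proj pos)) (int j, \<alpha>) (int k, \<beta>)"
      unfolding op_entry_toeplitz_product[OF E E' m\<phi> m\<psi>] PW.compression_mult_inverse[OF exp_cancel(1)]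
      by (simp add: entry_proj pos_def)
  next
    fix p q :: "int \<times> 'n" assume "p \<notin> pos"
    then show "entry (- (proj pos * exp L * proj (- pos) * exp (- L) * proj pos)) p q = 0"
      by (simp add: mult.assoc entry_proj_mult)
  qed
qed

section \<open>The identity for symbols\<close>

text \<open>Without truncation the product need not have absolutely summable entries. Its diagonal
  still does, since diagonal entries are minors of order one of a product of Hilbert-Schmidt
  blocks.\<close>

lemma offdiagonal_diagonal_summable:
  fixes X Y :: "'a bmat"
  assumes "hs_le (entry (proj A * Y * proj (- A))) c" "hs_le (entry (proj (- A) * X * proj A)) d"
  shows "(\<lambda>p. entry (proj A * Y * proj (- A) * X * proj A) p p) summable_on UNIV"
proof (rule abs_summable_summable, rule Infinite_Sum.abs_summable_on_comparison_test'[OF hs_bound_summable[OF assms]])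
  fix p
  have "proj A * Y * proj (- A) * X * proj A = (proj A * Y * proj (- A)) * (proj (- A) * X * proj A)"
    using proj_mult_proj[of "- A" "- A"] by (simp add: mult.assoc) (simp flip: mult.assoc)
  then show "cmod (entry (proj A * Y * proj (- A) * X * proj A) p p) \<le>
      hs_bound (entry (proj A * Y * proj (- A))) (entry (proj (- A) * X * proj A)) p"
    using cmod_det_on_mult_le[OF assms(1) _ assms(2), of "proj A * Y * proj (- A)" "proj (- A) * X * proj A" "{p}"]
    by simp
qed

lemma infsum_negative_int: "(\<Sum>\<^sub>\<infinity>k\<in>{..<0}. f k) = (\<Sum>\<^sub>\<infinity>n::nat. f (-
    int n - 1))"
proof -
  have "range (\<lambda>n. - int n - 1) = {..<0}"
  proof (intro set_eqI iffI)
    fix k :: int assume "k \<in> {..<0}"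
    then have "k = - int (nat (- k - 1)) - 1" by simp
    then show "k \<in> range (\<lambda>n. - int n - 1)" by blast
  qed auto
  then show ?thesis using infsum_reindex[of "\<lambda>n. - int n - 1" UNIV f] by (simp add: o_def inj_def)
qed

lemma trace_scalar_offdiagonal:
  assumes a: "(\<lambda>k. cmod (a k)) summable_on UNIV" "(\<lambda>k. of_int \<bar>k\<bar> * (cmod (a
      k))\<^sup>2) summable_on UNIV"
  defines "s \<equiv> scalar_symbol a :: int \<Rightarrow> 'n::finite \<Rightarrow> 'n \<Rightarrow> complex"
  shows "fredholm_trace (entry (proj pos * laurent (restrict_symbol {0..} s) * proj (- pos) *
      laurent (restrict_symbol {..<0} s) * proj pos)) =
    of_nat CARD('n) * (\<Sum>\<^sub>\<infinity>j::nat. \<Sum>\<^sub>\<infinity>n::nat. a (int j + int n + 1) *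
        a (- (int j + int n + 1)))"
proof -
  let ?P = "proj pos :: (int \<times> 'n) bmat" and ?W = "proj (- pos) :: (int \<times> 'n) bmat"
  let ?Y = "laurent (restrict_symbol {0..} s)" and ?X = "laurent (restrict_symbol {..<0} s)"
  have ks: "krein s" unfolding s_def by (rule krein_scalar_symbol[OF a])
  then have ws: "wiener s" by (simp add: krein_def)
  have kr: "krein (restrict_symbol K s)" for K
    unfolding s_def restrict_scalar_symbol
  proof (rule krein_scalar_symbol)
    show "(\<lambda>k. cmod (of_bool (k \<in> K) * a k)) summable_on UNIV"
      by (rule Infinite_Sum.abs_summable_on_comparison_test'[OF a(1)]) auto
    show "(\<lambda>k. of_int \<bar>k\<bar> * (cmod (of_bool (k \<in> K) * a k))\<^sup>2) summable_on UNIV"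
      by (rule summable_on_comparison_test[OF a(2)]) (auto simp: of_bool_def)
  qed
  have hs_abs: "hs_le (entry (proj A * laurent c * proj B)) e"
    if "hs_le (entry (proj A * bmat_abs (laurent c) * proj B)) e" for A B e and c :: "int \<Rightarrow> 'n
        \<Rightarrow> 'n \<Rightarrow> complex"
    using that by (simp add: hs_le_def entry_mult_proj entry_proj_mult entry_bmat_abs norm_mult)
  obtain c d where "hs_le (entry (?P * bmat_abs ?Y * ?W)) c" "hs_le (entry (?W * bmat_abs ?X * ?P)) d"
    using hs_le_laurent[OF kr] by metis
  note summ = offdiagonal_diagonal_summable[OF hs_abs[OF this(1)] hs_abs[OF this(2)]]
  let ?h = "\<lambda>j. \<Sum>\<^sub>\<infinity>n::nat. a (j + int n + 1) * a (- (j + int n + 1))"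
  have ent: "entry (?P * ?Y * ?W * ?X * ?P) (j, \<alpha>) (j, \<alpha>) = of_bool (0 \<le> j) * ?h j" for j \<alpha>
  proof (cases "0 \<le> j")
    case True
    have "(\<Sum>\<^sub>\<infinity>k\<in>{..<0}. \<Sum>\<gamma>\<in>UNIV. restrict_symbol {0..} s (j - k)
        \<alpha> \<gamma> * restrict_symbol {..<0} s (k - j) \<gamma> \<alpha>) =
        (\<Sum>\<^sub>\<infinity>k\<in>{..<0}. a (j - k) * a (k - j))"
      using True
      by (intro infsum_cong)
        (simp add: restrict_symbol_def s_def scalar_symbol_def of_bool_def if_distrib if_distribR cong: if_cong)
    \<comment> \<open>The enumeration \<open>k = - n - 1\<close> of the negative integers produces
      the offset 1 of the Hankel indices.\<close>
    also have "\<dots> = ?h j"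
    proof -
      have "j - (- int n - 1) = j + int n + 1" "- int n - 1 - j = - (j + int n + 1)" for n by simp_all
      then show ?thesis unfolding infsum_negative_int by (simp only:)
    qed
    finally show ?thesis by (simp add: entry_offdiagonal_block wiener_restrict_symbol ws)
  qed (simp add: entry_offdiagonal_block wiener_restrict_symbol ws)
  \<comment> \<open>The diagonal entries do not depend on the component within a block, whence the
    factor \<open>CARD('n)\<close>.\<close>
  have "fredholm_trace (entry (?P * ?Y * ?W * ?X * ?P)) = (\<Sum>\<^sub>\<infinity>j. of_nat CARD('n) *
      (of_bool (0 \<le> j) * ?h j))"
    unfolding fredholm_trace_def infsum_int_times_finite[OF summ] ent by simp
  also have "\<dots> = of_nat CARD('n) * (\<Sum>\<^sub>\<infinity>j. of_bool (0 \<le> j) * ?h j)" by (rule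
      infsum_cmult_right')
  also have "(\<Sum>\<^sub>\<infinity>j. of_bool (0 \<le> j) * ?h j) = (\<Sum>\<^sub>\<infinity>j\<in>{0..}. ?h
      j)" by (rule infsum_cong_neutral) auto
  finally show ?thesis by (simp add: infsum_nonneg_int)
qed

lemma matrix_fourier_mat_1: "matrix_fourier (\<lambda>z. mat (a z) :: complex^1^1) k $ i $ j = fourier a k"
proof -
  have "i = j" by (simp add: num1_eq_iff)
  then show ?thesis by (simp add: matrix_fourier_def mat_def)
qed

text \<open>Reflection negates the index of a coefficient, so row \<open>j\<close> pairs the
  coefficients of index \<open>j + n + 1\<close> with those of the opposite index, as in the trace
  of the Laurent blocks.\<close>

lemma op_trace_hankel_product:
  assumes a: "a \<in> krein_algebra"
  shows "op_trace (scalar_hankel a \<circ> scalar_hankel (reflect a)) =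
    (\<Sum>\<^sub>\<infinity>j::nat. \<Sum>\<^sub>\<infinity>n::nat. fourier a (int j + int n + 1) * fourier a
        (- (int j + int n + 1)))"
proof -
  have ca: "continuous_on (sphere 0 1) a" and sa: "(\<lambda>k. cmod (fourier a k)) summable_on UNIV"
    using a by (auto simp: krein_algebra_def)
  have ent: "op_entry (scalar_hankel a \<circ> scalar_hankel (reflect a)) (j, x) (j, x) =
      (\<Sum>\<^sub>\<infinity>n::nat. fourier a (int j + int n + 1) * fourier a (- (int j + int n + 1)))" for
          j and x :: 1
  proof -
    let ?g = "\<lambda>l::nat. matrix_fourier (\<lambda>z. mat (a z) :: complex^1^1) (int j + int l + 1) *v
      scalar_hankel (reflect a) (std_basis (j, x)) l"
    have "scalar_hankel (reflect a) (std_basis (j, x)) l $ y = fourier a (- (int l + int j + 1))" for l y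
      by (simp add: hankel_def std_basis_infsum matrix_fourier_mat_1 fourier_reflect[OF ca sa])
    then have g: "?g l $ y = fourier a (int j + int l + 1) * fourier a (- (int j + int l + 1))" for l y
      by (simp add: matrix_vector_mult_def matrix_fourier_mat_1 algebra_simps)
    have "(\<lambda>k. cmod (fourier a k)) summable_on range (\<lambda>l::nat. int j + int l + 1)"
      by (rule summable_on_subset_banach[OF sa]) simp
    then have s: "(\<lambda>l::nat. cmod (fourier a (int j + int l + 1))) summable_on UNIV"
      by (subst (asm) summable_on_reindex) (auto simp: inj_def o_def)
    have b: "cmod (fourier a k) \<le> (\<Sum>\<^sub>\<infinity>k. cmod (fourier a k))" for k
      using finite_sum_le_infsum[OF sa, of "{k}"] by simp
    have "op_entry (scalar_hankel a \<circ> scalar_hankel (reflect a)) (j, x) (j, x) = infsum ?g UNIV $ x"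
      by (simp add: op_entry_def hankel_def[of "\<lambda>z. mat (a z)"])
    also have "\<dots> = (\<Sum>\<^sub>\<infinity>l. ?g l $ x)"
      by (rule infsum_vec_nth) (unfold g, rule summable_mult_bounded(3)[OF s b])
    finally show ?thesis unfolding g .
  qed
  have "bij (\<lambda>j::nat. (j, 1::1))"
    by (rule bij_betw_byWitness[where f' = fst]) (auto simp: prod_eq_iff)
  from infsum_reindex_bij_betw[OF this,
      of "\<lambda>p. op_entry (scalar_hankel a \<circ> scalar_hankel (reflect a)) p p"]
  show ?thesis unfolding op_trace_def ent ..
qed

lemma fourier_sum:
  assumes "finite S" "\<And>i. i \<in> S \<Longrightarrow> continuous_on (sphere 0 1) (f i)"
  shows "fourier (\<lambda>z. \<Sum>i\<in>S. f i z) k = (\<Sum>i\<in>S. fourier (f i) k)"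
  using assms
proof (induction S rule: finite_induct)
  case empty
  show ?case by (simp add: fourier_def)
next
  case (insert i S)
  then show ?case by (simp add: fourier_add continuous_on_sum)
qed

theorem corollary2p4:
  fixes Q :: "complex \<Rightarrow> complex^'n^'n" and a :: "complex \<Rightarrow> complex"
  assumes "Q \<in> krein_matrix_algebra"
    and "\<forall>z\<in>sphere 0 1. trace (Q z) = 0"
    and "a \<in> krein_algebra"
  shows "E_det (\<lambda>z. matrix_exp (mat (a z) + Q z)) =
    exp (of_nat CARD('n) * op_trace (scalar_hankel a \<circ> scalar_hankel (reflect a)))
      * E_det (\<lambda>z. matrix_exp (Q z))"
proof -
  define q where "q = (\<lambda>k \<alpha> \<beta>. fourier (\<lambda>z. Q z $ \<alpha> $ \<beta>) k)"
  define s where "s = (scalar_symbol (fourier a) :: int \<Rightarrow> 'n \<Rightarrow> 'n \<Rightarrow> complex)"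
  have Q: "continuous_on (sphere 0 1) (\<lambda>z. Q z $ \<alpha> $ \<beta>)" "(\<lambda>k. cmod (q k \<alpha>
      \<beta>)) summable_on UNIV"
    "(\<lambda>k. of_int \<bar>k\<bar> * (cmod (q k \<alpha> \<beta>))\<^sup>2) summable_on UNIV" for \<alpha> \<beta>
    using assms(1) by (auto simp: krein_matrix_algebra_def krein_algebra_def q_def)
  have a: "continuous_on (sphere 0 1) a" "(\<lambda>k. cmod (fourier a k)) summable_on UNIV"
    "(\<lambda>k. of_int \<bar>k\<bar> * (cmod (fourier a k))\<^sup>2) summable_on UNIV"
    using assms(3) by (auto simp: krein_algebra_def)
  have kq: "krein q" and wq: "wiener q" using Q by (auto simp: krein_def wiener_def)
  have ws: "wiener s" unfolding s_def by (rule wiener_scalar_symbol[OF a(2)])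
  \<comment> \<open>The trace condition holds pointwise on the circle; linearity of the coefficients
    transfers it to every matrix coefficient.\<close>
  have trace_q: "(\<Sum>\<alpha>\<in>UNIV. q k \<alpha> \<alpha>) = 0" for k
  proof -
    have "(\<Sum>\<alpha>\<in>UNIV. q k \<alpha> \<alpha>) = fourier (\<lambda>z. \<Sum>\<alpha>\<in>UNIV. Q z
        $ \<alpha> $ \<alpha>) k"
      unfolding q_def by (rule fourier_sum[symmetric]) (auto intro: Q)
    also have "\<dots> = fourier (\<lambda>z. 0) k"
      by (rule fourier_cong) (use assms(2) in \<open>simp add: trace_def\<close>)
    finally show ?thesis by (simp add: fourier_def)
  qed
  have sym_q: "Q z = symbol (laurent q) z" if z: "z \<in> sphere 0 1" for z
  proof -
    have "fourier_series (\<lambda>k. q k \<alpha> \<beta>) z = Q z $ \<alpha> $ \<beta>" for \<alpha> \<beta>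
      using fourier_series_fourier[OF Q(1) Q(2)[unfolded q_def] z] by (simp add: q_def)
    then show ?thesis
      by (simp add: vec_eq_iff symbol_eq_fourier_series[OF shift_invariant_laurent[OF wq] z] entry_laurent[OF wq])
  qed
  have sym_s: "mat (a z) = symbol (laurent s) z" if z: "z \<in> sphere 0 1" for z
  proof -
    have "fourier_series (\<lambda>k. s k \<alpha> \<beta>) z = mat (a z) $ \<alpha> $ \<beta>" for \<alpha> \<beta>
      using fourier_series_fourier[OF a(1,2) z]
      by (auto simp: s_def scalar_symbol_def mat_def fourier_series_def)
    then show ?thesis
      by (simp add: vec_eq_iff symbol_eq_fourier_series[OF shift_invariant_laurent[OF ws] z] entry_laurent[OF ws])
  qed
  \<comment> \<open>The exponent is a symbol only on the circle, which is all that the Fourier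
    coefficients see.\<close>
  have sym: "mat (a z) + Q z = symbol (laurent s + laurent q) z" if z: "z \<in> sphere 0 1" for z
    unfolding sym_s[OF z] sym_q[OF z]
    by (simp add: vec_eq_iff linear_add[OF bounded_linear.linear[OF bounded_linear_symbol[OF z]]])
  have "E_det (\<lambda>z. matrix_exp (mat (a z) + Q z)) = widom_det (laurent s + laurent q)"
    by (rule E_det_matrix_exp[OF shift_invariant_add[OF shift_invariant_laurent[OF ws]
        shift_invariant_laurent[OF wq]] sym])
  moreover have "E_det (\<lambda>z. matrix_exp (Q z)) = widom_det (laurent q)"
    by (rule E_det_matrix_exp[OF shift_invariant_laurent[OF wq] sym_q])
  moreover have "widom_det (laurent s + laurent q) =
      exp (of_nat CARD('n) * op_trace (scalar_hankel a \<circ> scalar_hankel (reflect a))) * widom_det (laurent q)"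
    unfolding s_def widom_det_scalar_plus[OF a(2,3) kq trace_q] trace_scalar_offdiagonal[OF a(2,3)]
      op_trace_hankel_product[OF assms(3)] ..
  ultimately show ?thesis by simp
qed

end
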